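(* Assume $\alpha\in\ell^6$ and $(S-1)\alpha\in\ell^2$. Then $$\int_0^{2\pi}(1-\cos4\theta)\log w(\theta)\frac{d\theta}{2\pi}>-\infty\iff\alpha\in\ell^4.$$
   Context: $\mu$ is a probability measure with infinite support on the unit circle (identified with $[0,2\pi]$ via $e^{i\theta}\mapsto\theta$), with Lebesgue decomposition $d\mu(\theta)=w(\theta)\frac{d\theta}{2\pi}+d\mu_s(\theta)$. $\Phi_n$ are its monic orthogonal polynomials, and its sequence of Verblunsky coefficients is $\alpha=(\alpha_n)_{n\ge0}$, $\alpha_n=-\overline{\Phi_{n+1}(0)}\in\mathbb{D}$. $S$ is the left shift on sequences, $(S\alpha)_n=\alpha_{n+1}$. The integral is well defined in $[-\infty,\infty)$. *)

theory Defs
  imports "HOL-Probability.Probability_Measure" "HOL-Computational_Algebra.Polynomial"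
begin

definition unit_circle :: "complex measure" where
  "unit_circle = restrict_space borel (sphere 0 1)"

definition support_of :: "complex measure \<Rightarrow> complex set" where
  "support_of \<mu> =
     {z \<in> space \<mu>. \<forall>U. open U \<longrightarrow> z \<in> U \<longrightarrow> emeasure \<mu> (U \<inter> space \<mu>) > 0}"

definition circle_prob :: "complex measure \<Rightarrow> bool" where
  "circle_prob \<mu> \<longleftrightarrow>
     prob_space \<mu> \<and> sets \<mu> = sets unit_circle \<and> infinite (support_of \<mu>)"

(* The measure d theta / (2 pi) on [0, 2 pi]. *)
definition dtheta :: "real measure" where
  "dtheta = scale_measure (ennreal (1 / (2 * pi))) (restrict_space lborel {0..2 * pi})"

(* The measure w(theta) d theta / (2 pi), transported to the circle by theta |-> exp (i theta).
   The endpoints 0 and 2 pi have the same image, but they form a null set. *)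
definition ac_measure :: "(real \<Rightarrow> real) \<Rightarrow> complex measure" where
  "ac_measure w = distr (density dtheta (\<lambda>\<theta>. ennreal (w \<theta>))) unit_circle cis"

(* d mu = w d theta / (2 pi) + d mu_s with mu_s singular to arc length ac_measure (\<lambda>_. 1).
   The density w is an arbitrary nonnegative finite-valued Borel version. *)
definition lebesgue_decomposition ::
    "complex measure \<Rightarrow> (real \<Rightarrow> real) \<Rightarrow> complex measure \<Rightarrow> bool" where
  "lebesgue_decomposition \<mu> w \<mu>s \<longleftrightarrow>
     w \<in> borel_measurable dtheta \<and> (\<forall>\<theta>\<in>{0..2 * pi}. 0 \<le> w \<theta>) \<and>
     sets \<mu>s = sets unit_circle \<and>
     (\<forall>A\<in>sets unit_circle. emeasure \<mu> A = emeasure (ac_measure w) A + emeasure \<mu>s A) \<and>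
     (\<exists>N\<in>sets unit_circle.
        emeasure (ac_measure (\<lambda>_. 1)) N = 0 \<and> emeasure \<mu>s (space unit_circle - N) = 0)"

definition monic_orthogonal_polys :: "complex measure \<Rightarrow> (nat \<Rightarrow> complex poly) \<Rightarrow> bool" where
  "monic_orthogonal_polys \<mu> \<Phi> \<longleftrightarrow>
     (\<forall>n. degree (\<Phi> n) = n \<and> lead_coeff (\<Phi> n) = 1) \<and>
     (\<forall>m n. m \<noteq> n \<longrightarrow> (LINT z|\<mu>. cnj (poly (\<Phi> m) z) * poly (\<Phi> n) z) = 0)"

definition verblunsky :: "(nat \<Rightarrow> complex poly) \<Rightarrow> nat \<Rightarrow> complex" where
  "verblunsky \<Phi> n = - cnj (poly (\<Phi> (Suc n)) 0)"

definition left_shift :: "(nat \<Rightarrow> complex) \<Rightarrow> nat \<Rightarrow> complex" where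
  "left_shift a n = a (Suc n)"

definition in_ell :: "nat \<Rightarrow> (nat \<Rightarrow> complex) \<Rightarrow> bool" where
  "in_ell p a \<longleftrightarrow> summable (\<lambda>n. norm (a n) ^ p)"

(* The logarithm on [0, \<infinity>) with log 0 = -\<infinity>; the library's ln has ln 0 = 0, which would be wrong
   where the density vanishes. *)
definition elog :: "real \<Rightarrow> ereal" where
  "elog x = (if x \<le> 0 then -\<infinity> else ereal (ln x))"

(* The integral of the positive part minus the integral of the negative part (e2ennreal sends
   negative arguments to 0). Meaningful if one of the two is finite: for g log w with g bounded
   and nonnegative, the positive part is at most a multiple of the integrable w. *)
definition ext_integral :: "'a measure \<Rightarrow> ('a \<Rightarrow> ereal) \<Rightarrow> ereal" where
  "ext_integral M f =
     enn2ereal (\<integral>\<^sup>+x. e2ennreal (f x) \<partial>M) - enn2ereal (\<integral>\<^sup>+x. e2ennreal (- f x) \<partial>M)"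

lemma space_unit_circle [simp]: "space unit_circle = sphere 0 1"
  by (simp add: unit_circle_def space_restrict_space)

lemma space_dtheta [simp]: "space dtheta = {0..2 * pi}"
  by (simp add: dtheta_def space_scale_measure space_restrict_space)

lemma sets_dtheta: "sets dtheta = sets (restrict_space borel {0..2 * pi})"
  by (simp add: dtheta_def sets_restrict_space)

lemma cis_measurable_dtheta: "cis \<in> measurable dtheta unit_circle"
proof -
  have "cis \<in> borel_measurable borel"
    by (intro borel_measurable_continuous_onI continuous_intros)
  then have "cis \<in> borel_measurable (restrict_space borel {0..2 * pi})"
    by (rule measurable_restrict_space1)
  then have "cis \<in> borel_measurable dtheta"
    by (simp add: measurable_cong_sets[OF sets_dtheta refl])
  then show ?thesis
    unfolding unit_circle_def by (intro measurable_restrict_space2) auto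
qed

lemma prob_space_dtheta: "prob_space dtheta"
proof
  have "emeasure dtheta (space dtheta) = ennreal (1 / (2 * pi)) * ennreal (2 * pi)"
    by (simp add: dtheta_def space_scale_measure space_restrict_space emeasure_restrict_space)
  also have "\<dots> = 1"
    by (simp flip: ennreal_mult)
  finally show "emeasure dtheta (space dtheta) = 1" .
qed

lemma emeasure_ac_measure:
  assumes "w \<in> borel_measurable dtheta" and "A \<in> sets unit_circle"
  shows "emeasure (ac_measure w) A =
           (\<integral>\<^sup>+\<theta>. ennreal (w \<theta>) * indicator A (cis \<theta>) \<partial>dtheta)"
proof -
  have c: "cis \<in> measurable (density dtheta (\<lambda>\<theta>. ennreal (w \<theta>))) unit_circle"
    using cis_measurable_dtheta by simp
  have "cis -` A \<inter> space dtheta \<in> sets dtheta"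
    using cis_measurable_dtheta assms(2) by (rule measurable_sets)
  then have "emeasure (ac_measure w) A =
      (\<integral>\<^sup>+\<theta>. ennreal (w \<theta>) * indicator (cis -` A \<inter> space dtheta) \<theta> \<partial>dtheta)"
    using assms unfolding ac_measure_def
    by (subst emeasure_distr[OF c]) (simp_all add: emeasure_density)
  also have "\<dots> = (\<integral>\<^sup>+\<theta>. ennreal (w \<theta>) * indicator A (cis \<theta>) \<partial>dtheta)"
    by (intro nn_integral_cong) (auto simp: indicator_def)
  finally show ?thesis .
qed

end

(* Let w_N = prod_{j<N} (1 - |alpha_j|^2) / |Phi_N|^2 be the density of the N-th Bernstein-Szego
   approximation of mu, let Q(theta) = 1 - cos(4 theta), and let Z_N be the mean of Q log w_N.

   The integral of Q log w is finite iff (Z_N) is bounded below. In one direction,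
   Q log(w / w_N) <= 2 w / w_N, and the mean of w / w_N is at most 1. In the other direction,
   Q log w_N <= 2 w_N g - Q log g for all g >= 1. The moments of w_N agree with those of mu up to
   order N, so this passes to the limit for trigonometric polynomials g, hence by density for
   bounded measurable g; then take g = 1 + min(1/w, k), and g = 1 on a null set carrying mu_s.

   The reversed polynomials Psi_N have no zeros in the closed disc, so Cauchy's formula gives
   Z_{N+1} - Z_N = log(1 - |alpha_N|^2) + Re c, where c is the fourth Taylor coefficient of
   log(1 - alpha_N z Phi_N / Psi_N). This is a polynomial in five consecutive alpha's, with
   quadratic part alpha_N conj(alpha_{N-4}). Since alpha is in l^6 and has l^2 differences, up to a
   summable error the increment is (|alpha_{N-4}|^2 - |alpha_N|^2) / 2 - 8 |alpha_N|^4. The first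
   term telescopes, so (Z_N) is bounded below iff alpha is in l^4. *)
theory Submission
  imports Defs "HOL-Complex_Analysis.Complex_Analysis"
begin

section \<open>Integrals over the unit circle\<close>

text \<open>The measures with density w_N converge to mu only weakly, and the logarithm is not
  weakly continuous; so Z_N is never shown to converge to the entropy of w. Two one-sided
  inequalities, both instances of log x <= x, take the place of convergence. The second one needs
  test functions g because w_N is controlled only through its moments.

  The weight Q has only the frequencies 0, 4 and -4; hence a single Taylor coefficient appears, and
  it pairs alpha_N with alpha_{N-4}. The term -|alpha_N|^2 of the logarithm cancels against the
  quadratic part of that coefficient, up to the telescoping term and half of |alpha_N -
  alpha_{N-4}|^2. The constant 8 is 1/2 from log(1 - t) plus 15/2 from the quartic part at equal
  entries.

  The two hypotheses meet in the errors: terms of order six are summable by the l^6 condition, and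
  replacing a neighbour by alpha_N in a quartic term costs |alpha|^3 times a difference, which is at
  most a sixth power plus a squared difference.\<close>

lemma dtheta_eq_density:
  "dtheta = density (restrict_space lborel {0..2 * pi}) (\<lambda>_. ennreal (1 / (2 * pi)))"
  unfolding dtheta_def
  by (rule measure_eqI) (simp_all add: emeasure_density nn_integral_cmult)

lemma integrable_dtheta_continuous:
  fixes f :: "real \<Rightarrow> 'a::{banach, second_countable_topology}"
  assumes "continuous_on {0..2 * pi} f"
  shows "integrable dtheta f"
proof -
  have s: "set_integrable lborel {0..2 * pi} f"
    by (rule borel_integrable_atLeastAtMost'[OF assms])
  then have i: "integrable (restrict_space lborel {0..2 * pi}) f"
    unfolding set_integrable_def by (subst integrable_restrict_space) auto
  show ?thesis
    unfolding dtheta_eq_density using i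
    by (subst integrable_density[OF borel_measurable_integrable[OF i]]) simp_all
qed

lemma integral_dtheta_eq:
  fixes f :: "real \<Rightarrow> 'a::euclidean_space"
  assumes "continuous_on {0..2 * pi} f" and "(f has_integral I) {0..2 * pi}"
  shows "(LINT \<theta>|dtheta. f \<theta>) = I /\<^sub>R (2 * pi)"
proof -
  have s: "set_integrable lborel {0..2 * pi} f"
    by (rule borel_integrable_atLeastAtMost'[OF assms(1)])
  then have i: "integrable (restrict_space lborel {0..2 * pi}) f"
    unfolding set_integrable_def by (subst integrable_restrict_space) auto
  have "(LINT \<theta>|dtheta. f \<theta>) = (LINT \<theta>|restrict_space lborel {0..2 * pi}. (1 / (2 * pi)) *\<^sub>R f \<theta>)"
    unfolding dtheta_eq_density
    by (subst integral_density[OF borel_measurable_integrable[OF i]]) simp_all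
  also have "\<dots> = (1 / (2 * pi)) *\<^sub>R (LINT \<theta>|restrict_space lborel {0..2 * pi}. f \<theta>)"
    by (rule Bochner_Integration.integral_scaleR_right)
  also have "(LINT \<theta>|restrict_space lborel {0..2 * pi}. f \<theta>) = (LINT \<theta>:{0..2 * pi}|lborel. f \<theta>)"
    unfolding set_lebesgue_integral_def by (subst integral_restrict_space) simp_all
  also have "(LINT \<theta>:{0..2 * pi}|lborel. f \<theta>) = I"
    using set_borel_integral_eq_integral(2)[OF s] assms(2) by (simp add: integral_unique)
  finally show ?thesis by (simp only: inverse_eq_divide)
qed

lemma continuous_on_cis_compose:
  assumes "continuous_on (sphere 0 1) f"
  shows "continuous_on A (\<lambda>\<theta>. f (cis \<theta>))"
  by (rule continuous_on_compose2[OF assms]) (auto intro!: continuous_intros)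

text \<open>Cauchy's formula for the k-th derivative, with du = i u d theta and cnj u = 1/u on the
  circle.\<close>

lemma circle_coeff:
  assumes "h holomorphic_on cball 0 1"
  shows "(LINT \<theta>|dtheta. h (cis \<theta>) * cnj (cis \<theta>) ^ k) = (deriv ^^ k) h 0 / fact k"
proof -
  have c: "continuous_on (cball 0 1) h"
    using assms by (rule holomorphic_on_imp_continuous_on)
  have "((\<lambda>u. h u / (u - 0) ^ Suc k) has_contour_integral
      (complex_of_real (2 * pi) * \<i>) / fact k * (deriv ^^ k) h 0) (circlepath 0 1)"
    using holomorphic_on_subset[OF assms ball_subset_cball] c
    by (intro Cauchy_has_contour_integral_higher_derivative_circlepath) auto
  then have "((\<lambda>t. h (cis t) / cis t ^ Suc k * \<i> * cis t) has_integral
      (complex_of_real (2 * pi) * \<i>) / fact k * (deriv ^^ k) h 0) {0..2 * pi}"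
    unfolding circlepath_def by (subst (asm) has_contour_integral_part_circlepath_iff) auto
  then have "((\<lambda>t. (- \<i>) * (h (cis t) / cis t ^ Suc k * \<i> * cis t)) has_integral
      (- \<i>) * (complex_of_real (2 * pi) * \<i> / fact k * (deriv ^^ k) h 0)) {0..2 * pi}"
    by (rule has_integral_mult_right)
  moreover have "(\<lambda>t. (- \<i>) * (h (cis t) / cis t ^ Suc k * \<i> * cis t)) =
      (\<lambda>t. h (cis t) * cnj (cis t) ^ k)"
  proof
    fix t :: real
    have "cis t ^ k * cnj (cis t) ^ k = 1"
      by (simp add: cis_cnj cis_mult flip: power_mult_distrib)
    then show "(- \<i>) * (h (cis t) / cis t ^ Suc k * \<i> * cis t) = h (cis t) * cnj (cis t) ^ k"
      by (simp add: field_simps)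
  qed
  moreover have "(- \<i>) * (p * \<i> / F * D) = p * (D / F)" for p F D :: complex
    by (cases "F = 0") (simp_all add: field_simps)
  ultimately have i: "((\<lambda>t. h (cis t) * cnj (cis t) ^ k) has_integral
      (2 * pi) * ((deriv ^^ k) h 0 / fact k)) {0..2 * pi}"
    by (simp only:)
  have "continuous_on {0..2 * pi} (\<lambda>\<theta>. h (cis \<theta>) * cnj (cis \<theta>) ^ k)"
    by (intro continuous_intros continuous_on_cis_compose continuous_on_subset[OF c]) auto
  from integral_dtheta_eq[OF this i]
  have "(LINT \<theta>|dtheta. h (cis \<theta>) * cnj (cis \<theta>) ^ k) =
      (2 * pi) * ((deriv ^^ k) h 0 / fact k) /\<^sub>R (2 * pi)" .
  moreover have "complex_of_real (2 * pi) * X /\<^sub>R (2 * pi) = X" for X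
    by (simp add: scaleR_conv_of_real)
  ultimately show ?thesis by (simp only:)
qed

lemma circle_mean:
  assumes "h holomorphic_on cball 0 1"
  shows "(LINT \<theta>|dtheta. h (cis \<theta>)) = h 0"
  using circle_coeff[OF assms, of 0] by simp

text \<open>The integral is the mean of the holomorphic function z^k h, whose value at 0
  vanishes.\<close>

lemma circle_coeff_neg:
  assumes "h holomorphic_on cball 0 1" and "0 < k"
  shows "(LINT \<theta>|dtheta. h (cis \<theta>) * cis \<theta> ^ k) = 0"
proof -
  have "(\<lambda>z. h z * z ^ k) holomorphic_on cball 0 1"
    by (intro holomorphic_intros assms)
  from circle_mean[OF this] assms(2) show ?thesis by simp
qed

text \<open>Writing cos(4 theta) as half the sum of the fourth powers of \<open>cis\<close> and its
  conjugate leaves only the Fourier coefficients 0, 4 and -4 of h, and the last one vanishes. This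
  is the origin of the fourth Taylor coefficient in the sum rule.\<close>

lemma circle_fejer4:
  assumes "h holomorphic_on cball 0 1"
  shows "(LINT \<theta>|dtheta. (1 - cos (4 * \<theta>)) * Re (h (cis \<theta>))) =
    Re (h 0) - Re ((deriv ^^ 4) h 0 / fact 4) / 2"
proof -
  have c: "continuous_on (cball 0 1) h"
    using assms by (rule holomorphic_on_imp_continuous_on)
  have ch: "continuous_on {0..2*pi} (\<lambda>\<theta>. h (cis \<theta>))"
    by (intro continuous_on_cis_compose continuous_on_subset[OF c]) auto
  have [simp]: "integrable dtheta (\<lambda>\<theta>. h (cis \<theta>))"
      "integrable dtheta (\<lambda>\<theta>. h (cis \<theta>) * cis \<theta> ^ 4)"
      "integrable dtheta (\<lambda>\<theta>. h (cis \<theta>) * cnj (cis \<theta>) ^ 4)"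
    by (intro integrable_dtheta_continuous continuous_intros ch)+
  have e: "(1 - cos (4 * \<theta>)) * Re (h (cis \<theta>)) =
      Re (h (cis \<theta>) - (h (cis \<theta>) * cis \<theta> ^ 4 + h (cis \<theta>) * cnj (cis \<theta>) ^ 4) / 2)" for \<theta>
  proof -
    have "cis \<theta> ^ 4 + cnj (cis \<theta>) ^ 4 = of_real (2 * cos (4 * \<theta>))"
      using Complex.DeMoivre[of \<theta> 4] Complex.DeMoivre[of "-\<theta>" 4]
      by (simp add: cis_cnj complex_eq_iff)
    then have "h (cis \<theta>) * cis \<theta> ^ 4 + h (cis \<theta>) * cnj (cis \<theta>) ^ 4 = h (cis \<theta>) * of_real (2 * cos (4 * \<theta>))"
      by (simp flip: distrib_left)
    then show ?thesis by (simp add: algebra_simps)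
  qed
  have "(LINT \<theta>|dtheta. (1 - cos (4 * \<theta>)) * Re (h (cis \<theta>))) =
      Re (LINT \<theta>|dtheta. h (cis \<theta>) - (h (cis \<theta>) * cis \<theta> ^ 4 + h (cis \<theta>) * cnj (cis \<theta>) ^ 4) / 2)"
    unfolding e by (rule integral_Re) simp
  also have "(LINT \<theta>|dtheta. h (cis \<theta>) - (h (cis \<theta>) * cis \<theta> ^ 4 + h (cis \<theta>) * cnj (cis \<theta>) ^ 4) / 2) =
      h 0 - (0 + (deriv ^^ 4) h 0 / fact 4) / 2"
    using circle_mean[OF assms] circle_coeff_neg[OF assms, of 4] circle_coeff[OF assms, of 4]
    by simp
  also have "Re (h 0 - (0 + (deriv ^^ 4) h 0 / fact 4) / 2) = Re (h 0) - Re ((deriv ^^ 4) h 0 / fact 4) / 2"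
    by (simp only: add_0 minus_complex.sel Re_divide_numeral)
  finally show ?thesis .
qed

section \<open>The Szego recursion\<close>

text \<open>The Szego recursion for an arbitrary coefficient sequence, run jointly with the reversed
  polynomials Psi_n, so that facts about the disc can be proved without a measure. That
  \<open>opuc_rev\<close> is the reversal is \<open>opuc_rev_circle\<close>.\<close>

fun opuc :: "(nat \<Rightarrow> complex) \<Rightarrow> nat \<Rightarrow> complex poly"
  and opuc_rev :: "(nat \<Rightarrow> complex) \<Rightarrow> nat \<Rightarrow> complex poly" where
  "opuc a 0 = 1"
| "opuc a (Suc n) = pCons 0 (opuc a n) - smult (cnj (a n)) (opuc_rev a n)"
| "opuc_rev a 0 = 1"
| "opuc_rev a (Suc n) = opuc_rev a n - smult (a n) (pCons 0 (opuc a n))"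

lemma poly_opuc_Suc:
  "poly (opuc a (Suc n)) z = z * poly (opuc a n) z - cnj (a n) * poly (opuc_rev a n) z"
  by simp

lemma poly_opuc_rev_Suc:
  "poly (opuc_rev a (Suc n)) z = poly (opuc_rev a n) z - a n * (z * poly (opuc a n) z)"
  by simp

text \<open>Conjugating one recursion and multiplying by z^(n+1) gives the other, since cnj z = 1/z
  on the circle.\<close>

lemma opuc_rev_circle:
  assumes "norm z = 1"
  shows "poly (opuc_rev a n) z = z ^ n * cnj (poly (opuc a n) z)"
proof (induction n)
  case (Suc n)
  have z: "z * cnj z = 1" using assms by (simp add: complex_norm_square[symmetric])
  then have zn: "z ^ n * cnj z ^ n = 1" by (simp flip: power_mult_distrib)
  have "z ^ Suc n * cnj (poly (opuc a (Suc n)) z) =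
      (z * cnj z) * (z ^ n * cnj (poly (opuc a n) z)) - a n * (z * ((z ^ n * cnj z ^ n) * poly (opuc a n) z))"
    unfolding poly_opuc_Suc Suc by (simp add: algebra_simps)
  also have "\<dots> = poly (opuc_rev a (Suc n)) z"
    unfolding poly_opuc_rev_Suc z zn Suc by simp
  finally show ?case ..
qed simp

lemma norm_opuc_rev_circle:
  "norm z = 1 \<Longrightarrow> norm (poly (opuc_rev a n) z) = norm (poly (opuc a n) z)"
  by (simp add: opuc_rev_circle norm_mult norm_power)

lemma coeff_opuc_rev_eq_0: "n < i \<Longrightarrow> coeff (opuc_rev a n) i = 0"
  and coeff_opuc_eq_0: "n < i \<Longrightarrow> coeff (opuc a n) i = 0"
proof (induction n arbitrary: i)
  case (Suc n)
  { case 1 with Suc show ?case by (cases i) auto }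
  { case 2 with Suc show ?case by (cases i) auto }
qed auto

lemma poly_opuc_rev_0: "poly (opuc_rev a n) 0 = 1"
  by (induction n) auto

text \<open>One Szego step maps (u, v) = (Psi_n, z Phi_n) to (u - a v, v - cnj a u). Like the
  Blaschke factors of the disc, it preserves the form |u|^2 - |v|^2 up to the factor 1 -
  |a|^2.\<close>

lemma norm_blaschke_identity:
  fixes u v a :: complex
  shows "(norm (u - a * v))\<^sup>2 - (norm (v - cnj a * u))\<^sup>2 =
    (1 - (norm a)\<^sup>2) * ((norm u)\<^sup>2 - (norm v)\<^sup>2)"
  unfolding cmod_power2 by (simp add: algebra_simps power2_eq_square)

text \<open>The two claims need each other: |Phi_n| <= |Psi_n| forces |a_n z Phi_n| < |Psi_n|, so
  Psi_(n+1) cannot vanish, and the form identity carries the inequality to n + 1.\<close>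

lemma opuc_disc:
  assumes a: "\<And>j. norm (a j) < 1" and z: "norm z \<le> 1"
  shows opuc_rev_nonzero: "poly (opuc_rev a n) z \<noteq> 0"
    and norm_opuc_le: "norm (poly (opuc a n) z) \<le> norm (poly (opuc_rev a n) z)"
proof (induction n)
  case (Suc n)
  define u v where "u = poly (opuc_rev a n) z" and "v = z * poly (opuc a n) z"
  have uv: "norm v \<le> norm u"
    using mult_mono[OF z Suc(2)] unfolding u_def v_def by (simp add: norm_mult)
  have "u \<noteq> 0" using Suc(1) by (simp add: u_def)
  have "norm (a n * v) < norm u"
  proof -
    have "norm (a n) * norm v \<le> norm (a n) * norm u" using uv by (simp add: mult_left_mono)
    also have "\<dots> < 1 * norm u" using a[of n] \<open>u \<noteq> 0\<close> by (intro mult_strict_right_mono) auto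
    finally show ?thesis by (simp add: norm_mult)
  qed
  then have "u \<noteq> a n * v" by auto
  { case 1 show ?case using \<open>u \<noteq> a n * v\<close> by (simp add: u_def v_def mult.left_commute) }
  { case 2
    have "0 \<le> (1 - (norm (a n))\<^sup>2) * ((norm u)\<^sup>2 - (norm v)\<^sup>2)"
      using a[of n] uv by (intro mult_nonneg_nonneg) (auto simp: power_le_one abs_square_le_1 intro: power_mono)
    then have "(norm (v - cnj (a n) * u))\<^sup>2 \<le> (norm (u - a n * v))\<^sup>2"
      using norm_blaschke_identity[of u "a n" v] by linarith
    then have "norm (v - cnj (a n) * u) \<le> norm (u - a n * v)"
      by (rule power2_le_imp_le) simp
    then show ?case unfolding poly_opuc_Suc poly_opuc_rev_Suc u_def v_def . }
qed auto

section \<open>Orthogonal polynomials of a measure on the circle\<close>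

lemma integrable_circle:
  fixes f :: "complex \<Rightarrow> 'b::{banach, second_countable_topology}"
  assumes "finite_measure M" "sets M = sets unit_circle" "continuous_on (sphere 0 1) f"
  shows "integrable M f"
proof -
  have sp: "space M = sphere 0 1"
    using sets_eq_imp_space_eq[OF assms(2)] by simp
  have "f \<in> borel_measurable unit_circle"
    unfolding unit_circle_def by (rule borel_measurable_continuous_on_restrict) fact
  then have m: "f \<in> borel_measurable M"
    by (simp add: measurable_cong_sets[OF assms(2) refl])
  have "compact (f ` sphere 0 1)"
    by (intro compact_continuous_image assms(3)) simp
  then obtain B where "\<And>x. x \<in> sphere 0 1 \<Longrightarrow> norm (f x) \<le> B"
    by (metis bounded_iff compact_imp_bounded imageI)
  then show ?thesis
    by (intro finite_measure.integrable_const_bound[OF assms(1), of _ B] m) (auto simp: sp)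
qed

lemma circle_probD:
  assumes "circle_prob \<mu>"
  shows "prob_space \<mu>" "finite_measure \<mu>" "sets \<mu> = sets unit_circle" "space \<mu> = sphere 0 1"
    "infinite (support_of \<mu>)"
  using assms sets_eq_imp_space_eq[of \<mu> unit_circle]
  by (auto simp: circle_prob_def prob_space_def)

text \<open>The complement of the zero set of p is open and mu-null, so a nonzero p would confine
  the support to finitely many zeros. This is where infinite support enters.\<close>

lemma circle_prob_poly_eq_0:
  assumes "circle_prob \<mu>" and "(LINT z|\<mu>. (norm (poly p z))\<^sup>2) = 0"
  shows "p = 0"
proof (rule ccontr)
  assume "p \<noteq> 0"
  note \<mu> = circle_probD[OF assms(1)]
  have "integrable \<mu> (\<lambda>z. (norm (poly p z))\<^sup>2)"
    by (intro integrable_circle \<mu> continuous_intros)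
  then have "AE z in \<mu>. (norm (poly p z))\<^sup>2 = 0"
    using assms(2) by (subst (asm) integral_nonneg_eq_0_iff_AE) auto
  then have ae: "AE z in \<mu>. poly p z = 0" by simp
  have "support_of \<mu> \<subseteq> {z. poly p z = 0}"
  proof (rule subsetI, rule ccontr)
    fix z assume z: "z \<in> support_of \<mu>" "z \<notin> {z. poly p z = 0}"
    define U where "U = {z. poly p z \<noteq> 0}"
    have U: "open U" unfolding U_def by (intro open_Collect_neq continuous_intros)
    then have "emeasure \<mu> (U \<inter> space \<mu>) > 0"
      using z by (auto simp: support_of_def U_def)
    moreover have "U \<inter> space \<mu> \<in> sets \<mu>"
      using U unfolding \<mu>(3,4) unit_circle_def sets_restrict_space by auto
    then have "emeasure \<mu> (U \<inter> space \<mu>) = 0"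
      using ae by (subst AE_iff_measurable[symmetric, where P="\<lambda>z. poly p z = 0"]) (auto simp: U_def)
    ultimately show False by simp
  qed
  then show False
    using \<mu>(5) poly_roots_finite[OF \<open>p \<noteq> 0\<close>] finite_subset by blast
qed

text \<open>Induction along a triangular basis: subtracting the multiple of \<open>\<Phi> N\<close>
  that cancels the coefficient at N lowers the bound by one.\<close>

lemma monic_basis_induct:
  fixes p :: "'a::comm_ring_1 poly"
  assumes "\<And>n. degree (\<Phi> n) = n" and "\<And>n. lead_coeff (\<Phi> n) = 1"
    and "\<And>i. N \<le> i \<Longrightarrow> coeff p i = 0"
    and "P 0" and step: "\<And>p c m. m < N \<Longrightarrow> P p \<Longrightarrow> P (p + smult c (\<Phi> m))"
  shows "P p"
  using assms(3) step
proof (induction N arbitrary: p)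
  case 0
  then have "p = 0" by (simp add: poly_eq_iff)
  then show ?case using \<open>P 0\<close> by simp
next
  case (Suc N)
  define r where "r = p - smult (coeff p N) (\<Phi> N)"
  have "coeff r i = 0" if "N \<le> i" for i
  proof (cases "i = N")
    case True then show ?thesis
      using assms(2)[of N] assms(1)[of N] by (simp add: r_def)
  next
    case False
    then have "Suc N \<le> i" "degree (\<Phi> N) < i" using that assms(1)[of N] by auto
    then show ?thesis using Suc.prems(1) by (simp add: r_def coeff_eq_0)
  qed
  then have "P r" using Suc by simp
  then have "P (r + smult (coeff p N) (\<Phi> N))" by (intro Suc.prems(2)) auto
  then show ?case by (simp add: r_def)
qed

context
  fixes \<mu> :: "complex measure" and \<Phi> :: "nat \<Rightarrow> complex poly"
  assumes mu: "circle_prob \<mu>" and orth: "monic_orthogonal_polys \<mu> \<Phi>"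
begin

lemma integrable_mu:
  fixes f :: "complex \<Rightarrow> 'b::{banach, second_countable_topology}"
  shows "continuous_on (sphere 0 1) f \<Longrightarrow> integrable \<mu> f"
  using circle_probD[OF mu] by (intro integrable_circle) auto

text \<open>Orthogonality to each Phi_k extends by linearity. Bounding coefficients instead of the
  degree covers n = 0, where p = 0.\<close>

lemma monic_orth_poly:
  assumes "\<And>i. n \<le> i \<Longrightarrow> coeff p i = 0"
  shows "(LINT z|\<mu>. cnj (poly p z) * poly (\<Phi> n) z) = 0"
proof -
  have "degree (\<Phi> n) = n" "lead_coeff (\<Phi> n) = 1" for n
    using orth unfolding monic_orthogonal_polys_def by blast+
  then show ?thesis
  proof (rule monic_basis_induct[where N=n and p=p])
    fix p c k assume k: "k < n" and p: "(LINT z|\<mu>. cnj (poly p z) * poly (\<Phi> n) z) = 0"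
    have "(LINT z|\<mu>. cnj (poly (\<Phi> k) z) * poly (\<Phi> n) z) = 0"
      using orth k by (simp add: monic_orthogonal_polys_def)
    moreover have "(LINT z|\<mu>. cnj (poly (p + smult c (\<Phi> k)) z) * poly (\<Phi> n) z) =
        (LINT z|\<mu>. cnj (poly p z) * poly (\<Phi> n) z + cnj c * (cnj (poly (\<Phi> k) z) * poly (\<Phi> n) z))"
      by (simp add: algebra_simps)
    moreover have "\<dots> = (LINT z|\<mu>. cnj (poly p z) * poly (\<Phi> n) z) +
        cnj c * (LINT z|\<mu>. cnj (poly (\<Phi> k) z) * poly (\<Phi> n) z)"
      by (subst Bochner_Integration.integral_add) (auto intro!: integrable_mu continuous_intros)
    ultimately show "(LINT z|\<mu>. cnj (poly (p + smult c (\<Phi> k)) z) * poly (\<Phi> n) z) = 0"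
      using p by simp
  qed (use assms in simp_all)
qed

text \<open>The defect E of the recursion has degree at most n and vanishes at 0, so it is a
  combination of z, ..., z^n. The three terms that make up E are all orthogonal to these powers;
  hence E is orthogonal to itself.\<close>

lemma monic_orth_opuc: "\<Phi> n = opuc (verblunsky \<Phi>) n"
proof (induction n)
  case 0
  have "degree (\<Phi> 0) = 0" "lead_coeff (\<Phi> 0) = 1"
    using orth unfolding monic_orthogonal_polys_def by blast+
  then have "\<Phi> 0 = 1" by (metis degree_eq_zeroE lead_coeff_pCons(2) pCons_one)
  then show ?case by simp
next
  case (Suc n)
  define a where "a = verblunsky \<Phi> n"
  define R where "R = opuc_rev (verblunsky \<Phi>) n"
  define E where "E = \<Phi> (Suc n) - pCons 0 (\<Phi> n) + smult (cnj a) R"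
  have deg: "degree (\<Phi> n) = n" "lead_coeff (\<Phi> n) = 1" for n
    using orth unfolding monic_orthogonal_polys_def by blast+
  have R0: "poly R 0 = 1" by (simp add: R_def poly_opuc_rev_0)
  have R: "poly R z = z ^ n * cnj (poly (\<Phi> n) z)" if "norm z = 1" for z
    using opuc_rev_circle[OF that] Suc by (simp add: R_def)
  have "coeff E i = 0" if "n < i" for i
  proof (cases "i = Suc n")
    case True then show ?thesis
      using deg[of "Suc n"] deg[of n] by (simp add: E_def R_def coeff_opuc_rev_eq_0)
  next
    case False
    then have "degree (\<Phi> (Suc n)) < i" "degree (pCons 0 (\<Phi> n)) < i"
      using that deg[of n] deg[of "Suc n"] by (auto simp: degree_pCons_eq_if)
    then show ?thesis using that by (simp add: E_def coeff_eq_0 R_def coeff_opuc_rev_eq_0)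
  qed
  moreover obtain F where F: "E = pCons 0 F"
  proof -
    have "coeff E 0 = 0"
      by (simp add: E_def poly_0_coeff_0[symmetric] R0 a_def verblunsky_def)
    then show ?thesis using that by (metis pCons_cases coeff_pCons_0)
  qed
  ultimately have Fi: "coeff F i = 0" if "n \<le> i" for i
    using that by (metis coeff_pCons_Suc le_imp_less_Suc)
  have 1: "(LINT z|\<mu>. cnj (poly E z) * poly (\<Phi> (Suc n)) z) = 0"
    by (rule monic_orth_poly) (simp add: \<open>\<And>i. n < i \<Longrightarrow> coeff E i = 0\<close>)
  have sp: "space \<mu> = sphere 0 1" by (rule circle_probD[OF mu])
  \<comment> \<open>With E = z F the factors z cancel on the circle, and F has degree below
    n.\<close>
  have 2: "(LINT z|\<mu>. cnj (poly E z) * poly (pCons 0 (\<Phi> n)) z) = 0"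
  proof -
    have "(LINT z|\<mu>. cnj (poly E z) * poly (pCons 0 (\<Phi> n)) z) =
        (LINT z|\<mu>. cnj (poly F z) * poly (\<Phi> n) z)"
    proof (intro Bochner_Integration.integral_cong refl)
      fix z assume "z \<in> space \<mu>"
      then have "cnj z * z = 1" by (simp add: sp complex_norm_square[symmetric] mult.commute)
      moreover have "cnj (poly E z) * poly (pCons 0 (\<Phi> n)) z =
          (cnj z * z) * (cnj (poly F z) * poly (\<Phi> n) z)" by (simp add: F)
      ultimately show "cnj (poly E z) * poly (pCons 0 (\<Phi> n)) z = cnj (poly F z) * poly (\<Phi> n) z"
        by simp
    qed
    also have "\<dots> = 0" by (rule monic_orth_poly) (rule Fi)
    finally show ?thesis .
  qed
  have 3: "(LINT z|\<mu>. cnj (poly E z) * poly R z) = 0"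
  proof -
    \<comment> \<open>On the circle Psi_n = z^n cnj Phi_n, so this is the conjugate of the inner
      product of z^(n-k-1) with Phi_n.\<close>
    have mono: "(LINT z|\<mu>. cnj (z ^ Suc k) * poly R z) = 0" if "k < n" for k
    proof -
      have "(LINT z|\<mu>. cnj (z ^ Suc k) * poly R z) =
          (LINT z|\<mu>. cnj (cnj (poly (monom 1 (n - Suc k)) z) * poly (\<Phi> n) z))"
      proof (intro Bochner_Integration.integral_cong refl)
        fix z assume "z \<in> space \<mu>"
        then have nz: "norm z = 1" by (simp add: sp)
        then have "cnj z * z = 1" by (simp add: complex_norm_square[symmetric] mult.commute)
        then have "cnj z ^ Suc k * z ^ Suc k = 1" by (simp only: power_mult_distrib[symmetric] power_one)
        moreover have "z ^ n = z ^ Suc k * z ^ (n - Suc k)"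
          using that by (simp only: power_add[symmetric] le_add_diff_inverse Suc_leI)
        ultimately have "cnj z ^ Suc k * z ^ n = z ^ (n - Suc k)"
          by (metis mult.assoc mult_1)
        then show "cnj (z ^ Suc k) * poly R z =
            cnj (cnj (poly (monom 1 (n - Suc k)) z) * poly (\<Phi> n) z)"
          unfolding R[OF nz] by (simp add: poly_monom flip: mult.assoc)
      qed
      also have "\<dots> = cnj (LINT z|\<mu>. cnj (poly (monom 1 (n - Suc k)) z) * poly (\<Phi> n) z)"
        by (rule Bochner_Integration.integral_cnj)
      also have "(LINT z|\<mu>. cnj (poly (monom 1 (n - Suc k)) z) * poly (\<Phi> n) z) = 0"
        using that by (intro monic_orth_poly) auto
      finally show ?thesis by simp
    qed
    have "cnj (poly E z) * poly R z =
        (\<Sum>k<n. cnj (coeff F k) * (cnj (z ^ Suc k) * poly R z))" for z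
    proof -
      have "poly F z = (\<Sum>k<n. coeff F k * z ^ k)"
      proof -
        have "F = (\<Sum>k<n. monom (coeff F k) k)"
          by (rule poly_eqI) (use Fi not_less in \<open>auto simp: coeff_sum\<close>)
        then have "poly F z = poly (\<Sum>k<n. monom (coeff F k) k) z" by simp
        then show ?thesis by (simp add: poly_sum poly_monom)
      qed
      then show ?thesis
        by (simp add: F sum_distrib_left sum_distrib_right algebra_simps)
    qed
    then show ?thesis
      by (simp del: complex_cnj_power power_Suc)
         (subst Bochner_Integration.integral_sum,
           auto intro!: integrable_mu continuous_intros simp: mono simp del: complex_cnj_power power_Suc)
  qed
  have "complex_of_real (LINT z|\<mu>. (norm (poly E z))\<^sup>2) =
      (LINT z|\<mu>. cnj (poly E z) * poly E z)"
    by (simp only: integral_complex_of_real[symmetric] complex_norm_square mult.commute)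
  also have "\<dots> = (LINT z|\<mu>. cnj (poly E z) * poly (\<Phi> (Suc n)) z
      - cnj (poly E z) * poly (pCons 0 (\<Phi> n)) z + cnj a * (cnj (poly E z) * poly R z))"
    by (rule Bochner_Integration.integral_cong) (simp_all add: E_def algebra_simps)
  also have "\<dots> = (LINT z|\<mu>. cnj (poly E z) * poly (\<Phi> (Suc n)) z)
      - (LINT z|\<mu>. cnj (poly E z) * poly (pCons 0 (\<Phi> n)) z)
      + cnj a * (LINT z|\<mu>. cnj (poly E z) * poly R z)"
    by (subst Bochner_Integration.integral_add Bochner_Integration.integral_diff;
        (intro integrable_mu continuous_intros)?)+ simp
  also have "\<dots> = 0" unfolding 1 2 3 by simp
  finally have "E = 0"
    using circle_prob_poly_eq_0[OF mu] by simp
  then show ?case using Suc by (simp add: E_def a_def R_def algebra_simps)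
qed

text \<open>Pythagoras for z Phi_n = Phi_(n+1) + cnj alpha_n Psi_n: Psi_n has degree at most n,
  hence is orthogonal to Phi_(n+1), and |Psi_n| = |Phi_n| on the circle.\<close>

lemma norm_opuc_rec:
  "(LINT z|\<mu>. (norm (poly (\<Phi> (Suc n)) z))\<^sup>2) =
    (1 - (norm (verblunsky \<Phi> n))\<^sup>2) * (LINT z|\<mu>. (norm (poly (\<Phi> n) z))\<^sup>2)"
proof -
  define a where "a = verblunsky \<Phi>"
  define R where "R = opuc_rev a n"
  have \<Phi>: "\<Phi> k = opuc a k" for k by (simp add: a_def flip: monic_orth_opuc)
  have 0: "(LINT z|\<mu>. cnj (poly R z) * poly (\<Phi> (Suc n)) z) = 0"
    by (rule monic_orth_poly) (simp add: R_def coeff_opuc_rev_eq_0)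
  have e: "(norm (poly (\<Phi> n) z))\<^sup>2 = (norm (poly (\<Phi> (Suc n)) z))\<^sup>2 + (norm (a n))\<^sup>2 * (norm (poly (\<Phi> n) z))\<^sup>2
      + 2 * Re (a n * (cnj (poly R z) * poly (\<Phi> (Suc n)) z))" if "z \<in> space \<mu>" for z
  proof -
    have nz: "norm z = 1" using that circle_probD(4)[OF mu] by simp
    have p: "(norm (u + v))\<^sup>2 = (norm u)\<^sup>2 + (norm v)\<^sup>2 + 2 * Re (cnj v * u)" for u v :: complex
      unfolding cmod_power2 by (simp add: algebra_simps power2_eq_square)
    have "z * poly (\<Phi> n) z = poly (\<Phi> (Suc n)) z + cnj (a n) * poly R z" (is "_ = ?x + ?y")
      unfolding \<Phi> R_def poly_opuc_Suc by simp
    then have "(norm (z * poly (\<Phi> n) z))\<^sup>2 = (norm (poly (\<Phi> (Suc n)) z))\<^sup>2 + (norm (cnj (a n) * poly R z))\<^sup>2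
        + 2 * Re (cnj (cnj (a n) * poly R z) * poly (\<Phi> (Suc n)) z)"
      by (simp only: p)
    moreover have "norm (poly R z) = norm (poly (\<Phi> n) z)"
      unfolding R_def \<Phi> by (rule norm_opuc_rev_circle[OF nz])
    ultimately show ?thesis
      by (simp only: norm_mult nz power_mult_distrib complex_cnj_mult complex_cnj_cnj mult.assoc complex_mod_cnj mult_1 power_one)
  qed
  have "(LINT z|\<mu>. (norm (poly (\<Phi> n) z))\<^sup>2) = (LINT z|\<mu>. (norm (poly (\<Phi> (Suc n)) z))\<^sup>2
      + (norm (a n))\<^sup>2 * (norm (poly (\<Phi> n) z))\<^sup>2
      + 2 * Re (a n * (cnj (poly R z) * poly (\<Phi> (Suc n)) z)))"
    by (rule Bochner_Integration.integral_cong[OF refl e])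
  also have "\<dots> = (LINT z|\<mu>. (norm (poly (\<Phi> (Suc n)) z))\<^sup>2)
      + (norm (a n))\<^sup>2 * (LINT z|\<mu>. (norm (poly (\<Phi> n) z))\<^sup>2)
      + 2 * Re (a n * (LINT z|\<mu>. cnj (poly R z) * poly (\<Phi> (Suc n)) z))"
    by (subst Bochner_Integration.integral_add Bochner_Integration.integral_mult_right_zero integral_Re;
        (intro integrable_mu continuous_intros)?)+ simp
  finally show ?thesis unfolding 0 by (simp add: a_def algebra_simps)
qed

text \<open>By \<open>norm_opuc_rec\<close>, 1 - |alpha_n|^2 is a quotient of two positive squared
  norms.\<close>

lemma norm_verblunsky_less_1: "norm (verblunsky \<Phi> n) < 1"
proof -
  have pos: "0 < (LINT z|\<mu>. (norm (poly (\<Phi> n) z))\<^sup>2)" for n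
  proof -
    have "\<Phi> n \<noteq> 0" using orth by (metis monic_orthogonal_polys_def zero_neq_one leading_coeff_0_iff)
    then have "(LINT z|\<mu>. (norm (poly (\<Phi> n) z))\<^sup>2) \<noteq> 0" using circle_prob_poly_eq_0[OF mu] by blast
    moreover have "0 \<le> (LINT z|\<mu>. (norm (poly (\<Phi> n) z))\<^sup>2)" by simp
    ultimately show ?thesis by linarith
  qed
  have "0 < 1 - (norm (verblunsky \<Phi> n))\<^sup>2"
    using pos[of n] pos[of "Suc n"] norm_opuc_rec[of n] by (simp add: zero_less_mult_iff)
  then show ?thesis by (simp add: abs_square_less_1)
qed

lemma norm_opuc_prod:
  "(LINT z|\<mu>. (norm (poly (\<Phi> n) z))\<^sup>2) = (\<Prod>j<n. 1 - (norm (verblunsky \<Phi> j))\<^sup>2)"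
proof (induction n)
  case 0
  interpret prob_space \<mu> by (rule circle_probD[OF mu])
  show ?case by (simp add: monic_orth_opuc prob_space)
qed (simp add: norm_opuc_rec)

end

section \<open>Asymptotics of the sum rule\<close>

text \<open>The fourth Taylor coefficient of \<open>log (1 - \<alpha>\<^sub>n z \<Phi>\<^sub>n / \<Psi>\<^sub>n)\<close>, where \<open>p0, \<dots>, p4\<close> are
  \<open>\<alpha>\<^sub>n, \<dots>, \<alpha>\<^sub>n\<^sub>-\<^sub>4\<close>.\<close>
definition step_poly :: "complex \<Rightarrow> complex \<Rightarrow> complex \<Rightarrow> complex \<Rightarrow> complex \<Rightarrow> complex" where
  "step_poly p0 p1 p2 p3 p4 =
    (let s1 = 1 - p1 * cnj p1; s2 = 1 - p2 * cnj p2; s3 = 1 - p3 * cnj p3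
     in p0 * cnj p4 * s1 * s2 * s3 - p0 * p2 * (cnj p3)\<^sup>2 * s1 * s2 - 2 * p0 * p1 * cnj p2 * cnj p3 * s1 * s2
        + p0 * p1\<^sup>2 * cnj p2 ^ 3 * s1 - p0\<^sup>2 * cnj p1 * cnj p3 * s1 * s2 + p0\<^sup>2 * cnj p1 * p1 * (cnj p2)\<^sup>2 * s1
        - p0\<^sup>2 * (cnj p2)\<^sup>2 * s1\<^sup>2 / 2 + p0 ^ 3 * (cnj p1)\<^sup>2 * cnj p2 * s1 - p0 ^ 4 * cnj p1 ^ 4 / 4)"

lemma norm_diff_mult_le:
  fixes x y x' y' :: "'a::real_normed_algebra"
  assumes "norm y \<le> B" "norm x' \<le> A" "norm (x - x') \<le> d" "norm (y - y') \<le> e"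
  shows "norm (x * y - x' * y') \<le> d * B + A * e"
proof -
  have "x * y - x' * y' = (x - x') * y + x' * (y - y')" by (simp add: algebra_simps)
  also have "norm \<dots> \<le> norm (x - x') * norm y + norm x' * norm (y - y')"
    by (meson add_mono norm_mult_ineq norm_triangle_mono)
  also have "\<dots> \<le> d * B + A * e"
    using assms by (intro add_mono mult_mono) (auto intro: order_trans[OF norm_ge_zero])
  finally show ?thesis .
qed

lemma norm_diff_mult4_le:
  fixes x1 :: "'a::real_normed_algebra"
  assumes "norm x1 \<le> m" "norm x2 \<le> m" "norm x3 \<le> m" "norm x4 \<le> m"
    and "norm y1 \<le> m" "norm y2 \<le> m" "norm y3 \<le> m" "norm y4 \<le> m"
    and "norm (x1 - y1) \<le> d" "norm (x2 - y2) \<le> d" "norm (x3 - y3) \<le> d" "norm (x4 - y4) \<le> d"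
  shows "norm ((x1 * x2) * (x3 * x4) - (y1 * y2) * (y3 * y4)) \<le> 4 * (m ^ 3 * d)"
proof -
  have m: "0 \<le> m" using assms(1) norm_ge_zero order_trans by blast
  have "norm ((x1 * x2) * (x3 * x4) - (y1 * y2) * (y3 * y4)) \<le>
      (d * m + m * d) * (m * m) + (m * m) * (d * m + m * d)"
    using assms m
    by (intro norm_diff_mult_le) (auto intro!: norm_diff_mult_le order_trans[OF norm_mult_ineq] mult_mono)
  then show ?thesis by (simp add: eval_nat_numeral algebra_simps)
qed

lemma norm_mult_power_le:
  fixes x y :: "'a::real_normed_algebra"
  assumes "norm x \<le> m ^ i" "norm y \<le> m ^ j" 
  shows "norm (x * y) \<le> m ^ (i + j)"
proof -
  have "norm (x * y) \<le> norm x * norm y" by (rule norm_mult_ineq)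
  also have "\<dots> \<le> m ^ i * m ^ j"
    using assms by (intro mult_mono) (auto intro: order_trans[OF norm_ge_zero])
  finally show ?thesis by (simp add: power_add)
qed

text \<open>The fourth order part of \<open>step_poly p p p p p\<close> is \<open>- (15 / 2) |p|\<^sup>4\<close>.\<close>
lemma step_poly_estimate:
  assumes m: "norm p0 \<le> m" "norm p1 \<le> m" "norm p2 \<le> m" "norm p3 \<le> m" "norm p4 \<le> m" "m \<le> 1"
    and d: "norm (p1 - p0) \<le> d" "norm (p2 - p0) \<le> d" "norm (p3 - p0) \<le> d" "norm (p4 - p0) \<le> d"
  shows "norm (step_poly p0 p1 p2 p3 p4 - (p0 * cnj p4 - 15 / 2 * (p0 * cnj p0)\<^sup>2)) \<le> 40 * (m ^ 6 + m ^ 3 * d)"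
proof -
  have m0: "0 \<le> m" using m(1) norm_ge_zero order_trans by blast
  have d0: "0 \<le> d" using d(1) norm_ge_zero order_trans by blast
  \<comment> \<open>Every quartic monomial is compared with q = |p0|^4, its value at equal
    entries.\<close>
  define q where "q = (p0 * cnj p0) * (p0 * cnj p0)"
  define t1 t2 t3 where "t1 = p1 * cnj p1" and "t2 = p2 * cnj p2" and "t3 = p3 * cnj p3"
  define s1 s2 s3 where "s1 = 1 - t1" and "s2 = 1 - t2" and "s3 = 1 - t3"
  \<comment> \<open>The quartic part with reversed sign: the coefficient 2 becomes a repeated entry
    and 1/2 a halved one, so q is subtracted 7 + 1/2 = 15/2 times.\<close>
  define M where "M = [(p0 * cnj p4) * (p1 * cnj p1) - q, (p0 * cnj p4) * (p2 * cnj p2) - q,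
      (p0 * cnj p4) * (p3 * cnj p3) - q, (p0 * cnj p3) * (p2 * cnj p3) - q,
      (p0 * cnj p2) * (p1 * cnj p3) - q, (p0 * cnj p2) * (p1 * cnj p3) - q,
      (p0 * cnj p1) * (p0 * cnj p3) - q, ((p0 * cnj p2) * (p0 * cnj p2) - q) / 2]"
  \<comment> \<open>The rest has order at least six: three or more pairs of entries, times factors s
    of norm at most 1.\<close>
  define R where "R = [(p0 * cnj p4) * (t1 * t2 * s3), (p0 * cnj p4) * (t1 * t3),  (p0 * cnj p4) * (t2 * t3),
     (p0 * cnj p3) * (p2 * cnj p3) * t1, (p0 * cnj p3) * (p2 * cnj p3) * (t2 * s1),
     2 * ((p0 * cnj p2) * (p1 * cnj p3) * t1), 2 * ((p0 * cnj p2) * (p1 * cnj p3) * (t2 * s1)),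
     (p0 * cnj p1) * (p0 * cnj p3) * t1, (p0 * cnj p1) * (p0 * cnj p3) * (t2 * s1),
     (p0 * cnj p2) * (p1 * cnj p2) * (p1 * cnj p2) * s1, (p0 * cnj p1) * (p0 * cnj p2) * (p1 * cnj p2) * s1,
     ((p0 * cnj p2) * (p0 * cnj p2) * (t1 + t1 * s1)) / 2, (p0 * cnj p1) * (p0 * cnj p1) * (p0 * cnj p2) * s1,
     - ((p0 * cnj p1) * (p0 * cnj p1) * ((p0 * cnj p1) * (p0 * cnj p1)) / 4)]"
  have eq: "step_poly p0 p1 p2 p3 p4 - (p0 * cnj p4 - 15 / 2 * (p0 * cnj p0)\<^sup>2) = sum_list R - sum_list M"
    unfolding step_poly_def Let_def R_def M_def t1_def t2_def t3_def s1_def s2_def s3_def q_def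
    by (simp add: algebra_simps eval_nat_numeral) (simp add: field_simps)
  have pair: "norm (x * cnj y) \<le> m\<^sup>2" if "norm x \<le> m" "norm y \<le> m" for x y
    using norm_mult_power_le[of x m 1 "cnj y" 1] that by (simp add: power2_eq_square)
  have three: "norm (x * y * z) \<le> m ^ 6" if "norm x \<le> m\<^sup>2" "norm y \<le> m\<^sup>2" "norm z \<le> m\<^sup>2" for x y z :: complex
    using norm_mult_power_le[OF norm_mult_power_le[OF that(1,2)] that(3)] by simp
  have three': "norm (x * (y * z)) \<le> m ^ 6" if "norm x \<le> m\<^sup>2" "norm y \<le> m\<^sup>2" "norm z \<le> m\<^sup>2" for x y z :: complex
    using three[OF that] by (simp only: mult.assoc)
  have contr: "norm (x * s) \<le> B" if "norm x \<le> B" "norm s \<le> 1" for x s :: complex and B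
  proof -
    have "norm x * norm s \<le> norm x * 1" using that(2) by (intro mult_left_mono) auto
    then show ?thesis using that(1) by (simp add: norm_mult)
  qed
  have one: "norm (1 - x * cnj x) \<le> 1" if "norm x \<le> m" for x
  proof -
    have "1 - x * cnj x = complex_of_real (1 - (norm x)\<^sup>2)"
      by (simp only: of_real_diff of_real_1 complex_norm_square)
    then have "norm (1 - x * cnj x) = \<bar>1 - (norm x)\<^sup>2\<bar>" by (simp only: norm_of_real)
    moreover have "(norm x)\<^sup>2 \<le> 1" using that m(6) by (simp add: power_le_one)
    ultimately show ?thesis by simp
  qed
  note pm = pair[OF m(1) m(2)] pair[OF m(1) m(3)] pair[OF m(1) m(4)] pair[OF m(1) m(5)]
    pair[OF m(2) m(3)] pair[OF m(2) m(4)] pair[OF m(3) m(4)]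
  have ts: "norm t1 \<le> m\<^sup>2" "norm t2 \<le> m\<^sup>2" "norm t3 \<le> m\<^sup>2" "norm s1 \<le> 1" "norm s2 \<le> 1" "norm s3 \<le> 1"
    using m unfolding t1_def t2_def t3_def s1_def s2_def s3_def by (auto intro!: pair one)
  have ts': "norm (t1 * t2) \<le> m ^ 4" "norm (t2 * s1) \<le> m\<^sup>2"
    using norm_mult_power_le[OF ts(1,2)] contr[OF ts(2,4)] by simp_all
  have quad: "norm ((x1 * cnj x2) * (x3 * cnj x4) - q) \<le> 4 * (m ^ 3 * d)"
    if "norm x1 \<le> m" "norm x2 \<le> m" "norm x3 \<le> m" "norm x4 \<le> m"
      "norm (x1 - p0) \<le> d" "norm (x2 - p0) \<le> d" "norm (x3 - p0) \<le> d" "norm (x4 - p0) \<le> d" for x1 x2 x3 x4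
    unfolding q_def using that m(1)
    by (intro norm_diff_mult4_le) (simp_all flip: complex_cnj_diff)
  have d00: "norm (p0 - p0) \<le> d" using d0 by simp
  have sum_le: "norm (sum_list xs) \<le> sum_list (map norm xs)" for xs :: "complex list"
    by (induction xs) (auto intro: norm_triangle_mono)
  have "norm (sum_list R) \<le> sum_list (map norm R)" by (rule sum_le)
  \<comment> \<open>The entries cost at most 15 + 1/4 copies of m^6; the one of order eight is
    absorbed by m <= 1.\<close>
  also have "\<dots> \<le> 16 * m ^ 6"
  proof -
    have r1: "norm ((p0 * cnj p4) * (t1 * t2 * s3)) \<le> m ^ 6"
      using norm_mult_power_le[OF pm(4) contr[OF ts'(1) ts(6)]] by simp
    have r12: "norm ((p0 * cnj p2) * (p0 * cnj p2) * (t1 + t1 * s1)) \<le> 2 * m ^ 6"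
      using norm_triangle_mono[OF three[OF pm(2) pm(2) ts(1)] three[OF pm(2) pm(2) contr[OF ts(1) ts(4)]]]
      by (simp add: distrib_left)
    have r14: "norm ((p0 * cnj p1) * (p0 * cnj p1) * ((p0 * cnj p1) * (p0 * cnj p1))) \<le> m ^ 6"
    proof -
      have "norm ((p0 * cnj p1) * (p0 * cnj p1) * ((p0 * cnj p1) * (p0 * cnj p1))) \<le> m ^ (2 + 2 + (2 + 2))"
        by (intro norm_mult_power_le pm)
      also have "\<dots> \<le> m ^ 6" using m0 m(6) by (intro power_decreasing) auto
      finally show ?thesis .
    qed
    have scale: "norm (2 * x) = 2 * norm x" "norm (x / 2) = norm x / 2" "norm (- (x / 4)) = norm x / 4" for x :: complex
      by (simp_all add: norm_mult norm_divide)
    show ?thesis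
      unfolding R_def list.map sum_list.Cons sum_list.Nil scale
      using r1 three'[OF pm(4) ts(1) ts(3)] three'[OF pm(4) ts(2) ts(3)] three[OF pm(3) pm(7) ts(1)] three[OF pm(3) pm(7) ts'(2)]
        three[OF pm(2) pm(6) ts(1)] three[OF pm(2) pm(6) ts'(2)] three[OF pm(1) pm(3) ts(1)] three[OF pm(1) pm(3) ts'(2)]
        contr[OF three[OF pm(2) pm(5) pm(5)] ts(4)] contr[OF three[OF pm(1) pm(2) pm(5)] ts(4)] r12
        contr[OF three[OF pm(1) pm(1) pm(2)] ts(4)] r14 zero_le_power[OF m0, of 6]
      by linarith
  qed
  finally have Rb: "norm (sum_list R) \<le> 16 * m ^ 6" .
  have "norm (sum_list M) \<le> sum_list (map norm M)" by (rule sum_le)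
  \<comment> \<open>Seven entries at 4 and a halved one at 2 add up to 30.\<close>
  also have "\<dots> \<le> 40 * (m ^ 3 * d)"
  proof -
    have q': "norm (((p0 * cnj p2) * (p0 * cnj p2) - q) / 2) \<le> 2 * (m ^ 3 * d)"
      using quad[OF m(1) m(3) m(1) m(3) d00 d(2) d00 d(2)] by (simp add: norm_divide)
    show ?thesis
      unfolding M_def list.map sum_list.Cons sum_list.Nil
      using q' quad[OF m(1) m(5) m(2) m(2) d00 d(4) d(1) d(1)] quad[OF m(1) m(5) m(3) m(3) d00 d(4) d(2) d(2)]
        quad[OF m(1) m(5) m(4) m(4) d00 d(4) d(3) d(3)] quad[OF m(1) m(4) m(3) m(4) d00 d(3) d(2) d(3)]
        quad[OF m(1) m(3) m(2) m(4) d00 d(2) d(1) d(3)] quad[OF m(1) m(2) m(1) m(4) d00 d(1) d00 d(3)]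
        mult_nonneg_nonneg[OF zero_le_power[OF m0, of 3] d0]
      by linarith
  qed
  finally have "norm (sum_list M) \<le> 40 * (m ^ 3 * d)" .
  with Rb have "norm (sum_list R - sum_list M) \<le> 16 * m ^ 6 + 40 * (m ^ 3 * d)"
    by (meson add_mono norm_triangle_ineq4 order_trans)
  also have "\<dots> \<le> 40 * (m ^ 6 + m ^ 3 * d)" using zero_le_power[OF m0, of 6] by simp
  finally show ?thesis unfolding eq .
qed

section \<open>Boundedness below and summable errors\<close>

lemma sum_diff_shift4:
  fixes u :: "nat \<Rightarrow> real"
  shows "(\<Sum>n<N. u n - u (n + 4)) = (u 0 + u 1 + u 2 + u 3) - (u N + u (N + 1) + u (N + 2) + u (N + 3))"
  by (induction N) (simp_all add: eval_nat_numeral)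

lemma bounded_below_iff_summable_squares:
  fixes u e Z :: "nat \<Rightarrow> real"
  assumes c: "c > 0" and u: "\<And>n. 0 \<le> u n" "\<And>n. u n \<le> 1" and e: "summable (\<lambda>n. \<bar>e n\<bar>)"
    and Z: "\<And>n. Z (Suc (n + 4)) = Z (n + 4) + (u n - u (n + 4)) / 2 - c * (u (n + 4))\<^sup>2 + e n"
  shows "(\<exists>C. \<forall>N. C \<le> Z N) \<longleftrightarrow> summable (\<lambda>n. (u n)\<^sup>2)"
proof -
  define E where "E = (\<Sum>n. \<bar>e n\<bar>)"
  have ZN: "Z (N + 4) = Z 4 + (\<Sum>n<N. u n - u (n + 4)) / 2 - c * (\<Sum>n<N. (u (n + 4))\<^sup>2) + (\<Sum>n<N. e n)" for N
  proof (induction N)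
    case (Suc N)
    show ?case using Z[of N] Suc by (simp add: distrib_left diff_divide_distrib add_divide_distrib)
  qed simp
  have eN: "\<bar>\<Sum>n<N. e n\<bar> \<le> E" for N
  proof -
    have "\<bar>\<Sum>n<N. e n\<bar> \<le> (\<Sum>n<N. \<bar>e n\<bar>)" by (rule sum_abs)
    also have "\<dots> \<le> E" unfolding E_def by (rule sum_le_suminf[OF e]) auto
    finally show ?thesis .
  qed
  \<comment> \<open>After telescoping, four terms of each sign remain, all in [0, 1], so the
    difference is at most 4 in absolute value.\<close>
  have uN: "\<bar>(\<Sum>n<N. u n - u (n + 4)) / 2\<bar> \<le> 2" for N
    unfolding sum_diff_shift4
    using u[of 0] u[of 1] u[of 2] u[of 3] u[of N] u[of "N + 1"] u[of "N + 2"] u[of "N + 3"] by simp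
  show ?thesis
  proof
    assume "\<exists>C. \<forall>N. C \<le> Z N"
    then obtain C where C: "\<And>N. C \<le> Z N" by blast
    have "summable (\<lambda>n. (u (n + 4))\<^sup>2)"
    proof (rule summableI_nonneg_bounded)
      fix N
      have "c * (\<Sum>n<N. (u (n + 4))\<^sup>2) \<le> Z 4 + 2 + E - C"
        using ZN[of N] C[of "N + 4"] eN[of N] uN[of N] by linarith
      then show "(\<Sum>n<N. (u (n + 4))\<^sup>2) \<le> (Z 4 + 2 + E - C) / c"
        using c by (simp add: pos_le_divide_eq mult.commute)
    qed simp
    then show "summable (\<lambda>n. (u n)\<^sup>2)" by (simp only: summable_iff_shift[of "\<lambda>n. (u n)\<^sup>2" 4])
  next
    assume s: "summable (\<lambda>n. (u n)\<^sup>2)"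
    define S where "S = (\<Sum>n. (u (n + 4))\<^sup>2)"
    have s4: "summable (\<lambda>n. (u (n + 4))\<^sup>2)" by (simp only: summable_iff_shift[of "\<lambda>n. (u n)\<^sup>2" 4] s)
    \<comment> \<open>The recursion starts at index 4, so Z 0, ..., Z 3 enter the bound
      individually.\<close>
    define C where "C = Min (insert (Z 4 - 2 - c * S - E) (Z ` {..<4}))"
    have "C \<le> Z N" for N
    proof (cases "N < 4")
      case True then show ?thesis by (auto simp: C_def intro: Min_le)
    next
      case False
      then obtain k where k: "N = k + 4" by (metis add.commute le_Suc_ex not_less)
      have "(\<Sum>n<k. (u (n + 4))\<^sup>2) \<le> S" unfolding S_def by (rule sum_le_suminf[OF s4]) auto
      then have "c * (\<Sum>n<k. (u (n + 4))\<^sup>2) \<le> c * S" using c by simp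
      then have "Z 4 - 2 - c * S - E \<le> Z N"
        using ZN[of k] eN[of k] uN[of k] unfolding k by linarith
      moreover have "C \<le> Z 4 - 2 - c * S - E" by (simp add: C_def)
      ultimately show ?thesis by simp
    qed
    then show "\<exists>C. \<forall>N. C \<le> Z N" by blast
  qed
qed

text \<open>The derivative of ln(1 - x) + x + x^2/2 is -x^2/(1 - x), which lies between -2 x^2 and 0
  on [0, 1/2].\<close>

lemma ln_one_minus_estimate:
  fixes t :: real
  assumes "0 \<le> t" "t \<le> 1 / 2"
  shows "\<bar>ln (1 - t) + t + t\<^sup>2 / 2\<bar> \<le> 2 * t ^ 3"
proof -
  define g where "g = (\<lambda>x::real. ln (1 - x) + x + x\<^sup>2 / 2)"
  have d: "(g has_real_derivative (- (x\<^sup>2) / (1 - x))) (at x)" if "x \<le> 1 / 2" for x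
    unfolding g_def using that
    by (auto intro!: derivative_eq_intros simp: field_simps power2_eq_square)
  have "g t \<le> g 0"
  proof (rule DERIV_nonpos_imp_nonincreasing[OF assms(1)])
    fix x assume "0 \<le> x" "x \<le> t"
    then show "\<exists>y. (g has_real_derivative y) (at x) \<and> y \<le> 0"
      using d[of x] assms by (intro exI[of _ "- (x\<^sup>2) / (1 - x)"]) (auto simp: divide_nonpos_pos)
  qed
  \<comment> \<open>The summand 2 x^3 adds 6 x^2 to the derivative, more than enough to make it
    nonnegative.\<close>
  moreover have "g 0 + 2 * 0 ^ 3 \<le> g t + 2 * t ^ 3"
  proof (rule DERIV_nonneg_imp_nondecreasing[OF assms(1), of "\<lambda>x. g x + 2 * x ^ 3"])
    fix x assume x: "0 \<le> x" "x \<le> t"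
    have "((\<lambda>x. g x + 2 * x ^ 3) has_real_derivative (- (x\<^sup>2) / (1 - x) + 6 * x\<^sup>2)) (at x)"
      using x assms by (auto intro!: derivative_eq_intros d)
    moreover have "x\<^sup>2 / (1 - x) \<le> 6 * x\<^sup>2"
    proof -
      have "x\<^sup>2 / (1 - x) \<le> x\<^sup>2 / (1 / 2)" using x assms by (intro divide_left_mono) auto
      also have "x\<^sup>2 / (1 / 2) \<le> 6 * x\<^sup>2" by simp
      finally show ?thesis .
    qed
    ultimately show "\<exists>y. ((\<lambda>x. g x + 2 * x ^ 3) has_real_derivative y) (at x) \<and> 0 \<le> y"
      by force
  qed
  moreover have "g 0 = 0" by (simp add: g_def)
  ultimately show ?thesis unfolding g_def using assms by auto
qed

text \<open>The mixed term m^3 D of the estimate is at most (m^6 + D^2) / 2, which lets the l^6 and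
  the l^2 condition act separately.\<close>

lemma summable_step_poly_error:
  fixes a :: "nat \<Rightarrow> complex"
  assumes a: "\<And>n. norm (a n) < 1" and s6: "summable (\<lambda>n. norm (a n) ^ 6)"
    and s2: "summable (\<lambda>n. norm (a (Suc n) - a n) ^ 2)"
  shows "summable (\<lambda>n. norm (step_poly (a (n + 4)) (a (n + 3)) (a (n + 2)) (a (n + 1)) (a n)
    - (a (n + 4) * cnj (a n) - 15 / 2 * (a (n + 4) * cnj (a (n + 4)))\<^sup>2)))"
proof -
  define d where "d = (\<lambda>n. norm (a (Suc n) - a n))"
  define D where "D = (\<lambda>n. d n + d (n + 1) + d (n + 2) + d (n + 3))"
  define A where "A = (\<lambda>n. {norm (a n), norm (a (n + 1)), norm (a (n + 2)), norm (a (n + 3)), norm (a (n + 4))})"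
  \<comment> \<open>The maximum is attained at one of the five entries, so its sixth power is at
    most the sum s of theirs.\<close>
  define m where "m = (\<lambda>n. Max (A n))"
  define s where "s = (\<lambda>n. norm (a n) ^ 6 + norm (a (n + 1)) ^ 6 + norm (a (n + 2)) ^ 6 + norm (a (n + 3)) ^ 6 + norm (a (n + 4)) ^ 6)"
  define q where "q = (\<lambda>n. (d n)\<^sup>2 + (d (n + 1))\<^sup>2 + (d (n + 2))\<^sup>2 + (d (n + 3))\<^sup>2)"
  have "summable s"
    unfolding s_def by (intro summable_add summable_ignore_initial_segment s6)
  moreover have "summable q"
    using s2 unfolding q_def d_def[symmetric] by (intro summable_add summable_ignore_initial_segment) (auto simp: d_def)
  ultimately have "summable (\<lambda>n. 40 * (2 * s n + 4 * q n))" by (intro summable_add summable_mult)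
  then show ?thesis
  proof (rule summable_comparison_test'[where N=0])
    fix n :: nat
    have mA: "x \<le> m n" if "x \<in> A n" for x
      using that unfolding m_def by (intro Max_ge) (auto simp: A_def)
    have "m n \<in> A n" unfolding m_def by (intro Max_in) (auto simp: A_def)
    then have m1: "m n \<le> 1" and m6: "m n ^ 6 \<le> s n"
      using less_imp_le[OF a] by (auto simp: A_def s_def)
    have D: "norm (a (n + 3) - a (n + 4)) \<le> D n" "norm (a (n + 2) - a (n + 4)) \<le> D n"
        "norm (a (n + 1) - a (n + 4)) \<le> D n" "norm (a n - a (n + 4)) \<le> D n"
    proof -
      have e: "d n = norm (a (n + 1) - a n)" "d (n + 1) = norm (a (n + 2) - a (n + 1))"
          "d (n + 2) = norm (a (n + 3) - a (n + 2))" "d (n + 3) = norm (a (n + 4) - a (n + 3))"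
        by (simp_all add: d_def eval_nat_numeral)
      have t: "norm (x - z) \<le> norm (y - x) + norm (z - y)" for x y z :: complex
        by (metis dist_norm dist_triangle dist_commute)
      have c: "norm (a (n + 3) - a (n + 4)) = norm (a (n + 4) - a (n + 3))" by (rule norm_minus_commute)
      show "norm (a (n + 3) - a (n + 4)) \<le> D n" "norm (a (n + 2) - a (n + 4)) \<le> D n"
        "norm (a (n + 1) - a (n + 4)) \<le> D n" "norm (a n - a (n + 4)) \<le> D n"
        unfolding D_def e
        using c norm_minus_commute[of "a (n + 4)" "a (n + 1)"] t[of "a (n + 2)" "a (n + 4)" "a (n + 3)"] t[of "a (n + 1)" "a (n + 4)" "a (n + 2)"]
          t[of "a n" "a (n + 4)" "a (n + 1)"] t[of "a (n + 1)" "a (n + 4)" "a (n + 2)"]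
          norm_triangle_ineq[of "a (n + 4) - a (n + 3)" "a (n + 3) - a (n + 2)"]
          norm_ge_zero[of "a (n + 1) - a n"] norm_ge_zero[of "a (n + 2) - a (n + 1)"]
          norm_ge_zero[of "a (n + 3) - a (n + 2)"]
        by (simp_all only: diff_add_cancel add_diff_eq)
    qed
    \<comment> \<open>Cauchy-Schwarz for four terms, with the defect written as a sum of
      squares.\<close>
    have Dq: "(D n)\<^sup>2 \<le> 4 * q n"
    proof -
      have "4 * q n - (D n)\<^sup>2 = (d n - d (n+1))\<^sup>2 + (d n - d (n+2))\<^sup>2 + (d n - d (n+3))\<^sup>2
        + (d (n+1) - d (n+2))\<^sup>2 + (d (n+1) - d (n+3))\<^sup>2 + (d (n+2) - d (n+3))\<^sup>2"
        unfolding D_def q_def by (simp add: power2_eq_square algebra_simps)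
      then show ?thesis by (smt (verit) zero_le_power2)
    qed
    have "m n ^ 3 * D n \<le> ((m n ^ 3)\<^sup>2 + (D n)\<^sup>2) / 2"
      using sum_squares_bound[of "m n ^ 3" "D n"] by simp
    moreover have "(m n ^ 3)\<^sup>2 = m n ^ 6" by (simp flip: power_mult)
    moreover have "y + x \<le> 2 * s n + 4 * q n"
      if "x \<le> (y + z) / 2" "z \<le> 4 * q n" "y \<le> s n" "0 \<le> z" "0 \<le> y" for x y z
      using that by (simp add: field_simps)
    ultimately have mD: "m n ^ 6 + m n ^ 3 * D n \<le> 2 * s n + 4 * q n"
      using Dq m6 zero_le_power2[of "D n"] zero_le_power2[of "m n ^ 3"] by metis
    have "norm (step_poly (a (n + 4)) (a (n + 3)) (a (n + 2)) (a (n + 1)) (a n)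
      - (a (n + 4) * cnj (a n) - 15 / 2 * (a (n + 4) * cnj (a (n + 4)))\<^sup>2)) \<le> 40 * (m n ^ 6 + m n ^ 3 * D n)"
      by (rule step_poly_estimate) (use D m1 mA in \<open>auto simp: A_def\<close>)
    also have "\<dots> \<le> 40 * (2 * s n + 4 * q n)" using mD by simp
    finally show "norm (norm (step_poly (a (n + 4)) (a (n + 3)) (a (n + 2)) (a (n + 1)) (a n)
      - (a (n + 4) * cnj (a n) - 15 / 2 * (a (n + 4) * cnj (a (n + 4)))\<^sup>2))) \<le> 40 * (2 * s n + 4 * q n)"
      by simp
  qed
qed

section \<open>Bernstein-Szego entropies\<close>

text \<open>The density of the Bernstein-Szego approximation, whose Verblunsky coefficients are
  \<open>a 0, \<dots>, a (n - 1), 0, 0, \<dots>\<close>.\<close>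
definition bs_weight :: "(nat \<Rightarrow> complex) \<Rightarrow> nat \<Rightarrow> complex \<Rightarrow> real" where
  "bs_weight a n z = (\<Prod>j<n. 1 - (norm (a j))\<^sup>2) / (norm (poly (opuc a n) z))\<^sup>2"

definition bs_entropy :: "(nat \<Rightarrow> complex) \<Rightarrow> nat \<Rightarrow> real" where
  "bs_entropy a n = (LINT \<theta>|dtheta. (1 - cos (4 * \<theta>)) * ln (bs_weight a n (cis \<theta>)))"

text \<open>For coefficients in the disc this is a finite Blaschke product, and its recursion in n
  is a Schur step.\<close>

definition opuc_ratio :: "(nat \<Rightarrow> complex) \<Rightarrow> nat \<Rightarrow> complex \<Rightarrow> complex" where
  "opuc_ratio a n z = poly (opuc a n) z / poly (opuc_rev a n) z"

text \<open>A holomorphic logarithm of Psi_(n+1) / Psi_n. The argument of \<open>Ln\<close> has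
  positive real part on the closed disc when the coefficients lie in the open disc, so the principal
  branch serves.\<close>

definition opuc_step :: "(nat \<Rightarrow> complex) \<Rightarrow> nat \<Rightarrow> complex \<Rightarrow> complex" where
  "opuc_step a n z = Ln (1 - a n * (z * opuc_ratio a n z))"

lemma integral_fejer4: "(LINT \<theta>|dtheta. 1 - cos (4 * \<theta>)) = 1"
proof -
  have "(deriv ^^ 4) (\<lambda>_. 1 :: complex) 0 = 0"
    by (simp add: eval_nat_numeral)
  then show ?thesis
    using circle_fejer4[of "\<lambda>_. 1"] by simp
qed

context
  fixes a :: "nat \<Rightarrow> complex"
  assumes a: "\<And>j. norm (a j) < 1"
begin

lemma verblunsky_factor_pos: "0 < 1 - (norm (a n))\<^sup>2"
  using a[of n] by (simp add: abs_square_less_1)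

lemma verblunsky_prod_pos: "0 < (\<Prod>j<n. 1 - (norm (a j))\<^sup>2)"
  by (intro prod_pos verblunsky_factor_pos)

lemma opuc_rev_nz: "norm z \<le> 1 \<Longrightarrow> poly (opuc_rev a n) z \<noteq> 0"
  using opuc_rev_nonzero[of a] a by blast

lemma opuc_circle_nonzero: "norm z = 1 \<Longrightarrow> poly (opuc a n) z \<noteq> 0"
  using opuc_rev_nz[of z n] norm_opuc_rev_circle[of z a n] by force

lemma bs_weight_pos: "norm z = 1 \<Longrightarrow> 0 < bs_weight a n z"
  using opuc_circle_nonzero verblunsky_prod_pos by (simp add: bs_weight_def)

lemma continuous_on_bs_weight: "continuous_on (sphere 0 1) (bs_weight a n)"
  unfolding bs_weight_def [abs_def]
  by (intro continuous_intros) (auto simp: opuc_circle_nonzero)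

lemma continuous_on_ln_bs_weight: "continuous_on A (\<lambda>\<theta>. ln (bs_weight a n (cis \<theta>)))"
proof -
  have "continuous_on (sphere 0 1) (\<lambda>z. ln (bs_weight a n z))"
    using bs_weight_pos by (intro continuous_on_ln continuous_on_bs_weight) (auto simp: less_imp_neq[symmetric] dest: less_imp_neq)
  then show ?thesis by (rule continuous_on_cis_compose)
qed

lemma norm_opuc_ratio_le:
  assumes "norm z \<le> 1"
  shows "norm (opuc_ratio a n z) \<le> 1"
  using norm_opuc_le[of a z n] a assms opuc_rev_nz[OF assms, of n]
  by (simp add: opuc_ratio_def norm_divide)

lemma norm_opuc_step_arg:
  assumes "norm z \<le> 1"
  shows "norm (a n * (z * opuc_ratio a n z)) < 1"
proof -
  have "norm (z * opuc_ratio a n z) \<le> 1 * 1"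
    unfolding norm_mult using assms norm_opuc_ratio_le[OF assms] by (intro mult_mono) auto
  then have "norm (a n) * norm (z * opuc_ratio a n z) \<le> norm (a n) * 1"
    by (intro mult_left_mono) auto
  then show ?thesis using a[of n] by (simp only: norm_mult)
qed

lemma opuc_step_arg_Re:
  assumes "norm z \<le> 1"
  shows "0 < Re (1 - a n * (z * opuc_ratio a n z))"
  using norm_opuc_step_arg[OF assms, of n] complex_Re_le_cmod[of "a n * (z * opuc_ratio a n z)"]
  by simp

lemma holomorphic_opuc_ratio: "opuc_ratio a n holomorphic_on cball 0 1"
  unfolding opuc_ratio_def [abs_def]
  by (intro holomorphic_intros) (auto simp: opuc_rev_nz)

lemma holomorphic_opuc_step: "opuc_step a n holomorphic_on cball 0 1"
  unfolding opuc_step_def [abs_def]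
proof (intro holomorphic_intros holomorphic_opuc_ratio)
  fix z assume "z \<in> cball (0::complex) 1"
  then have "0 < Re (1 - a n * (z * opuc_ratio a n z))" by (intro opuc_step_arg_Re) simp
  then show "1 - a n * (z * opuc_ratio a n z) \<notin> \<real>\<^sub>\<le>\<^sub>0" 
    by (meson complex_nonpos_Reals_iff linorder_not_less)
qed

lemma opuc_rev_ratio:
  assumes "norm z \<le> 1"
  shows "poly (opuc_rev a (Suc n)) z = poly (opuc_rev a n) z * (1 - a n * (z * opuc_ratio a n z))"
  using opuc_rev_nz[OF assms, of n]
  unfolding poly_opuc_rev_Suc opuc_ratio_def by (simp add: field_simps)

text \<open>The quotient of the two Szego recursions, kept free of division so that it transfers to
  formal power series.\<close>

lemma opuc_ratio_Suc:
  assumes "norm z \<le> 1"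
  shows "opuc_ratio a (Suc n) z * (1 - a n * (z * opuc_ratio a n z)) = z * opuc_ratio a n z - cnj (a n)"
proof -
  have nz: "poly (opuc_rev a n) z \<noteq> 0" "poly (opuc_rev a (Suc n)) z \<noteq> 0"
    using opuc_rev_nz[OF assms] by blast+
  then have "1 - a n * (z * opuc_ratio a n z) = poly (opuc_rev a (Suc n)) z / poly (opuc_rev a n) z"
    using opuc_rev_ratio[OF assms, of n] by simp
  then have "opuc_ratio a (Suc n) z * (1 - a n * (z * opuc_ratio a n z)) =
      poly (opuc a (Suc n)) z / poly (opuc_rev a n) z"
    using nz(2) by (simp only: opuc_ratio_def) simp
  also have "\<dots> = z * opuc_ratio a n z - cnj (a n)"
    unfolding poly_opuc_Suc opuc_ratio_def using nz(1) by (simp add: diff_divide_distrib)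
  finally show ?thesis .
qed

text \<open>On the circle |Phi_n| = |Psi_n|, so the weight changes by the factor 1 - |a_n|^2 over
  the square of |Psi_(n+1) / Psi_n|; the square accounts for the 2.\<close>

lemma ln_bs_weight_Suc:
  assumes z: "norm z = 1"
  shows "ln (bs_weight a (Suc n) z) = ln (bs_weight a n z) + ln (1 - (norm (a n))\<^sup>2) - 2 * Re (opuc_step a n z)"
proof -
  define u where "u = 1 - a n * (z * opuc_ratio a n z)"
  have u: "u \<noteq> 0" using opuc_step_arg_Re[of z n] z unfolding u_def by force
  have "poly (opuc_rev a (Suc n)) z = poly (opuc_rev a n) z * u"
    unfolding u_def using z by (intro opuc_rev_ratio) simp
  then have nu: "norm (poly (opuc a (Suc n)) z) = norm (poly (opuc a n) z) * norm u"
    by (simp only: norm_opuc_rev_circle[OF z, symmetric] norm_mult)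
  have "bs_weight a (Suc n) z = bs_weight a n z * (1 - (norm (a n))\<^sup>2) / (norm u)\<^sup>2"
    unfolding bs_weight_def nu by (simp add: power_mult_distrib)
  then have "ln (bs_weight a (Suc n) z) = ln (bs_weight a n z) + ln (1 - (norm (a n))\<^sup>2) - ln ((norm u)\<^sup>2)"
    using bs_weight_pos[OF z, of n] verblunsky_factor_pos[of n] u
    by (simp add: ln_div ln_mult)
  also have "ln ((norm u)\<^sup>2) = 2 * Re (opuc_step a n z)"
    using u by (simp add: opuc_step_def u_def[symmetric] ln_realpow)
  finally show ?thesis .
qed

text \<open>In \<open>circle_fejer4\<close> with h = \<open>opuc_step a n\<close> the value at 0 is
  Ln 1 = 0, and the fourth coefficient receives the factor (-2) * (-1/2) = 1.\<close>

lemma bs_entropy_Suc: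
  "bs_entropy a (Suc n) = bs_entropy a n + ln (1 - (norm (a n))\<^sup>2) + Re (fps_nth (fps_expansion (opuc_step a n) 0) 4)"
proof -
  let ?Q = "\<lambda>\<theta>::real. 1 - cos (4 * \<theta>)"
  have cs: "continuous_on A (\<lambda>\<theta>. opuc_step a n (cis \<theta>))" for A
    by (intro continuous_on_cis_compose
        continuous_on_subset[OF holomorphic_on_imp_continuous_on[OF holomorphic_opuc_step]]) auto
  have i1: "integrable dtheta (\<lambda>\<theta>. ?Q \<theta> * ln (bs_weight a n (cis \<theta>)))"
    by (intro integrable_dtheta_continuous continuous_intros continuous_on_ln_bs_weight)
  have i2: "integrable dtheta (\<lambda>\<theta>. ?Q \<theta> * c)" for c
    by (intro integrable_dtheta_continuous continuous_intros)
  have i3: "integrable dtheta (\<lambda>\<theta>. ?Q \<theta> * Re (opuc_step a n (cis \<theta>)))"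
    by (intro integrable_dtheta_continuous continuous_intros cs)
  have "bs_entropy a (Suc n) = (LINT \<theta>|dtheta. ?Q \<theta> * ln (bs_weight a n (cis \<theta>)) +
      ?Q \<theta> * ln (1 - (norm (a n))\<^sup>2) - 2 * (?Q \<theta> * Re (opuc_step a n (cis \<theta>))))"
    unfolding bs_entropy_def by (simp add: ln_bs_weight_Suc algebra_simps)
  also have "\<dots> = bs_entropy a n + (LINT \<theta>|dtheta. ?Q \<theta> * ln (1 - (norm (a n))\<^sup>2)) -
      2 * (LINT \<theta>|dtheta. ?Q \<theta> * Re (opuc_step a n (cis \<theta>)))"
    unfolding bs_entropy_def
    by (subst Bochner_Integration.integral_diff Bochner_Integration.integral_add
        Bochner_Integration.integral_mult_right_zero;
        (intro i1 i2 i3 Bochner_Integration.integrable_add Bochner_Integration.integrable_mult_right)?)+ simp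
  also have "(LINT \<theta>|dtheta. ?Q \<theta> * ln (1 - (norm (a n))\<^sup>2)) = ln (1 - (norm (a n))\<^sup>2)"
    by (subst Bochner_Integration.integral_mult_left_zero) (simp only: integral_fejer4 mult_1)
  also have "(LINT \<theta>|dtheta. ?Q \<theta> * Re (opuc_step a n (cis \<theta>))) =
      - Re (fps_nth (fps_expansion (opuc_step a n) 0) 4) / 2"
    using circle_fejer4[OF holomorphic_opuc_step[of n]]
    by (simp add: fps_expansion_def opuc_step_def)
  finally show ?thesis by simp
qed

section \<open>Taylor coefficients at 0\<close>

lemma opuc_ratio_fps: "opuc_ratio a n has_fps_expansion fps_expansion (opuc_ratio a n) 0"
  by (rule has_fps_expansion_fps_expansion[OF open_ball[of 0 1]])
    (auto intro: holomorphic_on_subset[OF holomorphic_opuc_ratio])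

lemma opuc_step_fps: "opuc_step a n has_fps_expansion fps_expansion (opuc_step a n) 0"
  by (rule has_fps_expansion_fps_expansion[OF open_ball[of 0 1]])
    (auto intro: holomorphic_on_subset[OF holomorphic_opuc_step])

lemma eventually_unit_disc: "(\<And>z. norm z < 1 \<Longrightarrow> P z) \<Longrightarrow> eventually P (nhds (0::complex))"
  by (rule eventually_nhds_ball[of 1, THEN eventually_mono]) auto

lemma opuc_ratio_fps_Suc:
  fixes n
  defines "B \<equiv> \<lambda>n. fps_expansion (opuc_ratio a n) 0"
  shows "B (Suc n) * (1 - fps_const (a n) * (fps_X * B n)) = fps_X * B n - fps_const (cnj (a n))"
proof (rule fps_expansion_unique_complex)
  show "(\<lambda>z. opuc_ratio a (Suc n) z * (1 - a n * (z * opuc_ratio a n z))) has_fps_expansion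
      B (Suc n) * (1 - fps_const (a n) * (fps_X * B n))"
    unfolding B_def by (intro fps_expansion_intros opuc_ratio_fps)
  have "(\<lambda>z. z * opuc_ratio a n z - cnj (a n)) has_fps_expansion fps_X * B n - fps_const (cnj (a n))"
    unfolding B_def by (intro fps_expansion_intros opuc_ratio_fps)
  moreover have "eventually (\<lambda>z. z * opuc_ratio a n z - cnj (a n) =
      opuc_ratio a (Suc n) z * (1 - a n * (z * opuc_ratio a n z))) (nhds 0)"
    by (rule eventually_unit_disc) (simp add: opuc_ratio_Suc)
  ultimately show "(\<lambda>z. opuc_ratio a (Suc n) z * (1 - a n * (z * opuc_ratio a n z))) has_fps_expansion
      fps_X * B n - fps_const (cnj (a n))"
    by (subst (asm) has_fps_expansion_cong) auto
qed

text \<open>Passing to the logarithmic derivative yields a linear recursion for the coefficients, so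
  no logarithm series has to be composed with U.\<close>

lemma opuc_step_fps_deriv:
  fixes n
  defines "U \<equiv> fps_const (a n) * (fps_X * fps_expansion (opuc_ratio a n) 0)"
  shows "fps_deriv (fps_expansion (opuc_step a n) 0) * (1 - U) = - fps_deriv U"
proof (rule fps_expansion_unique_complex)
  define u where "u = (\<lambda>z. a n * (z * opuc_ratio a n z))"
  have U: "u has_fps_expansion U"
    unfolding U_def u_def by (intro fps_expansion_intros opuc_ratio_fps)
  show "(\<lambda>z. deriv (opuc_step a n) z * (1 - u z)) has_fps_expansion
      fps_deriv (fps_expansion (opuc_step a n) 0) * (1 - U)"
    by (intro fps_expansion_intros opuc_step_fps U)
  have "(\<lambda>z. - deriv u z) has_fps_expansion - fps_deriv U"
    by (intro fps_expansion_intros U)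
  moreover have "eventually (\<lambda>z. - deriv u z = deriv (opuc_step a n) z * (1 - u z)) (nhds 0)"
  proof (rule eventually_unit_disc)
    fix z :: complex assume z: "norm z < 1"
    have "u holomorphic_on ball 0 1"
      unfolding u_def
      by (intro holomorphic_intros holomorphic_on_subset[OF holomorphic_opuc_ratio]) auto
    then have du: "(u has_field_derivative deriv u z) (at z)"
      using z by (intro holomorphic_derivI[of u "ball 0 1"]) auto
    have pos: "0 < Re (1 - u z)" unfolding u_def using z by (intro opuc_step_arg_Re) simp
    then have "1 - u z \<notin> \<real>\<^sub>\<le>\<^sub>0" by (meson complex_nonpos_Reals_iff linorder_not_less)
    then have "((\<lambda>z. Ln (1 - u z)) has_field_derivative (- deriv u z) / (1 - u z)) (at z)"
      by (auto intro!: derivative_eq_intros du simp: divide_inverse)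
    then have "deriv (opuc_step a n) z = (- deriv u z) / (1 - u z)"
      unfolding opuc_step_def [abs_def] u_def by (rule DERIV_imp_deriv)
    moreover have "1 - u z \<noteq> 0" using pos by auto
    ultimately show "- deriv u z = deriv (opuc_step a n) z * (1 - u z)" by simp
  qed
  ultimately show "(\<lambda>z. deriv (opuc_step a n) z * (1 - u z)) has_fps_expansion - fps_deriv U"
    by (subst (asm) has_fps_expansion_cong) auto
qed

text \<open>This is the coefficient of z^4 in -(U + U^2/2 + U^3/3 + U^4/4) for U = a_n z (b_0 + b_1
  z + ...), found by solving the recursion at orders 1 to 4.\<close>

lemma opuc_step_coeff4:
  fixes n
  defines "b \<equiv> fps_nth (fps_expansion (opuc_ratio a n) 0)"
  shows "fps_nth (fps_expansion (opuc_step a n) 0) 4 =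
    - (a n * b 3 + (a n)\<^sup>2 * b 0 * b 2 + (a n)\<^sup>2 * (b 1)\<^sup>2 / 2 + (a n) ^ 3 * (b 0)\<^sup>2 * b 1 + (a n) ^ 4 * (b 0) ^ 4 / 4)"
proof -
  define H where "H = fps_expansion (opuc_step a n) 0"
  define U where "U = fps_const (a n) * (fps_X * fps_expansion (opuc_ratio a n) 0)"
  have U: "fps_nth U 0 = 0" "fps_nth U (Suc k) = a n * b k" for k
    by (simp_all add: U_def b_def)
  have D: "fps_nth (fps_deriv H * (1 - U)) k = - fps_nth (fps_deriv U) k" for k
    using opuc_step_fps_deriv[of n] by (simp add: H_def U_def)
  have h1: "fps_nth H 1 = - (a n * b 0)"
    using D[of 0] by (simp add: U)
  have h2: "2 * fps_nth H 2 + fps_nth H 1 * (- (a n * b 0)) = - (2 * (a n * b 1))"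
    using D[of 1] by (simp add: U fps_mult_nth eval_nat_numeral)
  have h3: "3 * fps_nth H 3 + 2 * fps_nth H 2 * (- (a n * b 0)) + fps_nth H 1 * (- (a n * b 1)) = - (3 * (a n * b 2))"
    using D[of 2] by (simp add: U fps_mult_nth eval_nat_numeral algebra_simps)
  have h4: "4 * fps_nth H 4 + 3 * fps_nth H 3 * (- (a n * b 0)) + 2 * fps_nth H 2 * (- (a n * b 1))
      + fps_nth H 1 * (- (a n * b 2)) = - (4 * (a n * b 3))"
    using D[of 3] by (simp add: U fps_mult_nth eval_nat_numeral algebra_simps)
  have h2': "fps_nth H 2 = - (a n * b 1) - (a n * b 0)\<^sup>2 / 2"
    using h2 unfolding h1 by (simp add: power2_eq_square algebra_simps) (simp add: field_simps)
  have h3': "fps_nth H 3 = - (a n * b 2) - (a n * b 0) * (a n * b 1) - (a n * b 0) ^ 3 / 3"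
    using h3 unfolding h1 h2' by (simp add: power2_eq_square power3_eq_cube algebra_simps) (simp add: field_simps)
  have "4 * fps_nth H 4 = - (4 * (a n * b 3)) + 3 * fps_nth H 3 * (a n * b 0) + 2 * fps_nth H 2 * (a n * b 1)
      + fps_nth H 1 * (a n * b 2)"
    using h4 by (simp add: algebra_simps)
  also have "\<dots> = 4 * (- (a n * b 3 + (a n)\<^sup>2 * b 0 * b 2 + (a n)\<^sup>2 * (b 1)\<^sup>2 / 2
      + (a n) ^ 3 * (b 0)\<^sup>2 * b 1 + (a n) ^ 4 * (b 0) ^ 4 / 4))"
    unfolding h1 h2' h3' by (simp add: algebra_simps eval_nat_numeral)
  finally show ?thesis unfolding H_def mult_cancel_left by (rule disjE) simp_all
qed

text \<open>Because of the factor z, c_k depends only on a_n and b_0, ..., b_(k-1), and c_0 on a_n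
  alone. Hence four applications reduce b_0, ..., b_3 to four consecutive coefficients.\<close>

lemma opuc_ratio_coeffs:
  fixes n
  defines "b \<equiv> fps_nth (fps_expansion (opuc_ratio a n) 0)"
    and "c \<equiv> fps_nth (fps_expansion (opuc_ratio a (Suc n)) 0)"
    and "r \<equiv> 1 - a n * cnj (a n)"
  shows "c 0 = - cnj (a n)" and "c 1 = r * b 0" and "c 2 = r * (b 1 + a n * (b 0)\<^sup>2)"
    and "c 3 = r * (b 2 + 2 * a n * b 0 * b 1 + (a n)\<^sup>2 * (b 0) ^ 3)"
proof -
  define U where "U = fps_const (a n) * (fps_X * fps_expansion (opuc_ratio a n) 0)"
  have U: "fps_nth U 0 = 0" "fps_nth U (Suc k) = a n * b k" for k
    by (simp_all add: U_def b_def)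
  have D: "fps_nth (fps_expansion (opuc_ratio a (Suc n)) 0 * (1 - U)) k =
      fps_nth (fps_X * fps_expansion (opuc_ratio a n) 0 - fps_const (cnj (a n))) k" for k
    using opuc_ratio_fps_Suc[of n] by (simp add: U_def)
  show c0: "c 0 = - cnj (a n)"
    using D[of 0] by (simp add: U c_def)
  have "c 1 = b 0 + a n * (c 0 * b 0)"
    using D[of 1] by (simp add: U fps_mult_nth eval_nat_numeral c_def[symmetric] b_def[symmetric] algebra_simps)
  then show c1: "c 1 = r * b 0"
    unfolding c0 by (simp add: r_def algebra_simps)
  have "c 2 = b 1 + a n * (c 0 * b 1 + c 1 * b 0)"
    using D[of 2] by (simp add: U fps_mult_nth eval_nat_numeral c_def[symmetric] b_def[symmetric] algebra_simps)
  then show c2: "c 2 = r * (b 1 + a n * (b 0)\<^sup>2)"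
    unfolding c0 c1 by (simp add: r_def algebra_simps power2_eq_square)
  have "c 3 = b 2 + a n * (c 0 * b 2 + c 1 * b 1 + c 2 * b 0)"
    using D[of 3] by (simp add: U fps_mult_nth eval_nat_numeral c_def[symmetric] b_def[symmetric] algebra_simps)
  then show "c 3 = r * (b 2 + 2 * a n * b 0 * b 1 + (a n)\<^sup>2 * (b 0) ^ 3)"
    unfolding c0 c1 c2 by (simp add: r_def algebra_simps eval_nat_numeral)
qed

lemma opuc_step_coeff4_eq:
  "fps_nth (fps_expansion (opuc_step a (n + 4)) 0) 4 =
    step_poly (a (n + 4)) (a (n + 3)) (a (n + 2)) (a (n + 1)) (a n)"
proof -
  have e: "n + 4 = Suc (n + 3)" "n + 3 = Suc (n + 2)" "n + 2 = Suc (n + 1)" "n + 1 = Suc n" by simp_all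
  note c1 = opuc_ratio_coeffs[of n, folded e(4)]
    and c2 = opuc_ratio_coeffs[of "n + 1", folded e(3)]
    and c3 = opuc_ratio_coeffs[of "n + 2", folded e(2)]
    and c4 = opuc_ratio_coeffs[of "n + 3", folded e(1)]
  define p0 p1 p2 p3 p4 where "p0 = a (n + 4)" and "p1 = a (n + 3)" and "p2 = a (n + 2)" and "p3 = a (n + 1)" and "p4 = a n"
  show ?thesis
    unfolding opuc_step_coeff4 c4 c3 c2 c1 p0_def[symmetric] p1_def[symmetric] p2_def[symmetric] p3_def[symmetric] p4_def[symmetric]
      step_poly_def Let_def
    by (simp add: algebra_simps eval_nat_numeral)
qed

end

section \<open>The entropy criterion in terms of the coefficients\<close>

lemma summable_norm_add_power2:
  fixes f g :: "nat \<Rightarrow> 'a::real_normed_vector"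
  assumes "summable (\<lambda>n. (norm (f n))\<^sup>2)" "summable (\<lambda>n. (norm (g n))\<^sup>2)"
  shows "summable (\<lambda>n. (norm (f n + g n))\<^sup>2)"
proof (rule summable_comparison_test')
  show "summable (\<lambda>n. 2 * (norm (f n))\<^sup>2 + 2 * (norm (g n))\<^sup>2)"
    by (intro summable_add summable_mult assms)
  fix n :: nat
  have "(norm (f n + g n))\<^sup>2 \<le> (norm (f n) + norm (g n))\<^sup>2"
    by (intro power_mono norm_triangle_ineq) auto
  also have "\<dots> \<le> 2 * (norm (f n))\<^sup>2 + 2 * (norm (g n))\<^sup>2"
    using zero_le_power2[of "norm (f n) - norm (g n)"] by (simp add: power2_eq_square algebra_simps)
  finally show "norm ((norm (f n + g n))\<^sup>2) \<le> 2 * (norm (f n))\<^sup>2 + 2 * (norm (g n))\<^sup>2" by simp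
qed

theorem bs_entropy_bounded_below_iff:
  fixes a :: "nat \<Rightarrow> complex"
  assumes a: "\<And>n. norm (a n) < 1" and s6: "summable (\<lambda>n. norm (a n) ^ 6)"
    and s2: "summable (\<lambda>n. norm (a (Suc n) - a n) ^ 2)"
  shows "(\<exists>C. \<forall>N. C \<le> bs_entropy a N) \<longleftrightarrow> summable (\<lambda>n. norm (a n) ^ 4)"
proof -
  define u where "u = (\<lambda>n. (norm (a n))\<^sup>2)"
  define r where "r = (\<lambda>n. step_poly (a (n + 4)) (a (n + 3)) (a (n + 2)) (a (n + 1)) (a n)
    - (a (n + 4) * cnj (a n) - 15 / 2 * (a (n + 4) * cnj (a (n + 4)))\<^sup>2))"
  define l where "l = (\<lambda>n. ln (1 - u n) + u n + (u n)\<^sup>2 / 2)"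
  \<comment> \<open>Re (x cnj y) = (|x|^2 + |y|^2 - |x - y|^2) / 2 supplies both the telescoping
    term and the squared difference; l and r are the errors of the logarithm and of the Taylor
    coefficient.\<close>
  define e where "e = (\<lambda>n. l (n + 4) + Re (r n) - (norm (a (n + 4) - a n))\<^sup>2 / 2)"
  have "summable (\<lambda>n. \<bar>l n\<bar>)"
  proof (rule summable_comparison_test_ev)
    have "(\<lambda>n. norm (a n) ^ 6) \<longlonglongrightarrow> 0" using s6 by (rule summable_LIMSEQ_zero)
    \<comment> \<open>1/8 = (1/2)^3 forces |a_n|^2 <= 1/2, the range of the logarithm
      estimate.\<close>
    then have "eventually (\<lambda>n. norm (a n) ^ 6 < 1 / 8) sequentially"
      by (rule order_tendstoD) simp
    then show "eventually (\<lambda>n. norm \<bar>l n\<bar> \<le> 2 * norm (a n) ^ 6) sequentially"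
    proof eventually_elim
      case (elim n)
      have u3: "u n ^ 3 = norm (a n) ^ 6" by (simp add: u_def flip: power_mult)
      have "u n \<le> 1 / 2"
      proof (rule ccontr)
        assume "\<not> u n \<le> 1 / 2"
        then have "(1 / 2) ^ 3 \<le> u n ^ 3" by (intro power_mono) auto
        then show False using elim u3 by (simp add: power_divide)
      qed
      then have "\<bar>l n\<bar> \<le> 2 * u n ^ 3"
        unfolding l_def by (intro ln_one_minus_estimate) (auto simp: u_def)
      then show ?case by (simp add: u3)
    qed
    show "summable (\<lambda>n. 2 * norm (a n) ^ 6)" by (intro summable_mult s6)
  qed
  then have "summable (\<lambda>n. \<bar>l (n + 4)\<bar>)" by (rule summable_ignore_initial_segment)
  moreover have "summable (\<lambda>n. norm (r n))"
    unfolding r_def by (rule summable_step_poly_error[OF a s6 s2])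
  moreover have "summable (\<lambda>n. (norm (a (n + 4) - a n))\<^sup>2)"
  proof -
    have s: "summable (\<lambda>n. (norm (a (n + Suc k) - a (n + k)))\<^sup>2)" for k
      using summable_ignore_initial_segment[OF s2, of k] by simp
    have "summable (\<lambda>n. (norm ((a (n + Suc 0) - a (n + 0)) + (a (n + Suc 1) - a (n + 1)) +
      (a (n + Suc 2) - a (n + 2)) + (a (n + Suc 3) - a (n + 3))))\<^sup>2)"
      by (intro summable_norm_add_power2 s)
    then show ?thesis by (simp add: eval_nat_numeral)
  qed
  ultimately have "summable (\<lambda>n. \<bar>l (n + 4)\<bar> + norm (r n) + (norm (a (n + 4) - a n))\<^sup>2 / 2)"
    by (intro summable_add summable_divide)
  then have es: "summable (\<lambda>n. \<bar>e n\<bar>)"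
  proof (rule summable_comparison_test'[where N=0])
    fix n
    have "\<bar>e n\<bar> \<le> \<bar>l (n + 4)\<bar> + \<bar>Re (r n)\<bar> + (norm (a (n + 4) - a n))\<^sup>2 / 2"
      unfolding e_def using zero_le_power2[of "norm (a (n + 4) - a n)"] by linarith
    then show "norm \<bar>e n\<bar> \<le> \<bar>l (n + 4)\<bar> + norm (r n) + (norm (a (n + 4) - a n))\<^sup>2 / 2"
      using abs_Re_le_cmod[of "r n"] by simp
  qed
  have "(\<exists>C. \<forall>N. C \<le> bs_entropy a N) \<longleftrightarrow> summable (\<lambda>n. (u n)\<^sup>2)"
  proof (rule bounded_below_iff_summable_squares[where c = 8 and e = e])
    fix n
    show "0 \<le> u n" by (simp add: u_def)
    show "u n \<le> 1" using a[of n] by (simp add: u_def power_le_one less_imp_le)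
    have un: "(norm (a k))\<^sup>2 = u k" for k by (simp add: u_def)
    have re: "Re (a (n + 4) * cnj (a n)) = (u n + u (n + 4) - (norm (a (n + 4) - a n))\<^sup>2) / 2"
      unfolding u_def cmod_power2 by (simp add: power2_eq_square algebra_simps)
    have sq: "a (n + 4) * cnj (a (n + 4)) = of_real (u (n + 4))"
      by (simp only: u_def complex_norm_square)
    have "Re (r n) = Re (fps_nth (fps_expansion (opuc_step a (n + 4)) 0) 4) - Re (a (n + 4) * cnj (a n)) + 15 / 2 * (u (n + 4))\<^sup>2"
      unfolding r_def opuc_step_coeff4_eq[OF a] sq
      by (simp only: minus_complex.sel of_real_power[symmetric] Re_complex_of_real times_complex.sel) simp
    then show "bs_entropy a (Suc (n + 4)) = bs_entropy a (n + 4) + (u n - u (n + 4)) / 2 - 8 * (u (n + 4))\<^sup>2 + e n"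
      unfolding bs_entropy_Suc[OF a] e_def l_def re un by (simp add: field_simps)
  qed (use es in auto)
  then show ?thesis by (simp add: u_def flip: power_mult)
qed

section \<open>Moments of the Bernstein-Szego measures\<close>

text \<open>1 / Psi_n is holomorphic on the closed disc with value 1 at 0, so the mean value
  property applies.\<close>

lemma bs_moment_top:
  assumes a: "\<And>j. norm (a j) < 1"
  shows "(LINT \<theta>|dtheta. cis \<theta> ^ m / poly (opuc_rev a n) (cis \<theta>)) = (if m = 0 then 1 else 0)"
proof -
  have "(\<lambda>z. z ^ m / poly (opuc_rev a n) z) holomorphic_on cball 0 1"
    by (intro holomorphic_intros) (auto simp: opuc_rev_nz[OF a])
  from circle_mean[OF this] show ?thesis by (simp add: poly_opuc_rev_0 power_0_left)
qed

lemma cnj_power_mult_power: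
  assumes "norm z = 1" "k \<le> n"
  shows "cnj z ^ k * z ^ n = z ^ (n - k)"
proof -
  have "cnj z * z = 1" using assms by (simp add: complex_norm_square[symmetric] mult.commute)
  then have "cnj z ^ k * z ^ k = 1" by (simp only: power_mult_distrib[symmetric] power_one)
  moreover have "z ^ n = z ^ k * z ^ (n - k)"
    using assms(2) by (simp only: power_add[symmetric] le_add_diff_inverse)
  ultimately show ?thesis by (simp flip: mult.assoc)
qed

lemma integrable_bs_weight:
  fixes f :: "complex \<Rightarrow> complex"
  assumes a: "\<And>j. norm (a j) < 1" and f: "continuous_on (sphere 0 1) f"
  shows "integrable dtheta (\<lambda>\<theta>. f (cis \<theta>) * of_real (bs_weight a N (cis \<theta>)))"
  by (intro integrable_dtheta_continuous continuous_intros continuous_on_cis_compose[OF f]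
      continuous_on_cis_compose[OF continuous_on_bs_weight[OF a]])

text \<open>Downward induction on \<open>n\<close>, using the inverse Szego recursion
  \<open>(1 - |\<alpha>\<^sub>n|\<^sup>2) z \<Phi>\<^sub>n = \<Phi>\<^sub>n\<^sub>+\<^sub>1 + cnj \<alpha>\<^sub>n \<Psi>\<^sub>n\<^sub>+\<^sub>1\<close>.\<close>
lemma bs_weight_orthogonal:
  assumes a: "\<And>j. norm (a j) < 1" and "n \<le> N" "k \<le> n"
  shows "(LINT \<theta>|dtheta. cnj (cis \<theta>) ^ k * poly (opuc a n) (cis \<theta>) * of_real (bs_weight a N (cis \<theta>))) =
    (if k = n then of_real (\<Prod>j<n. 1 - (norm (a j))\<^sup>2) else 0)"
  using \<open>n \<le> N\<close> \<open>k \<le> n\<close>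
proof (induction n arbitrary: k rule: inc_induct)
  case base
  define c where "c = (\<Prod>j<N. 1 - (norm (a j))\<^sup>2)"
  \<comment> \<open>On the circle the weight is c / (P cnj P); P cancels, and 1 / cnj P = z^N /
    Psi_N.\<close>
  have e: "cnj (cis \<theta>) ^ k * poly (opuc a N) (cis \<theta>) * of_real (bs_weight a N (cis \<theta>)) =
      of_real c * (cis \<theta> ^ (N - k) / poly (opuc_rev a N) (cis \<theta>))" for \<theta>
  proof -
    define P where "P = poly (opuc a N) (cis \<theta>)"
    have P: "P \<noteq> 0" unfolding P_def by (rule opuc_circle_nonzero[where a = a, OF a]) simp
    have R: "poly (opuc_rev a N) (cis \<theta>) = cis \<theta> ^ N * cnj P" unfolding P_def by (rule opuc_rev_circle) simp
    have "of_real (bs_weight a N (cis \<theta>)) = of_real c / (P * cnj P)"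
      unfolding bs_weight_def P_def[symmetric] c_def[symmetric] by (simp add: complex_norm_square[symmetric])
    then have "cnj (cis \<theta>) ^ k * P * of_real (bs_weight a N (cis \<theta>)) = of_real c * (cnj (cis \<theta>) ^ k / cnj P)"
      using P by simp
    also have "cnj (cis \<theta>) ^ k / cnj P = cis \<theta> ^ (N - k) / (cis \<theta> ^ N * cnj P)"
      using P by (simp add: cnj_power_mult_power[OF _ base, symmetric])
    finally show ?thesis unfolding P_def[symmetric] R .
  qed
  show ?case
    unfolding e Bochner_Integration.integral_mult_right_zero
    unfolding bs_moment_top[where a = a, OF a] c_def[symmetric] using base by (simp only: diff_is_0_eq) auto
next
  case (step n)
  define J where "J = (\<lambda>f. LINT \<theta>|dtheta. f (cis \<theta>) * complex_of_real (bs_weight a N (cis \<theta>)))"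
  have pos: "0 < 1 - (norm (a n))\<^sup>2" by (rule verblunsky_factor_pos[where a = a, OF a])
  \<comment> \<open>The inverse recursion times cnj z^(k+1); its reversed part is the conjugate of
    cnj z^(n-k) Phi_(n+1), as Psi_(n+1) = z^(n+1) cnj Phi_(n+1). Of the exponents k+1 and n-k only
    the first can equal n+1, and it does so exactly for k = n.\<close>
  have "of_real (1 - (norm (a n))\<^sup>2) * J (\<lambda>z. cnj z ^ k * poly (opuc a n) z) =
      J (\<lambda>z. cnj z ^ Suc k * poly (opuc a (Suc n)) z) + cnj (a n) * cnj (J (\<lambda>z. cnj z ^ (n - k) * poly (opuc a (Suc n)) z))"
  proof -
    have e: "of_real (1 - (norm (a n))\<^sup>2) * (cnj z ^ k * poly (opuc a n) z) =
      cnj z ^ Suc k * poly (opuc a (Suc n)) z + cnj (a n) * cnj (cnj z ^ (n - k) * poly (opuc a (Suc n)) z)"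
      if z: "norm z = 1" for z
    proof -
      have "cnj z ^ Suc k * z ^ Suc n = z ^ (n - k)"
        using cnj_power_mult_power[OF z, of "Suc k" "Suc n"] step by simp
      then have "cnj (a n) * cnj (cnj z ^ (n - k) * poly (opuc a (Suc n)) z) =
          cnj (a n) * cnj z ^ Suc k * (z ^ Suc n * cnj (poly (opuc a (Suc n)) z))"
        by (simp only: complex_cnj_mult complex_cnj_power complex_cnj_cnj mult.assoc[symmetric]) (simp add: mult.assoc)
      also have "z ^ Suc n * cnj (poly (opuc a (Suc n)) z) = poly (opuc_rev a (Suc n)) z"
        by (rule opuc_rev_circle[OF z, symmetric])
      finally have 1: "cnj (a n) * cnj (cnj z ^ (n - k) * poly (opuc a (Suc n)) z) =
          cnj z ^ Suc k * (cnj (a n) * poly (opuc_rev a (Suc n)) z)" by (simp only: mult_ac)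
      have 2: "poly (opuc a (Suc n)) z + cnj (a n) * poly (opuc_rev a (Suc n)) z =
          of_real (1 - (norm (a n))\<^sup>2) * (z * poly (opuc a n) z)"
        unfolding poly_opuc_Suc poly_opuc_rev_Suc of_real_diff of_real_1 complex_norm_square
        by (simp add: algebra_simps)
      have 3: "cnj z ^ Suc k * z = cnj z ^ k"
        using cnj_power_mult_power[OF z, of 1 1] by (simp add: mult.assoc mult.left_commute)
      show ?thesis
        unfolding 1 distrib_left[symmetric] 2
        by (simp only: mult.assoc[symmetric] 3[symmetric]) (simp only: mult_ac)
    qed
    have "of_real (1 - (norm (a n))\<^sup>2) * J (\<lambda>z. cnj z ^ k * poly (opuc a n) z) =
      J (\<lambda>z. of_real (1 - (norm (a n))\<^sup>2) * (cnj z ^ k * poly (opuc a n) z))"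
      unfolding J_def by (simp only: mult.assoc Bochner_Integration.integral_mult_right_zero)
    also have "\<dots> = J (\<lambda>z. cnj z ^ Suc k * poly (opuc a (Suc n)) z + cnj (a n) * cnj (cnj z ^ (n - k) * poly (opuc a (Suc n)) z))"
      unfolding J_def by (simp only: e[OF norm_cis])
    also have "\<dots> = J (\<lambda>z. cnj z ^ Suc k * poly (opuc a (Suc n)) z) + J (\<lambda>z. cnj (a n) * cnj (cnj z ^ (n - k) * poly (opuc a (Suc n)) z))"
      unfolding J_def distrib_right
      by (intro Bochner_Integration.integral_add integrable_bs_weight[where a = a, OF a] continuous_intros)
    also have "J (\<lambda>z. cnj (a n) * cnj (cnj z ^ (n - k) * poly (opuc a (Suc n)) z)) =
      cnj (a n) * J (\<lambda>z. cnj (cnj z ^ (n - k) * poly (opuc a (Suc n)) z))"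
      unfolding J_def by (simp only: mult.assoc Bochner_Integration.integral_mult_right_zero)
    also have "J (\<lambda>z. cnj (cnj z ^ (n - k) * poly (opuc a (Suc n)) z)) = cnj (J (\<lambda>z. cnj z ^ (n - k) * poly (opuc a (Suc n)) z))"
      unfolding J_def Bochner_Integration.integral_cnj[symmetric] by simp
    finally show ?thesis .
  qed
  moreover have "J (\<lambda>z. cnj z ^ Suc k * poly (opuc a (Suc n)) z) =
      (if k = n then of_real ((1 - (norm (a n))\<^sup>2) * (\<Prod>j<n. 1 - (norm (a j))\<^sup>2)) else 0)"
    using step.IH[of "Suc k"] step.prems unfolding J_def by (simp add: mult.commute)
  moreover have "J (\<lambda>z. cnj z ^ (n - k) * poly (opuc a (Suc n)) z) = 0"
    using step.IH[of "n - k"] unfolding J_def by simp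
  ultimately have eq: "of_real (1 - (norm (a n))\<^sup>2) * J (\<lambda>z. cnj z ^ k * poly (opuc a n) z) =
      of_real (1 - (norm (a n))\<^sup>2) * (if k = n then of_real (\<Prod>j<n. 1 - (norm (a j))\<^sup>2) else 0)"
    by (cases "k = n") (simp_all only: if_True if_False refl of_real_mult mult_zero_right complex_cnj_zero add_0_right)
  have nz: "complex_of_real (1 - (norm (a n))\<^sup>2) \<noteq> 0"
    using pos by (simp only: of_real_eq_0_iff)
  have "J (\<lambda>z. cnj z ^ k * poly (opuc a n) z) = (if k = n then of_real (\<Prod>j<n. 1 - (norm (a j))\<^sup>2) else 0)"
    by (rule mult_left_cancel[OF nz, THEN iffD1, OF eq])
  then show ?case by (simp only: J_def)
qed

text \<open>On the circle Re z and Im z are combinations of z and cnj z, and factors z cnj z = 1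
  bring all terms to a common power of cnj z. So real polynomials on the plane restrict to
  trigonometric polynomials.\<close>

lemma real_polynomial_function_circle:
  fixes g :: "complex \<Rightarrow> real"
  assumes "real_polynomial_function g"
  shows "\<exists>p m. \<forall>z. norm z = 1 \<longrightarrow> complex_of_real (g z) = poly p z * cnj z ^ m"
  using assms
proof (induction rule: real_polynomial_function.induct)
  case (linear f)
  interpret bounded_linear f by fact
  show ?case
  proof (intro exI allI impI)
    fix z :: complex assume "norm z = 1"
    then have z: "z * cnj z = 1" by (simp add: complex_norm_square[symmetric])
    have "f z = f (Re z *\<^sub>R 1 + Im z *\<^sub>R \<i>)" by (rule arg_cong[of _ _ f]) (simp add: complex_eq_iff)
    then have fz: "f z = Re z * f 1 + Im z * f \<i>" by (simp only: add scaleR real_scaleR_def)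
    then have "complex_of_real (f z) = (z + cnj z) / 2 * of_real (f 1) - \<i> * (z - cnj z) / 2 * of_real (f \<i>)"
    proof -
      have "(z + cnj z) / 2 = of_real (Re z)" "\<i> * (z - cnj z) / 2 = - of_real (Im z)"
        by (simp_all add: complex_eq_iff)
      then show ?thesis using fz by simp
    qed
    also have "\<dots> = ((z + cnj z) / 2 * of_real (f 1) - \<i> * (z - cnj z) / 2 * of_real (f \<i>)) * (z * cnj z)"
      by (simp only: z mult_1_right)
    also have "\<dots> = (z * (z + cnj z) / 2 * of_real (f 1) - \<i> * (z * (z - cnj z)) / 2 * of_real (f \<i>)) * cnj z"
      by (simp add: algebra_simps)
    also have "z * (z + cnj z) = z * z + 1" by (simp only: distrib_left z)
    also have "z * (z - cnj z) = z * z - 1" by (simp only: right_diff_distrib z)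
    also have "((z * z + 1) / 2 * of_real (f 1) - \<i> * (z * z - 1) / 2 * of_real (f \<i>)) * cnj z =
      (of_real (f 1) / 2 * (z * z + 1) - \<i> * of_real (f \<i>) / 2 * (z * z - 1)) * cnj z"
      by (simp only: times_divide_eq_left times_divide_eq_right mult.commute mult.left_commute)
    moreover have "A * (z * z + 1) - B * (z * z - 1) = poly (smult A [:1, 0, 1:] - smult B [:-1, 0, 1:]) z" for A B
      by (simp add: algebra_simps)
    ultimately show "complex_of_real (f z) =
      poly (smult (of_real (f 1) / 2) [:1, 0, 1:] - smult (\<i> * of_real (f \<i>) / 2) [:-1, 0, 1:]) z * cnj z ^ 1"
      by (simp only: power_one_right)
  qed
next
  case (const c)
  show ?case by (intro exI[of _ "[:of_real c:]"] exI[of _ 0]) simp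
next
  case (add f g)
  then obtain p m q l where *: "\<And>z. norm z = 1 \<Longrightarrow> complex_of_real (f z) = poly p z * cnj z ^ m"
    "\<And>z. norm z = 1 \<Longrightarrow> complex_of_real (g z) = poly q z * cnj z ^ l" by blast
  show ?case
  proof (intro exI allI impI)
    fix z :: complex assume z: "norm z = 1"
    have 1: "z ^ k * cnj z ^ k = 1" for k
      using cnj_power_mult_power[OF z, of k k] by (simp add: mult.commute)
    have "complex_of_real (f z + g z) = poly p z * cnj z ^ m * (z ^ l * cnj z ^ l) + poly q z * cnj z ^ l * (z ^ m * cnj z ^ m)"
      by (simp only: 1 of_real_add * [OF z] mult_1_right)
    then show "complex_of_real (f z + g z) = poly (p * monom 1 l + q * monom 1 m) z * cnj z ^ (m + l)"
      by (simp add: poly_monom power_add algebra_simps)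
  qed
next
  case (mult f g)
  then obtain p m q l where *: "\<And>z. norm z = 1 \<Longrightarrow> complex_of_real (f z) = poly p z * cnj z ^ m"
    "\<And>z. norm z = 1 \<Longrightarrow> complex_of_real (g z) = poly q z * cnj z ^ l" by blast
  show ?case
    by (intro exI[of _ "p * q"] exI[of _ "m + l"]) (simp add: * power_add algebra_simps)
qed

context
  fixes \<mu> :: "complex measure" and \<Phi> :: "nat \<Rightarrow> complex poly"
  assumes mu: "circle_prob \<mu>" and orth: "monic_orthogonal_polys \<mu> \<Phi>"
begin

definition bs_mean :: "nat \<Rightarrow> (complex \<Rightarrow> complex) \<Rightarrow> complex" where
  "bs_mean N f = (LINT \<theta>|dtheta. f (cis \<theta>) * of_real (bs_weight (verblunsky \<Phi>) N (cis \<theta>)))"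

lemma bs_mean_lin:
  assumes "continuous_on (sphere 0 1) f" "continuous_on (sphere 0 1) g"
  shows "bs_mean N (\<lambda>z. f z + g z) = bs_mean N f + bs_mean N g"
  unfolding bs_mean_def distrib_right
  by (intro Bochner_Integration.integral_add integrable_bs_weight norm_verblunsky_less_1[OF mu orth] assms)

lemma bs_mean_scale: "bs_mean N (\<lambda>z. c * f z) = c * bs_mean N f"
  unfolding bs_mean_def by (simp only: mult.assoc Bochner_Integration.integral_mult_right_zero)

lemma bs_mean_cnj: "bs_mean N (\<lambda>z. cnj (f z)) = cnj (bs_mean N f)"
  unfolding bs_mean_def Bochner_Integration.integral_cnj[symmetric] by simp

lemma bs_mean_cong: "(\<And>z. norm z = 1 \<Longrightarrow> f z = g z) \<Longrightarrow> bs_mean N f = bs_mean N g"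
  unfolding bs_mean_def by simp

text \<open>Both functionals send Phi_0 = 1 to 1 and annihilate Phi_1, ..., Phi_N, so they agree on
  the span.\<close>

lemma bs_mean_poly:
  assumes "\<And>i. N < i \<Longrightarrow> coeff p i = 0"
  shows "bs_mean N (poly p) = (LINT z|\<mu>. poly p z)"
proof -
  have deg: "degree (\<Phi> n) = n" "lead_coeff (\<Phi> n) = 1" for n
    using orth unfolding monic_orthogonal_polys_def by blast+
  have b: "bs_mean N (poly (\<Phi> n)) = (if n = 0 then 1 else 0)" if "n \<le> N" for n
    using bs_weight_orthogonal[where a = "verblunsky \<Phi>", OF norm_verblunsky_less_1[OF mu orth] that, of 0]
    by (auto simp: bs_mean_def monic_orth_opuc[OF mu orth, symmetric])
  interpret prob_space \<mu> by (rule circle_probD[OF mu])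
  have m: "(LINT z|\<mu>. poly (\<Phi> n) z) = (if n = 0 then 1 else 0)" for n
    using monic_orth_poly[OF mu orth, of n 1] by (auto simp: monic_orth_opuc[OF mu orth] prob_space)
  show ?thesis
  proof (rule monic_basis_induct[OF deg, where N = "Suc N" and p = p])
    show "bs_mean N (poly 0) = (LINT z|\<mu>. poly 0 z)" by (simp add: bs_mean_def)
    fix p c k assume k: "k < Suc N" and p: "bs_mean N (poly p) = (LINT z|\<mu>. poly p z)"
    have "bs_mean N (poly (p + smult c (\<Phi> k))) = bs_mean N (\<lambda>z. poly p z + c * poly (\<Phi> k) z)"
      by (rule bs_mean_cong) simp
    also have "\<dots> = bs_mean N (poly p) + c * bs_mean N (poly (\<Phi> k))"
      by (subst bs_mean_lin) (auto intro!: continuous_intros simp: bs_mean_scale)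
    also have "\<dots> = (LINT z|\<mu>. poly p z) + c * (LINT z|\<mu>. poly (\<Phi> k) z)"
      using k b[of k] by (simp add: p m)
    also have "\<dots> = (LINT z|\<mu>. poly p z + c * poly (\<Phi> k) z)"
      by (subst Bochner_Integration.integral_add) (auto intro!: integrable_mu[OF mu orth] continuous_intros)
    finally show "bs_mean N (poly (p + smult c (\<Phi> k))) = (LINT z|\<mu>. poly (p + smult c (\<Phi> k)) z)"
      by simp
  qed (use assms in auto)
qed

text \<open>On the circle the monomial is a power of z or of cnj z; the second case is the conjugate
  of the first, because both measures are real.\<close>

lemma bs_mean_monomial:
  assumes "k \<le> N" "m \<le> N"
  shows "bs_mean N (\<lambda>z. z ^ k * cnj z ^ m) = (LINT z|\<mu>. z ^ k * cnj z ^ m)"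
proof -
  have sp: "space \<mu> = sphere 0 1" by (rule circle_probD[OF mu])
  have mon: "bs_mean N (\<lambda>z. z ^ j) = (LINT z|\<mu>. z ^ j)" if "j \<le> N" for j
    using bs_mean_poly[of N "monom 1 j"] that by (simp add: poly_monom bs_mean_def)
  show ?thesis
  proof (cases "m \<le> k")
    case True
    have e: "z ^ k * cnj z ^ m = z ^ (k - m)" if "norm z = 1" for z
      using cnj_power_mult_power[OF that True] by (simp add: mult.commute)
    have "bs_mean N (\<lambda>z. z ^ k * cnj z ^ m) = bs_mean N (\<lambda>z. z ^ (k - m))"
      by (rule bs_mean_cong) (rule e)
    also have "\<dots> = (LINT z|\<mu>. z ^ (k - m))" using assms by (intro mon) simp
    also have "\<dots> = (LINT z|\<mu>. z ^ k * cnj z ^ m)"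
      by (rule Bochner_Integration.integral_cong) (simp_all add: sp e)
    finally show ?thesis .
  next
    case False
    have e: "z ^ k * cnj z ^ m = cnj (z ^ (m - k))" if "norm z = 1" for z
      using cnj_power_mult_power[of "cnj z" k m] that False by simp
    have "bs_mean N (\<lambda>z. z ^ k * cnj z ^ m) = bs_mean N (\<lambda>z. cnj (z ^ (m - k)))"
      by (rule bs_mean_cong) (rule e)
    also have "\<dots> = cnj (LINT z|\<mu>. z ^ (m - k))" using assms unfolding bs_mean_cnj by (subst mon) auto
    also have "\<dots> = (LINT z|\<mu>. cnj (z ^ (m - k)))" by (rule Bochner_Integration.integral_cnj[symmetric])
    also have "\<dots> = (LINT z|\<mu>. z ^ k * cnj z ^ m)"
      by (rule Bochner_Integration.integral_cong) (simp_all add: sp e del: complex_cnj_power)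
    finally show ?thesis .
  qed
qed

text \<open>Finitely many moments are involved and each is exact from some index on, which gives
  equality for large n and not merely convergence.\<close>

lemma bs_mean_real_polynomial:
  assumes "real_polynomial_function g"
  shows "\<exists>N. \<forall>n\<ge>N. (LINT \<theta>|dtheta. g (cis \<theta>) * bs_weight (verblunsky \<Phi>) n (cis \<theta>)) = (LINT z|\<mu>. g z)"
proof -
  obtain p m where g: "\<And>z. norm z = 1 \<Longrightarrow> complex_of_real (g z) = poly p z * cnj z ^ m"
    using real_polynomial_function_circle[OF assms] by blast
  have sp: "space \<mu> = sphere 0 1" by (rule circle_probD[OF mu])
  have "(LINT \<theta>|dtheta. g (cis \<theta>) * bs_weight (verblunsky \<Phi>) n (cis \<theta>)) = (LINT z|\<mu>. g z)"
    if n: "n \<ge> max (degree p) m" for n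
  proof -
    let ?S = "\<lambda>A z. \<Sum>i\<in>A. coeff p i * (z ^ i * cnj z ^ m)"
    have gs: "complex_of_real (g z) = ?S {..degree p} z" if "norm z = 1" for z
      unfolding g[OF that] poly_altdef by (simp add: sum_distrib_right mult.assoc)
    have S: "bs_mean n (?S A) = (LINT z|\<mu>. ?S A z)" if "finite A" "A \<subseteq> {..degree p}" for A
      using that
    proof (induction A)
      case empty then show ?case by (simp add: bs_mean_def)
    next
      case (insert i A)
      have "bs_mean n (?S (insert i A)) = bs_mean n (\<lambda>z. coeff p i * (z ^ i * cnj z ^ m) + ?S A z)"
        using insert by (intro bs_mean_cong) simp
      also have "\<dots> = coeff p i * bs_mean n (\<lambda>z. z ^ i * cnj z ^ m) + bs_mean n (?S A)"
        by (subst bs_mean_lin) (auto intro!: continuous_intros simp: bs_mean_scale)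
      also have "\<dots> = coeff p i * (LINT z|\<mu>. z ^ i * cnj z ^ m) + (LINT z|\<mu>. ?S A z)"
        using insert n by (subst bs_mean_monomial) auto
      also have "\<dots> = (LINT z|\<mu>. coeff p i * (z ^ i * cnj z ^ m) + ?S A z)"
        by (subst Bochner_Integration.integral_add) (auto intro!: integrable_mu[OF mu orth] continuous_intros)
      also have "\<dots> = (LINT z|\<mu>. ?S (insert i A) z)"
        using insert by simp
      finally show ?case .
    qed
    have "complex_of_real (LINT \<theta>|dtheta. g (cis \<theta>) * bs_weight (verblunsky \<Phi>) n (cis \<theta>)) =
        bs_mean n (\<lambda>z. complex_of_real (g z))"
      unfolding bs_mean_def by (simp only: integral_complex_of_real[symmetric] of_real_mult)
    also have "\<dots> = bs_mean n (?S {..degree p})" by (rule bs_mean_cong) (rule gs)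
    also have "\<dots> = (LINT z|\<mu>. ?S {..degree p} z)" by (rule S) auto
    also have "\<dots> = (LINT z|\<mu>. complex_of_real (g z))"
      by (rule Bochner_Integration.integral_cong) (simp_all only: sp gs mem_sphere dist_0_norm)
    also have "\<dots> = complex_of_real (LINT z|\<mu>. g z)" by (rule integral_complex_of_real)
    finally show ?thesis by (simp only: of_real_eq_iff)
  qed
  then show ?thesis by blast
qed

end

section \<open>Approximation by trigonometric polynomials\<close>

text \<open>One continuous c has to serve all measures in F at once: later these are mu and arc
  length, which may be mutually singular. Boundedness keeps all functions integrable against finite
  measures.\<close>

definition l1_approx :: "'a::metric_space measure set \<Rightarrow> ('a \<Rightarrow> real) \<Rightarrow> bool" where
  "l1_approx F f \<longleftrightarrow> f \<in> borel_measurable borel \<and> bounded (range f) \<and>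
    (\<forall>e>0. \<exists>c. continuous_on UNIV c \<and> bounded (range c) \<and> (\<forall>M\<in>F. (LINT x|M. \<bar>f x - c x\<bar>) < e))"

context
  fixes F :: "'a::metric_space measure set"
  assumes fin: "finite F" and F: "\<And>M. M \<in> F \<Longrightarrow> finite_measure M" "\<And>M. M \<in> F \<Longrightarrow> sets M = sets borel"
begin

lemma measurable_F: "M \<in> F \<Longrightarrow> f \<in> borel_measurable borel \<Longrightarrow> f \<in> borel_measurable M"
  using F(2) measurable_cong_sets by blast

lemma integrable_F:
  fixes f :: "'a \<Rightarrow> real"
  assumes "M \<in> F" "f \<in> borel_measurable borel" "bounded (range f)"
  shows "integrable M f"
proof -
  obtain B where "\<And>x. norm (f x) \<le> B" using assms(3) by (auto simp: bounded_iff)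
  then show ?thesis
    by (intro finite_measure.integrable_const_bound[OF F(1), of M f B] measurable_F[OF assms(1,2)] assms(1)) auto
qed

lemma integrable_F_diff:
  fixes f g :: "'a \<Rightarrow> real"
  assumes "M \<in> F" "f \<in> borel_measurable borel" "bounded (range f)" "g \<in> borel_measurable borel" "bounded (range g)"
  shows "integrable M (\<lambda>x. \<bar>f x - g x\<bar>)"
  by (intro integrable_abs Bochner_Integration.integrable_diff integrable_F assms)

lemma integral_F_triangle:
  fixes f g h :: "'a \<Rightarrow> real"
  assumes "M \<in> F" "f \<in> borel_measurable borel" "bounded (range f)" "g \<in> borel_measurable borel" "bounded (range g)"
    "h \<in> borel_measurable borel" "bounded (range h)"
  shows "(LINT x|M. \<bar>f x - h x\<bar>) \<le> (LINT x|M. \<bar>f x - g x\<bar>) + (LINT x|M. \<bar>g x - h x\<bar>)"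
proof -
  have "(LINT x|M. \<bar>f x - h x\<bar>) \<le> (LINT x|M. \<bar>f x - g x\<bar> + \<bar>g x - h x\<bar>)"
    by (intro integral_mono Bochner_Integration.integrable_add integrable_F_diff assms) auto
  also have "\<dots> = (LINT x|M. \<bar>f x - g x\<bar>) + (LINT x|M. \<bar>g x - h x\<bar>)"
    by (intro Bochner_Integration.integral_add integrable_F_diff assms)
  finally show ?thesis .
qed

lemma l1_approx_continuous:
  "continuous_on UNIV f \<Longrightarrow> bounded (range f) \<Longrightarrow> l1_approx F f"
  unfolding l1_approx_def by (auto intro!: borel_measurable_continuous_onI exI[of _ f])

text \<open>Dominated convergence works for each measure separately; finiteness of F then gives one
  index that is good for all of them.\<close>

lemma l1_approx_limit:
  assumes U: "\<And>i. l1_approx F (U i)" and B: "\<And>i x. \<bar>U i x\<bar> \<le> B" and lim: "\<And>x. (\<lambda>i. U i x) \<longlonglongrightarrow> f x"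
  shows "l1_approx F f"
  unfolding l1_approx_def
proof (intro conjI allI impI)
  have mU: "U i \<in> borel_measurable borel" "bounded (range (U i))" for i using U by (auto simp: l1_approx_def)
  show mf: "f \<in> borel_measurable borel"
    by (rule borel_measurable_LIMSEQ_real[OF lim mU(1)])
  have fB: "\<bar>f x\<bar> \<le> B" for x
    by (rule LIMSEQ_le_const2[OF tendsto_rabs[OF lim]]) (use B in auto)
  then show bf: "bounded (range f)" by (auto simp: bounded_iff)
  fix e :: real assume e: "0 < e"
  have "\<forall>M\<in>F. eventually (\<lambda>i. (LINT x|M. \<bar>f x - U i x\<bar>) < e / 2) sequentially"
  proof
    fix M assume M: "M \<in> F"
    have "(\<lambda>i. LINT x|M. \<bar>f x - U i x\<bar>) \<longlonglongrightarrow> (LINT x|M. 0)"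
    proof (rule integral_dominated_convergence)
      show "integrable M (\<lambda>x. 2 * B)" by (intro integrable_F M) auto
      show "AE x in M. (\<lambda>i. \<bar>f x - U i x\<bar>) \<longlonglongrightarrow> 0"
      proof (rule AE_I2)
        fix x
        have "(\<lambda>i. \<bar>f x - U i x\<bar>) \<longlonglongrightarrow> \<bar>f x - f x\<bar>" by (intro tendsto_intros lim)
        then show "(\<lambda>i. \<bar>f x - U i x\<bar>) \<longlonglongrightarrow> 0" by simp
      qed
      show "AE x in M. norm \<bar>f x - U i x\<bar> \<le> 2 * B" for i
      proof (rule AE_I2)
        fix x show "norm \<bar>f x - U i x\<bar> \<le> 2 * B" using B[of i x] fB[of x] by (simp add: abs_le_iff)
      qed
    qed (auto intro!: measurable_F[OF M borel_measurable_abs] measurable_F[OF M borel_measurable_const] borel_measurable_diff mf mU)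
    then show "eventually (\<lambda>i. (LINT x|M. \<bar>f x - U i x\<bar>) < e / 2) sequentially"
      using e by (intro order_tendstoD(2)) auto
  qed
  then have "eventually (\<lambda>i. \<forall>M\<in>F. (LINT x|M. \<bar>f x - U i x\<bar>) < e / 2) sequentially"
    by (rule eventually_ball_finite[OF fin])
  then obtain i where i: "\<And>M. M \<in> F \<Longrightarrow> (LINT x|M. \<bar>f x - U i x\<bar>) < e / 2"
    by (auto simp: eventually_sequentially)
  obtain c where c: "continuous_on UNIV c" "bounded (range c)" "\<And>M. M \<in> F \<Longrightarrow> (LINT x|M. \<bar>U i x - c x\<bar>) < e / 2"
    using U[of i] e unfolding l1_approx_def by (meson half_gt_zero)
  have "(LINT x|M. \<bar>f x - c x\<bar>) < e" if M: "M \<in> F" for M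
    using integral_F_triangle[OF M mf bf mU borel_measurable_continuous_onI[OF c(1)] c(2), of i] i[OF M] c(3)[OF M]
    by simp
  then show "\<exists>c. continuous_on UNIV c \<and> bounded (range c) \<and> (\<forall>M\<in>F. (LINT x|M. \<bar>f x - c x\<bar>) < e)"
    using c by blast
qed

lemma l1_approx_add:
  assumes "l1_approx F f" "l1_approx F g"
  shows "l1_approx F (\<lambda>x. f x + g x)"
  unfolding l1_approx_def
proof (intro conjI allI impI)
  have m: "f \<in> borel_measurable borel" "g \<in> borel_measurable borel" "bounded (range f)" "bounded (range g)"
    using assms by (auto simp: l1_approx_def)
  show "(\<lambda>x. f x + g x) \<in> borel_measurable borel" using m by simp
  show "bounded (range (\<lambda>x. f x + g x))" using m by (intro bounded_plus_comp)
  fix e :: real assume e: "0 < e"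
  obtain c where c: "continuous_on UNIV c" "bounded (range c)" "\<And>M. M \<in> F \<Longrightarrow> (LINT x|M. \<bar>f x - c x\<bar>) < e / 2"
    using assms(1) e unfolding l1_approx_def by (meson half_gt_zero)
  obtain d where d: "continuous_on UNIV d" "bounded (range d)" "\<And>M. M \<in> F \<Longrightarrow> (LINT x|M. \<bar>g x - d x\<bar>) < e / 2"
    using assms(2) e unfolding l1_approx_def by (meson half_gt_zero)
  note mc = borel_measurable_continuous_onI[OF c(1)] borel_measurable_continuous_onI[OF d(1)]
  have "(LINT x|M. \<bar>(f x + g x) - (c x + d x)\<bar>) < e" if M: "M \<in> F" for M
  proof -
    have i: "integrable M (\<lambda>x. \<bar>f x - c x\<bar>)" "integrable M (\<lambda>x. \<bar>g x - d x\<bar>)"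
        "integrable M (\<lambda>x. \<bar>(f x + g x) - (c x + d x)\<bar>)"
      by (intro integrable_F_diff M m c d mc borel_measurable_add bounded_plus_comp)+
    have "(LINT x|M. \<bar>(f x + g x) - (c x + d x)\<bar>) \<le> (LINT x|M. \<bar>f x - c x\<bar> + \<bar>g x - d x\<bar>)"
      by (intro integral_mono i Bochner_Integration.integrable_add) (auto simp: abs_if)
    also have "\<dots> = (LINT x|M. \<bar>f x - c x\<bar>) + (LINT x|M. \<bar>g x - d x\<bar>)"
      by (intro Bochner_Integration.integral_add i)
    also have "\<dots> < e" using c(3)[OF M] d(3)[OF M] by simp
    finally show ?thesis .
  qed
  then show "\<exists>c. continuous_on UNIV c \<and> bounded (range c) \<and> (\<forall>M\<in>F. (LINT x|M. \<bar>f x + g x - c x\<bar>) < e)"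
    using c d by (intro exI[of _ "\<lambda>x. c x + d x"]) (auto intro!: continuous_intros bounded_plus_comp)
qed

lemma bounded_range_cmult:
  fixes f :: "'b \<Rightarrow> real"
  assumes "bounded (range f)"
  shows "bounded (range (\<lambda>x. k * f x))"
  using bounded_scaling[OF assms, of k] by (simp add: image_image)

lemma l1_approx_cmult:
  assumes "l1_approx F f"
  shows "l1_approx F (\<lambda>x. k * f x)"
  unfolding l1_approx_def
proof (intro conjI allI impI)
  have m: "f \<in> borel_measurable borel" "bounded (range f)"
    using assms by (auto simp: l1_approx_def)
  show "(\<lambda>x. k * f x) \<in> borel_measurable borel" using m by simp
  show "bounded (range (\<lambda>x. k * f x))" using m by (intro bounded_range_cmult)
  fix e :: real assume e: "0 < e"
  then have "0 < e / (\<bar>k\<bar> + 1)" by simp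
  then obtain c where c: "continuous_on UNIV c" "bounded (range c)" "\<And>M. M \<in> F \<Longrightarrow> (LINT x|M. \<bar>f x - c x\<bar>) < e / (\<bar>k\<bar> + 1)"
    using assms(1) unfolding l1_approx_def by meson
  have "(LINT x|M. \<bar>k * f x - k * c x\<bar>) < e" if M: "M \<in> F" for M
  proof -
    have "(LINT x|M. \<bar>k * f x - k * c x\<bar>) = (LINT x|M. \<bar>k\<bar> * \<bar>f x - c x\<bar>)"
      by (simp flip: abs_mult right_diff_distrib)
    also have "\<dots> = \<bar>k\<bar> * (LINT x|M. \<bar>f x - c x\<bar>)" by simp
    also have "\<dots> \<le> \<bar>k\<bar> * (e / (\<bar>k\<bar> + 1))" using c(3)[OF M] by (intro mult_left_mono) auto
    also have "\<dots> < e" using e by (simp add: field_simps)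
    finally show ?thesis .
  qed
  then show "\<exists>c. continuous_on UNIV c \<and> bounded (range c) \<and> (\<forall>M\<in>F. (LINT x|M. \<bar>k * f x - c x\<bar>) < e)"
    using c by (intro exI[of _ "\<lambda>x. k * c x"]) (auto intro!: continuous_intros bounded_range_cmult)
qed

text \<open>The indicator is the pointwise limit of the continuous functions max 0 (1 - i dist(x,
  A)).\<close>

lemma l1_approx_closed:
  assumes "closed A"
  shows "l1_approx F (indicator A)"
proof (cases "A = {}")
  case True then show ?thesis by (auto intro!: l1_approx_continuous)
next
  case False
  define U where "U = (\<lambda>(i::nat) x. max 0 (1 - real i * infdist x A))"
  have U01: "\<bar>U i x\<bar> \<le> 1" for i x
    using mult_nonneg_nonneg[of "real i" "infdist x A"] infdist_nonneg[of x A] by (auto simp: U_def)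
  show ?thesis
  proof (rule l1_approx_limit[of U 1, OF _ U01])
    show "l1_approx F (U i)" for i
    proof (rule l1_approx_continuous)
      show "continuous_on UNIV (U i)" unfolding U_def by (intro continuous_intros)
      show "bounded (range (U i))" using U01[of i] by (auto simp: bounded_iff)
    qed
    fix x
    show "(\<lambda>i. U i x) \<longlonglongrightarrow> indicator A x"
    proof (cases "x \<in> A")
      case True
      then have "infdist x A = 0" using in_closed_iff_infdist_zero[OF assms False] by blast
      then show ?thesis using True by (simp add: U_def)
    next
      case nA: False
      then have "infdist x A \<noteq> 0" using in_closed_iff_infdist_zero[OF assms False] by blast
      then have pos: "0 < infdist x A" using infdist_nonneg[of x A] by simp
      obtain k :: nat where "1 / infdist x A \<le> real k" using real_arch_simple by blast
      then have k: "1 \<le> real k * infdist x A" using pos by (simp only: pos_divide_le_eq)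
      have "1 \<le> real i * infdist x A" if "k \<le> i" for i
        using that pos by (intro order_trans[OF k] mult_right_mono) auto
      then have "eventually (\<lambda>i. U i x = 0) sequentially"
        unfolding eventually_sequentially U_def by (intro exI[of _ k]) auto
      then show ?thesis using nA by (simp add: tendsto_eventually)
    qed
  qed
qed

text \<open>Dynkin's theorem over the closed sets: complements and finite disjoint unions follow by
  linearity, countable unions by \<open>l1_approx_limit\<close>.\<close>

lemma l1_approx_set:
  assumes "A \<in> sets borel"
  shows "l1_approx F (indicator A)"
proof -
  have "Int_stable (Collect closed :: 'a set set)" "Collect closed \<subseteq> Pow (UNIV :: 'a set)"
    by (auto simp: Int_stable_def)
  moreover have "A \<in> sigma_sets UNIV (Collect closed)"
    using assms by (simp add: borel_eq_closed)
  ultimately show ?thesis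
  proof (induction A rule: sigma_sets_induct_disjoint)
    case (basic A) then show ?case by (simp add: l1_approx_closed)
  next
    case empty then show ?case by (rule l1_approx_closed[OF closed_empty])
  next
    case (compl A)
    have "l1_approx F (\<lambda>x. 1 + (-1) * indicator A x)"
      by (intro l1_approx_add l1_approx_cmult compl l1_approx_continuous) auto
    moreover have "(\<lambda>x. 1 + (-1) * indicator A x) = (indicator (UNIV - A) :: 'a \<Rightarrow> real)"
      by (auto simp: indicator_def)
    ultimately show ?case by simp
  next
    case (union A)
    show ?case
    proof (rule l1_approx_limit[where B = 1])
      show "(\<lambda>n. indicator (\<Union>i<n. A i) x :: real) \<longlonglongrightarrow> indicator (\<Union>i. A i) x" for x
        by (rule LIMSEQ_indicator_UN)
      show "\<bar>indicator (\<Union>i<n. A i) x :: real\<bar> \<le> 1" for n x by (simp add: indicator_def)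
      show "l1_approx F (indicator (\<Union>i<n. A i))" for n
      proof (induction n)
        case 0
        have "(\<Union>i<0. A i) = {}" by simp
        then show ?case using l1_approx_closed[OF closed_empty] by (simp only:)
      next
        case (Suc n)
        have "l1_approx F (\<lambda>x. indicator (\<Union>i<n. A i) x + indicator (A n) x)"
          by (intro l1_approx_add Suc union)
        moreover have "(\<lambda>x. indicator (\<Union>i<n. A i) x + indicator (A n) x) = (indicator (\<Union>i<Suc n. A i) :: 'a \<Rightarrow> real)"
        proof
          fix x
          have "x \<notin> A i" if "x \<in> A n" "i < n" for i
          proof -
            have "A i \<inter> A n = {}" using union(1) that(2) by (simp add: disjoint_family_on_def)
            then show ?thesis using that(1) by blast
          qed
          then show "indicator (\<Union>i<n. A i) x + indicator (A n) x = (indicator (\<Union>i<Suc n. A i) x :: real)"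
            by (auto simp: indicator_def less_Suc_eq)
        qed
        ultimately show ?case by simp
      qed
    qed
  qed
qed

lemma l1_approx_bounded:
  fixes f :: "'a \<Rightarrow> real"
  assumes "f \<in> borel_measurable borel" "\<And>x. 0 \<le> f x" "\<And>x. f x \<le> B"
  shows "l1_approx F f"
proof -
  \<comment> \<open>Boundedness is a premise inside the induction, since the rule ranges over all
    nonnegative measurable functions; a bound on a multiple, sum or increasing limit passes down to
    its nonnegative constituents.\<close>
  have "(\<exists>B. \<forall>x. f x \<le> B) \<longrightarrow> l1_approx F f"
    using assms(1,2)
  proof (induction rule: borel_measurable_induct_real)
    case (set A) then show ?case by (simp add: l1_approx_set)
  next
    case (mult u c)
    show ?case
    proof (cases "c = 0")
      case True then show ?thesis by (auto intro!: l1_approx_continuous)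
    next
      case False
      then have c: "0 < c" using mult by simp
      show ?thesis
      proof
        assume "\<exists>B. \<forall>x. c * u x \<le> B"
        then obtain B where B: "\<And>x. c * u x \<le> B" by blast
        have "u x \<le> B / c" for x using B[of x] c by (simp add: pos_le_divide_eq mult.commute)
        moreover have "(\<exists>B. \<forall>x. u x \<le> B) \<longrightarrow> l1_approx F u" by (fact mult)
        ultimately show "l1_approx F (\<lambda>x. c * u x)" by (intro l1_approx_cmult) blast
      qed
    qed
  next
    case (add u v)
    show ?case
    proof
      assume "\<exists>B. \<forall>x. v x + u x \<le> B"
      then obtain B where B: "\<And>x. v x + u x \<le> B" by blast
      have nn: "0 \<le> u x" "0 \<le> v x" for x by (fact add)+
      have "v x \<le> B" for x using B[of x] nn(1)[of x] by linarith
      moreover have "u x \<le> B" for x using B[of x] nn(2)[of x] by linarith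
      moreover have "(\<exists>B. \<forall>x. u x \<le> B) \<longrightarrow> l1_approx F u" "(\<exists>B. \<forall>x. v x \<le> B) \<longrightarrow> l1_approx F v"
        by (fact add)+
      ultimately show "l1_approx F (\<lambda>x. v x + u x)" by (intro l1_approx_add) blast+
    qed
  next
    case (seq U)
    show ?case
    proof
      assume "\<exists>B. \<forall>x. f x \<le> B"
      then obtain B where B: "\<And>x. f x \<le> B" by blast
      have lim: "(\<lambda>i. U i x) \<longlonglongrightarrow> f x" for x by (rule seq) simp
      have inc: "incseq U" by (fact seq)
      have pos: "0 \<le> U i x" for i x by (fact seq)
      have U: "U i x \<le> f x" for i x
        using inc lim[of x] by (intro incseq_le) (auto simp: incseq_def le_fun_def)
      have "U i x \<le> B" for i x using U[of i x] B[of x] by (rule order_trans)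
      moreover have "(\<exists>B. \<forall>x. U i x \<le> B) \<longrightarrow> l1_approx F (U i)" for i by (fact seq)
      ultimately have "l1_approx F (U i)" for i by blast
      then show "l1_approx F f"
      proof (rule l1_approx_limit)
        show "\<bar>U i x\<bar> \<le> B" for i x using pos[of i x] U[of i x] B[of x] by linarith
        show "(\<lambda>i. U i x) \<longlonglongrightarrow> f x" for x by (rule lim)
      qed
    qed
  qed
  then show ?thesis using assms(3) by blast
qed

end

text \<open>Clipping a continuous approximant from below at 1 moves it no further from g >= 1, and
  Stone-Weierstrass then stays uniformly close to it; this secures the lower bound together with the
  L^1 bound.\<close>

lemma trig_polynomial_dense:
  fixes g :: "complex \<Rightarrow> real"
  assumes F: "finite F" "\<And>M. M \<in> F \<Longrightarrow> finite_measure M" "\<And>M. M \<in> F \<Longrightarrow> sets M = sets borel"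
    and sph: "\<And>M. M \<in> F \<Longrightarrow> AE z in M. norm z = 1"
    and g: "g \<in> borel_measurable borel" "\<And>z. 1 \<le> g z" "\<And>z. g z \<le> B" and e: "0 < e"
  obtains p where "real_polynomial_function p" "\<And>z. norm z = 1 \<Longrightarrow> 1 / 2 \<le> p z"
    "\<And>M. M \<in> F \<Longrightarrow> (LINT z|M. \<bar>g z - p z\<bar>) \<le> e"
proof -
  \<comment> \<open>The summand 1 keeps T positive even if all measures vanish.\<close>
  define T where "T = (\<Sum>M\<in>F. measure M (space M)) + 1"
  have "0 \<le> (\<Sum>M\<in>F. measure M (space M))" by (rule sum_nonneg) simp
  then have T0: "0 < T" by (simp add: T_def)
  have TM: "measure M (space M) \<le> T" if "M \<in> F" for M
    using member_le_sum[of M F "\<lambda>M. measure M (space M)"] F(1) that by (simp add: T_def)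
  note T = T0 TM
  \<comment> \<open>d <= 1/2 gives the lower bound for p, and d T <= e/2 bounds the uniform error in
    every measure.\<close>
  define d where "d = min (1 / 2) (e / (2 * T))"
  have d: "0 < d" "d \<le> 1 / 2" "d \<le> e / (2 * T)" using T(1) e by (simp_all add: d_def)
  have dT: "d * T \<le> e / 2"
    using mult_right_mono[OF d(3) less_imp_le[OF T0]] T0 by simp
  have "l1_approx F g"
    by (rule l1_approx_bounded[OF F g(1) _ g(3)]) (use order_trans[OF zero_le_one g(2)] in simp_all)
  then obtain c where c: "continuous_on UNIV c" "bounded (range c)" "\<And>M. M \<in> F \<Longrightarrow> (LINT z|M. \<bar>g z - c z\<bar>) < e / 2"
    using e unfolding l1_approx_def by (meson half_gt_zero)
  define c' where "c' = (\<lambda>z. max 1 (c z))"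
  have c': "continuous_on (sphere 0 1) c'" "continuous_on UNIV c'"
    unfolding c'_def by (intro continuous_intros continuous_on_subset[OF c(1)]; simp)+
  obtain p where p: "real_polynomial_function p" "\<And>z. z \<in> sphere 0 1 \<Longrightarrow> \<bar>c' z - p z\<bar> < d"
    using Stone_Weierstrass_real_polynomial_function[OF compact_sphere c'(1) d(1)] by blast
  show ?thesis
  proof (rule that[OF p(1)])
    fix z :: complex assume "norm z = 1"
    then have "\<bar>c' z - p z\<bar> < d" using p(2)[of z] by simp
    moreover have "1 \<le> c' z" by (simp add: c'_def)
    ultimately show "1 / 2 \<le> p z" using d(2) by (simp add: abs_less_iff)
  next
    fix M assume M: "M \<in> F"
    interpret finite_measure M by (rule F(2)[OF M])
    have "norm (g z) \<le> B" for z using g(2,3)[of z] by simp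
    then have bg: "bounded (range g)" by (auto simp: bounded_iff)
    have i: "integrable M (\<lambda>z. \<bar>g z - c z\<bar>)"
      by (rule integrable_F_diff[OF F M g(1) bg borel_measurable_continuous_onI[OF c(1)] c(2)])
    have "(LINT z|M. \<bar>g z - p z\<bar>) \<le> (LINT z|M. \<bar>g z - c z\<bar> + d)"
    proof (rule integral_mono_AE')
      show "integrable M (\<lambda>z. \<bar>g z - c z\<bar> + d)" using i by simp
      show "AE z in M. \<bar>g z - p z\<bar> \<le> \<bar>g z - c z\<bar> + d"
        using sph[OF M]
      proof eventually_elim
        case (elim z)
        then have "\<bar>c' z - p z\<bar> < d" using p(2)[of z] by simp
        moreover have "\<bar>g z - c' z\<bar> \<le> \<bar>g z - c z\<bar>" using g(2)[of z] by (auto simp: c'_def max_def abs_if)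
        ultimately show ?case by linarith
      qed
      show "AE z in M. 0 \<le> \<bar>g z - c z\<bar> + d" using d(1) by simp
    qed
    also have "\<dots> = (LINT z|M. \<bar>g z - c z\<bar>) + d * measure M (space M)"
      using i by (simp add: mult.commute)
    also have "\<dots> \<le> e"
      using c(3)[OF M] mult_left_mono[OF T(2)[OF M] less_imp_le[OF d(1)]] dT by linarith
    finally show "(LINT z|M. \<bar>g z - p z\<bar>) \<le> e" .
  qed
qed

section \<open>Entropy of the measure\<close>

text \<open>The negative part of \<open>(1 - cos 4\<theta>) log w\<close>, with the conventions \<open>log 0 = -\<infinity>\<close> and \<open>0 * \<infinity> = 0\<close>.\<close>
definition log_deficit :: "(real \<Rightarrow> real) \<Rightarrow> real \<Rightarrow> ennreal" where
  "log_deficit w \<theta> = (if 0 < w \<theta> then ennreal (- ((1 - cos (4 * \<theta>)) * ln (w \<theta>)))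
     else if cos (4 * \<theta>) = 1 then 0 else top)"

lemma fejer4_bounds: "0 \<le> 1 - cos (4 * \<theta>)" "1 - cos (4 * \<theta>) \<le> 2" for \<theta> :: real
  using cos_le_one[of "4 * \<theta>"] cos_ge_minus_one[of "4 * \<theta>"] by linarith+

lemma measurable_dtheta: "f \<in> borel_measurable borel \<Longrightarrow> f \<in> borel_measurable dtheta"
  unfolding measurable_cong_sets[OF sets_dtheta refl] by (rule measurable_restrict_space1)

lemma cis_borel_measurable: "cis \<in> borel_measurable borel"
  by (intro borel_measurable_continuous_onI continuous_intros)

lemma fejer4_measurable: "(\<lambda>\<theta>. 1 - cos (4 * \<theta>)) \<in> borel_measurable dtheta"
  by (intro measurable_dtheta borel_measurable_continuous_onI continuous_intros)

lemma measurable_log_deficit: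
  assumes "w \<in> borel_measurable dtheta"
  shows "log_deficit w \<in> borel_measurable dtheta"
proof -
  have q: "(\<lambda>\<theta>. cos (4 * \<theta>)) \<in> borel_measurable dtheta"
    by (intro measurable_dtheta borel_measurable_continuous_onI continuous_intros)
  note [measurable] = assms q
  show ?thesis unfolding log_deficit_def [abs_def] by measurable
qed

text \<open>\<open>circle_angle\<close> sends \<open>cis (2 * pi)\<close> to 0, so this endpoint has
  to be discarded when w is transported to the circle.\<close>

lemma AE_dtheta_not_2pi: "AE \<theta> in dtheta. \<theta> \<noteq> 2 * pi"
proof -
  have "AE \<theta> in restrict_space lborel {0..2 * pi}. \<theta> \<noteq> 2 * pi"
    by (subst AE_restrict_space_iff) (use AE_lborel_singleton[of "2 * pi"] in auto)
  then show ?thesis unfolding dtheta_eq_density by (subst AE_density) auto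
qed

section \<open>The circle in the angle variable\<close>

lemma borel_imp_circle_measurable: "f \<in> borel_measurable borel \<Longrightarrow> f \<in> borel_measurable unit_circle"
  unfolding unit_circle_def by (rule measurable_restrict_space1)

lemma circle_measurable:
  assumes "sets M = sets unit_circle" "f \<in> borel_measurable borel"
  shows "f \<in> borel_measurable M"
  unfolding measurable_cong_sets[OF assms(1) refl] by (rule borel_imp_circle_measurable) fact

lemma nn_integral_ac_measure:
  assumes w: "w \<in> borel_measurable dtheta" and f: "f \<in> borel_measurable unit_circle"
  shows "(\<integral>\<^sup>+z. f z \<partial>ac_measure w) = (\<integral>\<^sup>+\<theta>. ennreal (w \<theta>) * f (cis \<theta>) \<partial>dtheta)"
proof -
  have "(\<integral>\<^sup>+z. f z \<partial>ac_measure w) = (\<integral>\<^sup>+\<theta>. f (cis \<theta>) \<partial>density dtheta (\<lambda>\<theta>. ennreal (w \<theta>)))"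
    unfolding ac_measure_def by (rule nn_integral_distr) (use cis_measurable_dtheta f in auto)
  also have "\<dots> = (\<integral>\<^sup>+\<theta>. ennreal (w \<theta>) * f (cis \<theta>) \<partial>dtheta)"
    by (rule nn_integral_density) (use measurable_compose[OF cis_measurable_dtheta f] w in auto)
  finally show ?thesis .
qed

text \<open>A Borel inverse of \<open>cis\<close> on [0, 2 pi), which turns w into a function of z.
  Clamping Re z keeps the argument of \<open>arccos\<close> in [-1, 1] on the whole plane, so that
  the function is Borel there.\<close>

definition circle_angle :: "complex \<Rightarrow> real" where
  "circle_angle z = (if 0 \<le> Im z then arccos (max (-1) (min 1 (Re z))) else 2 * pi - arccos (max (-1) (min 1 (Re z))))"

lemma circle_angle_cis:
  assumes "0 \<le> \<theta>" "\<theta> < 2 * pi"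
  shows "circle_angle (cis \<theta>) = \<theta>"
proof (cases "\<theta> \<le> pi")
  case True
  then have "0 \<le> sin \<theta>" using assms by (intro sin_ge_zero)
  then show ?thesis using True assms by (simp add: circle_angle_def arccos_cos)
next
  case False
  then have "sin \<theta> < 0" using assms by (intro sin_lt_zero) auto
  moreover have "arccos (cos \<theta>) = 2 * pi - \<theta>"
    using arccos_cos[of "2 * pi - \<theta>"] False assms by (simp add: cos_diff)
  ultimately show ?thesis by (simp add: circle_angle_def)
qed

lemma circle_angle_measurable: "circle_angle \<in> borel_measurable borel"
proof -
  have "continuous_on UNIV (\<lambda>z. arccos (max (-1) (min 1 (Re z))))"
    by (intro continuous_intros) auto
  then have [measurable]: "(\<lambda>z. arccos (max (-1) (min 1 (Re z)))) \<in> borel_measurable borel"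
    by (rule borel_measurable_continuous_onI)
  have [measurable]: "Im \<in> borel_measurable borel"
    by (intro borel_measurable_continuous_onI continuous_intros)
  show ?thesis unfolding circle_angle_def [abs_def] by measurable
qed

lemma lebesgue_decompositionD:
  assumes "lebesgue_decomposition \<mu> w \<mu>s"
  shows "w \<in> borel_measurable dtheta" and "\<And>\<theta>. \<theta> \<in> {0..2 * pi} \<Longrightarrow> 0 \<le> w \<theta>"
    and "sets \<mu>s = sets unit_circle"
    and "\<And>A. A \<in> sets unit_circle \<Longrightarrow> emeasure \<mu> A = emeasure (ac_measure w) A + emeasure \<mu>s A"
  using assms by (auto simp: lebesgue_decomposition_def)

lemma sets_ac_measure: "sets (ac_measure w) = sets unit_circle"
  by (simp add: ac_measure_def)

section \<open>Finite entropy bounds the approximants from below\<close>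

context
  fixes \<mu> \<mu>s :: "complex measure" and w :: "real \<Rightarrow> real" and \<Phi> :: "nat \<Rightarrow> complex poly"
  assumes mu: "circle_prob \<mu>" and dec: "lebesgue_decomposition \<mu> w \<mu>s"
    and orth: "monic_orthogonal_polys \<mu> \<Phi>"
begin

lemmas w_measurable = lebesgue_decompositionD(1)[OF dec]
  and w_nonneg = lebesgue_decompositionD(2)[OF dec]
  and emeasure_mu = lebesgue_decompositionD(4)[OF dec]

text \<open>The singular part is nonnegative, so the absolutely continuous part lies below mu as a
  measure.\<close>

lemma nn_integral_ac_le:
  assumes "f \<in> borel_measurable unit_circle"
  shows "(\<integral>\<^sup>+\<theta>. ennreal (w \<theta>) * f (cis \<theta>) \<partial>dtheta) \<le> (\<integral>\<^sup>+z. f z \<partial>\<mu>)"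
proof -
  have s: "sets (ac_measure w) = sets \<mu>"
    using circle_probD(3)[OF mu] by (simp add: sets_ac_measure)
  have "ac_measure w \<le> \<mu>"
    unfolding le_measure[OF s] le_fun_def
  proof
    fix A
    show "emeasure (ac_measure w) A \<le> emeasure \<mu> A"
    proof (cases "A \<in> sets unit_circle")
      case True then show ?thesis by (simp add: emeasure_mu)
    next
      case False
      then have "A \<notin> sets (ac_measure w)" by (simp only: sets_ac_measure not_False_eq_True)
      then show ?thesis by (simp add: emeasure_notin_sets)
    qed
  qed
  from nn_integral_mono_measure[OF s this, of f] show ?thesis
    using nn_integral_ac_measure[OF w_measurable assms] by simp
qed

lemma nn_integral_w_le: "(\<integral>\<^sup>+\<theta>. ennreal (w \<theta>) \<partial>dtheta) \<le> 1"
proof -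
  interpret prob_space \<mu> by (rule circle_probD[OF mu])
  show ?thesis using nn_integral_ac_le[of "\<lambda>_. 1"] by (simp add: emeasure_space_1)
qed

text \<open>Since log x <= x and Q <= 2, the positive part is at most 2 w, which is integrable; only
  the negative part decides.\<close>

lemma ext_integral_iff:
  "ext_integral dtheta (\<lambda>\<theta>. ereal (1 - cos (4 * \<theta>)) * elog (w \<theta>)) > -\<infinity> \<longleftrightarrow>
    (\<integral>\<^sup>+\<theta>. log_deficit w \<theta> \<partial>dtheta) < \<infinity>"
proof -
  let ?f = "\<lambda>\<theta>. ereal (1 - cos (4 * \<theta>)) * elog (w \<theta>)"
  have "(\<integral>\<^sup>+\<theta>. e2ennreal (?f \<theta>) \<partial>dtheta) \<le> (\<integral>\<^sup>+\<theta>. 2 * ennreal (w \<theta>) \<partial>dtheta)"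
  proof (rule nn_integral_mono)
    fix \<theta> assume "\<theta> \<in> space dtheta"
    show "e2ennreal (?f \<theta>) \<le> 2 * ennreal (w \<theta>)"
    proof (cases "0 < w \<theta>")
      case True
      have "(1 - cos (4 * \<theta>)) * ln (w \<theta>) \<le> (1 - cos (4 * \<theta>)) * w \<theta>"
        using fejer4_bounds(1)[of \<theta>] ln_le_minus_one[OF True] by (intro mult_left_mono) auto
      also have "\<dots> \<le> 2 * w \<theta>"
        using fejer4_bounds(2)[of \<theta>] True by (intro mult_right_mono) auto
      finally have "e2ennreal (?f \<theta>) \<le> ennreal (2 * w \<theta>)"
        using True by (simp add: elog_def ennreal_leI)
      also have "\<dots> = 2 * ennreal (w \<theta>)"
        using True by (simp add: ennreal_mult)
      finally show ?thesis .
    next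
      case False
      have "?f \<theta> \<le> 0"
        using False fejer4_bounds(1)[of \<theta>] by (auto simp: elog_def intro: order_antisym[OF cos_le_one])
      then show ?thesis by (simp add: e2ennreal_neg)
    qed
  qed
  also have "\<dots> = 2 * (\<integral>\<^sup>+\<theta>. ennreal (w \<theta>) \<partial>dtheta)"
    using w_measurable by (intro nn_integral_cmult) auto
  also have "\<dots> \<le> 2 * 1" by (intro mult_left_mono nn_integral_w_le) auto
  finally have pos: "(\<integral>\<^sup>+\<theta>. e2ennreal (?f \<theta>) \<partial>dtheta) < \<infinity>"
    by (rule le_less_trans) simp
  have neg: "(\<integral>\<^sup>+\<theta>. e2ennreal (- ?f \<theta>) \<partial>dtheta) = (\<integral>\<^sup>+\<theta>. log_deficit w \<theta> \<partial>dtheta)"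
  proof (rule nn_integral_cong)
    fix \<theta>
    show "e2ennreal (- ?f \<theta>) = log_deficit w \<theta>"
    proof (cases "0 < w \<theta>")
      case True then show ?thesis by (simp add: elog_def log_deficit_def)
    next
      case False
      show ?thesis
      proof (cases "cos (4 * \<theta>) = 1")
        case True
        then show ?thesis using False by (simp add: elog_def log_deficit_def e2ennreal_neg zero_ereal_def[symmetric])
      next
        case c: False
        then have "0 < 1 - cos (4 * \<theta>)" using cos_le_one[of "4 * \<theta>"] by linarith
        then have "- ?f \<theta> = \<infinity>" using False by (simp add: elog_def)
        then show ?thesis using False c by (simp add: log_deficit_def)
      qed
    qed
  qed
  have key: "enn2ereal x - enn2ereal y > -\<infinity> \<longleftrightarrow> y < \<infinity>" if "x < \<infinity>" for x y
    using that by (cases x; cases y) (simp_all add: ennreal.rep_eq)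
  show ?thesis unfolding ext_integral_def neg by (rule key[OF pos])
qed

text \<open>The 2 is the bound on Q times the bound 1 on the mean of w / w_N. The latter holds as 1
  / w_N = |Phi_N|^2 / k on the circle, where k is the integral of |Phi_N|^2 over mu.\<close>

lemma bs_entropy_ge:
  assumes fin: "(\<integral>\<^sup>+\<theta>. log_deficit w \<theta> \<partial>dtheta) < \<infinity>"
  shows "- (LINT \<theta>|dtheta. enn2real (log_deficit w \<theta>)) - 2 \<le> bs_entropy (verblunsky \<Phi>) N"
proof -
  define a where "a = verblunsky \<Phi>"
  have a: "norm (a j) < 1" for j unfolding a_def by (rule norm_verblunsky_less_1[OF mu orth])
  define b where "b = (\<lambda>\<theta>. bs_weight a N (cis \<theta>))"
  have b: "0 < b \<theta>" for \<theta> unfolding b_def by (rule bs_weight_pos[OF a]) simp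
  have cb: "continuous_on UNIV b"
    unfolding b_def by (rule continuous_on_cis_compose[OF continuous_on_bs_weight[OF a]])
  have mb: "b \<in> borel_measurable dtheta"
    by (intro measurable_dtheta borel_measurable_continuous_onI cb)
  note m = measurable_log_deficit[OF w_measurable]
  define r where "r = (\<lambda>\<theta>. w \<theta> / b \<theta>)"
  have mr: "r \<in> borel_measurable dtheta"
    unfolding r_def using w_measurable mb by measurable
  have "(\<integral>\<^sup>+\<theta>. ennreal (r \<theta>) \<partial>dtheta) \<le> ennreal 1"
  proof -
    let ?f = "\<lambda>z. ennreal ((norm (poly (\<Phi> N) z))\<^sup>2)"
    define k where "k = (\<Prod>j<N. 1 - (norm (a j))\<^sup>2)"
    have k: "0 < k" unfolding k_def by (rule verblunsky_prod_pos[OF a])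
    have f: "(\<lambda>z. (norm (poly (\<Phi> N) z))\<^sup>2) \<in> borel_measurable unit_circle"
      by (intro borel_imp_circle_measurable borel_measurable_continuous_onI continuous_intros)
    have "(\<integral>\<^sup>+\<theta>. ennreal (r \<theta>) \<partial>dtheta) = (\<integral>\<^sup>+\<theta>. ennreal (1 / k) * (ennreal (w \<theta>) * ?f (cis \<theta>)) \<partial>dtheta)"
    proof (rule nn_integral_cong)
      fix \<theta> assume "\<theta> \<in> space dtheta"
      then have "0 \<le> w \<theta>" by (simp add: w_nonneg)
      moreover have "r \<theta> = 1 / k * (w \<theta> * (norm (poly (\<Phi> N) (cis \<theta>)))\<^sup>2)"
        unfolding r_def b_def bs_weight_def k_def[symmetric] by (simp add: a_def monic_orth_opuc[OF mu orth])
      ultimately show "ennreal (r \<theta>) = ennreal (1 / k) * (ennreal (w \<theta>) * ?f (cis \<theta>))"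
        using k by (simp only: ennreal_mult mult_nonneg_nonneg zero_le_power2 less_imp_le zero_le_divide_1_iff)
    qed
    also have "\<dots> = ennreal (1 / k) * (\<integral>\<^sup>+\<theta>. ennreal (w \<theta>) * ?f (cis \<theta>) \<partial>dtheta)"
      by (intro nn_integral_cmult borel_measurable_times_ennreal measurable_compose[OF _ measurable_ennreal]
          w_measurable measurable_compose[OF cis_measurable_dtheta f])
    also have "\<dots> \<le> ennreal (1 / k) * (\<integral>\<^sup>+z. ?f z \<partial>\<mu>)"
      by (intro mult_left_mono nn_integral_ac_le measurable_compose[OF f measurable_ennreal]) auto
    also have "(\<integral>\<^sup>+z. ?f z \<partial>\<mu>) = ennreal k"
    proof -
      have "integrable \<mu> (\<lambda>z. (norm (poly (\<Phi> N) z))\<^sup>2)"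
        by (intro integrable_mu[OF mu orth] continuous_intros)
      then show ?thesis
        using norm_opuc_prod[OF mu orth, of N] by (subst nn_integral_eq_integral) (auto simp: k_def a_def)
    qed
    also have "ennreal (1 / k) * ennreal k = ennreal 1"
      using k by (simp flip: ennreal_mult)
    finally show ?thesis .
  qed
  then have r1: "(LINT \<theta>|dtheta. r \<theta>) \<le> 1" "(\<integral>\<^sup>+\<theta>. ennreal (r \<theta>) \<partial>dtheta) < \<infinity>"
    by (auto intro: integral_real_bounded le_less_trans)
  have ir: "integrable dtheta r"
    using r1(2) b w_nonneg by (intro integrableI_nonneg mr) (auto simp: r_def intro!: divide_nonneg_pos)
  have ae: "AE \<theta> in dtheta. log_deficit w \<theta> \<noteq> \<infinity>"
    using fin by (intro nn_integral_PInf_AE m) auto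
  have id: "integrable dtheta (\<lambda>\<theta>. enn2real (log_deficit w \<theta>))"
  proof (rule integrableI_nonneg)
    have "(\<integral>\<^sup>+\<theta>. ennreal (enn2real (log_deficit w \<theta>)) \<partial>dtheta) \<le> (\<integral>\<^sup>+\<theta>. log_deficit w \<theta> \<partial>dtheta)"
      by (intro nn_integral_mono) (simp add: ennreal_enn2real_if)
    then show "(\<integral>\<^sup>+\<theta>. ennreal (enn2real (log_deficit w \<theta>)) \<partial>dtheta) < \<infinity>"
      using fin by (rule le_less_trans)
  qed (use m in auto)
  have ib: "integrable dtheta (\<lambda>\<theta>. (1 - cos (4 * \<theta>)) * ln (b \<theta>))"
    unfolding b_def
    by (intro integrable_dtheta_continuous continuous_intros continuous_on_ln_bs_weight[OF a])
  have "(LINT \<theta>|dtheta. - enn2real (log_deficit w \<theta>) - 2 * r \<theta>) \<le> (LINT \<theta>|dtheta. (1 - cos (4 * \<theta>)) * ln (b \<theta>))"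
  proof (rule integral_mono_AE)
    show "AE \<theta> in dtheta. - enn2real (log_deficit w \<theta>) - 2 * r \<theta> \<le> (1 - cos (4 * \<theta>)) * ln (b \<theta>)"
      using ae AE_space
    proof eventually_elim
      case (elim \<theta>)
      define q where "q = 1 - cos (4 * \<theta>)"
      have q: "0 \<le> q" "q \<le> 2" using fejer4_bounds[of \<theta>] by (auto simp: q_def)
      have r0: "0 \<le> r \<theta>" using b[of \<theta>] w_nonneg elim by (simp add: r_def)
      show ?case
      proof (cases "0 < w \<theta>")
        case True
        have "- (q * ln (w \<theta>)) \<le> enn2real (log_deficit w \<theta>)"
          using True by (cases "0 \<le> - (q * ln (w \<theta>))") (auto simp: log_deficit_def q_def[symmetric] ennreal_neg)
        moreover have "q * ln (r \<theta>) \<le> 2 * r \<theta>"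
        proof -
          have "0 < r \<theta>" using True b[of \<theta>] by (simp add: r_def)
          then have "q * ln (r \<theta>) \<le> q * r \<theta>" using q ln_le_minus_one[of "r \<theta>"] by (intro mult_left_mono) auto
          also have "\<dots> \<le> 2 * r \<theta>" using q r0 by (intro mult_right_mono)
          finally show ?thesis .
        qed
        moreover have "q * ln (r \<theta>) = q * ln (w \<theta>) - q * ln (b \<theta>)"
          using True b[of \<theta>] by (simp add: r_def ln_div algebra_simps)
        ultimately show ?thesis unfolding q_def[symmetric] by linarith
      next
        case False
        \<comment> \<open>Where w = 0, a finite deficit forces Q = 0; then the right side is 0 and
          the left side at most 0.\<close>
        then have "q = 0" using elim by (auto simp: log_deficit_def q_def split: if_splits)
        moreover have "0 \<le> enn2real (log_deficit w \<theta>)" by simp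
        ultimately show ?thesis using r0 unfolding q_def[symmetric] by (simp only: mult_zero_left)
      qed
    qed
  qed (intro ib id ir Bochner_Integration.integrable_diff Bochner_Integration.integrable_minus integrable_mult_right)+
  also have "(LINT \<theta>|dtheta. - enn2real (log_deficit w \<theta>) - 2 * r \<theta>) =
      - (LINT \<theta>|dtheta. enn2real (log_deficit w \<theta>)) - 2 * (LINT \<theta>|dtheta. r \<theta>)"
    using id ir by simp
  also have "(LINT \<theta>|dtheta. (1 - cos (4 * \<theta>)) * ln (b \<theta>)) = bs_entropy (verblunsky \<Phi>) N"
    by (simp add: bs_entropy_def b_def a_def)
  finally show ?thesis using r1(1) by linarith
qed

end

section \<open>Bounded approximants force finite entropy\<close>

context
  fixes \<mu> \<mu>s :: "complex measure" and w :: "real \<Rightarrow> real" and \<Phi> :: "nat \<Rightarrow> complex poly" and C :: real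
  assumes mu: "circle_prob \<mu>" and dec: "lebesgue_decomposition \<mu> w \<mu>s"
    and orth: "monic_orthogonal_polys \<mu> \<Phi>" and C: "\<And>N. C \<le> bs_entropy (verblunsky \<Phi>) N"
begin

text \<open>For a positive trigonometric polynomial \<open>p\<close> the elementary bound
  \<open>Q ln (w\<^sub>N p) \<le> 2 w\<^sub>N p\<close> passes to the limit, because the moments of \<open>w\<^sub>N\<close> stabilise.\<close>
lemma entropy_duality_polynomial:
  assumes p: "real_polynomial_function p" and pos: "\<And>z. norm z = 1 \<Longrightarrow> 1 / 2 \<le> p z"
  shows "(LINT \<theta>|dtheta. (1 - cos (4 * \<theta>)) * ln (p (cis \<theta>))) \<le> 2 * (LINT z|\<mu>. p z) - C"
proof -
  define a where "a = verblunsky \<Phi>"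
  have a: "norm (a j) < 1" for j unfolding a_def by (rule norm_verblunsky_less_1[OF mu orth])
  obtain N where N: "(LINT \<theta>|dtheta. p (cis \<theta>) * bs_weight a N (cis \<theta>)) = (LINT z|\<mu>. p z)"
    using bs_mean_real_polynomial[OF mu orth p] unfolding a_def by blast
  have p0: "0 < p z" if "norm z = 1" for z using pos[OF that] by linarith
  have cp: "continuous_on S p" for S
    using p by (intro continuous_on_polymonial_function) (simp add: real_polynomial_function_eq)
  have cpc: "continuous_on S (\<lambda>\<theta>. p (cis \<theta>))" for S by (rule continuous_on_cis_compose[OF cp])
  have clp: "continuous_on S (\<lambda>\<theta>. ln (p (cis \<theta>)))" for S
  proof (intro continuous_on_ln cpc ballI)
    show "p (cis \<theta>) \<noteq> 0" for \<theta> using p0[of "cis \<theta>"] by simp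
  qed
  have cb: "continuous_on S (\<lambda>\<theta>. bs_weight a N (cis \<theta>))" for S
    by (rule continuous_on_cis_compose[OF continuous_on_bs_weight[OF a]])
  have i1: "integrable dtheta (\<lambda>\<theta>. p (cis \<theta>) * bs_weight a N (cis \<theta>))"
    by (intro integrable_dtheta_continuous continuous_intros cpc cb)
  have i2: "integrable dtheta (\<lambda>\<theta>. (1 - cos (4 * \<theta>)) * ln (p (cis \<theta>)))"
    by (intro integrable_dtheta_continuous continuous_intros clp)
  have i3: "integrable dtheta (\<lambda>\<theta>. (1 - cos (4 * \<theta>)) * ln (bs_weight a N (cis \<theta>)))"
    by (intro integrable_dtheta_continuous continuous_intros continuous_on_ln_bs_weight[OF a])
  have "C \<le> bs_entropy a N" using C[of N] by (simp only: a_def)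
  also have "\<dots> \<le> (LINT \<theta>|dtheta. 2 * (p (cis \<theta>) * bs_weight a N (cis \<theta>)) - (1 - cos (4 * \<theta>)) * ln (p (cis \<theta>)))"
    unfolding bs_entropy_def
  proof (rule integral_mono)
    fix \<theta>
    define x where "x = p (cis \<theta>) * bs_weight a N (cis \<theta>)"
    have "0 < p (cis \<theta>)" "0 < bs_weight a N (cis \<theta>)" using p0 bs_weight_pos[OF a] by auto
    then have x: "0 < x" "ln x = ln (p (cis \<theta>)) + ln (bs_weight a N (cis \<theta>))"
      unfolding x_def by (simp_all add: ln_mult)
    have "(1 - cos (4 * \<theta>)) * ln x \<le> (1 - cos (4 * \<theta>)) * x"
      using fejer4_bounds(1)[of \<theta>] ln_le_minus_one[OF x(1)] by (intro mult_left_mono) auto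
    also have "\<dots> \<le> 2 * x" using fejer4_bounds(2)[of \<theta>] x(1) by (intro mult_right_mono) auto
    finally show "(1 - cos (4 * \<theta>)) * ln (bs_weight a N (cis \<theta>)) \<le>
        2 * (p (cis \<theta>) * bs_weight a N (cis \<theta>)) - (1 - cos (4 * \<theta>)) * ln (p (cis \<theta>))"
      unfolding x(2) x_def[symmetric] distrib_left by linarith
  qed (intro i1 i2 i3 Bochner_Integration.integrable_diff integrable_mult_right)+
  also have "\<dots> = 2 * (LINT z|\<mu>. p z) - (LINT \<theta>|dtheta. (1 - cos (4 * \<theta>)) * ln (p (cis \<theta>)))"
    using i1 i2 N by simp
  finally show ?thesis by linarith
qed

text \<open>g is approximated in L^1 of mu for the right side and of arc length for the left side.
  As p >= 1/2, log g - log p <= (g - p) / p <= 2 |g - p|; so with Q <= 2 an error e/6 costs 4 e/6 on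
  the left and 2 e/6 on the right.\<close>

lemma entropy_duality:
  assumes g: "g \<in> borel_measurable borel" "\<And>z. 1 \<le> g z" "\<And>z. g z \<le> B"
  shows "(LINT \<theta>|dtheta. (1 - cos (4 * \<theta>)) * ln (g (cis \<theta>))) \<le> 2 * (LINT z|\<mu>. g z) - C"
proof (rule field_le_epsilon)
  fix e :: real assume e: "0 < e"
  note \<mu> = circle_probD[OF mu]
  have id: "(\<lambda>z. z) \<in> measurable \<mu> borel"
    by (rule circle_measurable[OF \<mu>(3)]) simp
  have cis: "cis \<in> measurable dtheta borel" by (rule measurable_dtheta[OF cis_borel_measurable])
  interpret D: prob_space dtheta by (rule prob_space_dtheta)
  \<comment> \<open>Both measures are pushed forward to the plane, so that they share the Borel
    sigma-algebra.\<close>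
  define M1 where "M1 = distr \<mu> borel (\<lambda>z. z)"
  define M2 where "M2 = distr dtheta borel cis"
  have i1: "(LINT z|M1. f z) = (LINT z|\<mu>. f z)" if "f \<in> borel_measurable borel" for f :: "complex \<Rightarrow> real"
    unfolding M1_def using id that by (rule integral_distr)
  have i2: "(LINT z|M2. f z) = (LINT \<theta>|dtheta. f (cis \<theta>))" if "f \<in> borel_measurable borel" for f :: "complex \<Rightarrow> real"
    unfolding M2_def using cis that by (rule integral_distr)
  obtain p where p: "real_polynomial_function p" "\<And>z. norm z = 1 \<Longrightarrow> 1 / 2 \<le> p z"
    "\<And>M. M \<in> {M1, M2} \<Longrightarrow> (LINT z|M. \<bar>g z - p z\<bar>) \<le> e / 6"
  proof (rule trig_polynomial_dense[of "{M1, M2}" g B "e / 6"])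
    fix M assume M: "M \<in> {M1, M2}"
    show "finite_measure M"
      using M finite_measure.finite_measure_distr[OF \<mu>(2) id] D.finite_measure_distr[OF cis]
      by (auto simp: M1_def M2_def)
    show "sets M = sets borel" using M by (auto simp: M1_def M2_def)
    have s: "{z :: complex \<in> space borel. norm z = 1} \<in> sets borel" by measurable
    have "AE z in M1. norm z = 1"
      unfolding M1_def by (subst AE_distr_iff[OF id s]) (auto simp: \<mu>(4) intro: AE_I2)
    moreover have "AE z in M2. norm z = 1"
      unfolding M2_def by (subst AE_distr_iff[OF cis s]) auto
    ultimately show "AE z in M. norm z = 1" using M by auto
  qed (use g e in auto)
  have cp: "continuous_on S p" for S
    using p(1) by (intro continuous_on_polymonial_function) (simp add: real_polynomial_function_eq)
  then have mp: "p \<in> borel_measurable borel" by (rule borel_measurable_continuous_onI)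
  have mgp: "(\<lambda>z. \<bar>g z - p z\<bar>) \<in> borel_measurable borel" using g(1) mp by measurable
  have d1: "(LINT z|\<mu>. \<bar>g z - p z\<bar>) \<le> e / 6" using p(3)[of M1] i1[OF mgp] by simp
  have d2: "(LINT \<theta>|dtheta. \<bar>g (cis \<theta>) - p (cis \<theta>)\<bar>) \<le> e / 6" using p(3)[of M2] i2[OF mgp] by simp
  have B: "1 \<le> B" using g(2)[of 0] g(3)[of 0] by linarith
  have ig: "integrable \<mu> g"
  proof (rule finite_measure.integrable_const_bound[OF \<mu>(2), where B = B])
    show "g \<in> borel_measurable \<mu>" using measurable_compose[OF id g(1)] .
    show "AE z in \<mu>. norm (g z) \<le> B" using g(2,3) order_trans[OF zero_le_one g(2)] by simp
  qed
  have ip: "integrable \<mu> p" by (intro integrable_mu[OF mu orth] cp)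
  have mgc: "(\<lambda>\<theta>. g (cis \<theta>)) \<in> borel_measurable dtheta" using measurable_compose[OF cis g(1)] .
  have igc: "integrable dtheta (\<lambda>\<theta>. g (cis \<theta>))"
    by (rule D.integrable_const_bound[where B = B])
      (use g(2,3) order_trans[OF zero_le_one g(2)] mgc in auto)
  have ipc: "integrable dtheta (\<lambda>\<theta>. p (cis \<theta>))"
    by (intro integrable_dtheta_continuous continuous_on_cis_compose cp)
  have ilp: "integrable dtheta (\<lambda>\<theta>. (1 - cos (4 * \<theta>)) * ln (p (cis \<theta>)))"
  proof -
    have "p (cis \<theta>) \<noteq> 0" for \<theta> using p(2)[of "cis \<theta>"] by auto
    then show ?thesis
      by (intro integrable_dtheta_continuous continuous_intros continuous_on_ln continuous_on_cis_compose cp) auto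
  qed
  have "(LINT \<theta>|dtheta. (1 - cos (4 * \<theta>)) * ln (g (cis \<theta>))) \<le>
      (LINT \<theta>|dtheta. (1 - cos (4 * \<theta>)) * ln (p (cis \<theta>)) + 4 * \<bar>g (cis \<theta>) - p (cis \<theta>)\<bar>)"
  proof (rule integral_mono)
    show "integrable dtheta (\<lambda>\<theta>. (1 - cos (4 * \<theta>)) * ln (g (cis \<theta>)))"
    proof (rule D.integrable_const_bound[where B = "2 * ln B"])
      show "(\<lambda>\<theta>. (1 - cos (4 * \<theta>)) * ln (g (cis \<theta>))) \<in> borel_measurable dtheta"
        by (intro borel_measurable_times fejer4_measurable borel_measurable_ln mgc)
      show "AE \<theta> in dtheta. norm ((1 - cos (4 * \<theta>)) * ln (g (cis \<theta>))) \<le> 2 * ln B"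
      proof (rule AE_I2)
        fix \<theta>
        have "0 \<le> ln (g (cis \<theta>))" "ln (g (cis \<theta>)) \<le> ln B" using g(2,3)[of "cis \<theta>"] by auto
        then show "norm ((1 - cos (4 * \<theta>)) * ln (g (cis \<theta>))) \<le> 2 * ln B"
          using fejer4_bounds[of \<theta>] by (simp add: abs_mult mult_mono)
      qed
    qed
    fix \<theta>
    have p2: "1 / 2 \<le> p (cis \<theta>)" by (rule p(2)) simp
    have g1: "1 \<le> g (cis \<theta>)" by (rule g)
    have "ln (g (cis \<theta>)) - ln (p (cis \<theta>)) = ln (g (cis \<theta>) / p (cis \<theta>))"
      using p2 g1 by (simp add: ln_div)
    also have "\<dots> \<le> g (cis \<theta>) / p (cis \<theta>) - 1"
      using p2 g1 by (intro ln_le_minus_one divide_pos_pos) linarith+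
    also have "\<dots> = (g (cis \<theta>) - p (cis \<theta>)) / p (cis \<theta>)"
      using p2 by (simp add: diff_divide_distrib)
    also have "\<dots> \<le> \<bar>g (cis \<theta>) - p (cis \<theta>)\<bar> / p (cis \<theta>)"
      using p2 by (intro divide_right_mono) auto
    also have "\<dots> \<le> \<bar>g (cis \<theta>) - p (cis \<theta>)\<bar> / (1 / 2)"
      using p2 by (intro divide_left_mono) auto
    finally have l: "ln (g (cis \<theta>)) - ln (p (cis \<theta>)) \<le> 2 * \<bar>g (cis \<theta>) - p (cis \<theta>)\<bar>" by simp
    have "(1 - cos (4 * \<theta>)) * (ln (g (cis \<theta>)) - ln (p (cis \<theta>))) \<le> (1 - cos (4 * \<theta>)) * (2 * \<bar>g (cis \<theta>) - p (cis \<theta>)\<bar>)"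
      using fejer4_bounds(1)[of \<theta>] l by (intro mult_left_mono)
    also have "\<dots> \<le> 2 * (2 * \<bar>g (cis \<theta>) - p (cis \<theta>)\<bar>)"
      using fejer4_bounds(2)[of \<theta>] by (intro mult_right_mono) auto
    finally show "(1 - cos (4 * \<theta>)) * ln (g (cis \<theta>)) \<le>
        (1 - cos (4 * \<theta>)) * ln (p (cis \<theta>)) + 4 * \<bar>g (cis \<theta>) - p (cis \<theta>)\<bar>"
      unfolding right_diff_distrib by linarith
  qed (intro ilp Bochner_Integration.integrable_add integrable_mult_right integrable_abs Bochner_Integration.integrable_diff igc ipc)
  also have "\<dots> = (LINT \<theta>|dtheta. (1 - cos (4 * \<theta>)) * ln (p (cis \<theta>))) + 4 * (LINT \<theta>|dtheta. \<bar>g (cis \<theta>) - p (cis \<theta>)\<bar>)"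
    using ilp igc ipc by simp
  also have "\<dots> \<le> 2 * (LINT z|\<mu>. p z) - C + 4 * (e / 6)"
    using entropy_duality_polynomial[OF p(1,2)] d2 by linarith
  also have "(LINT z|\<mu>. p z) \<le> (LINT z|\<mu>. g z) + e / 6"
  proof -
    have "(LINT z|\<mu>. p z) - (LINT z|\<mu>. g z) = (LINT z|\<mu>. p z - g z)" using ig ip by simp
    also have "\<dots> \<le> (LINT z|\<mu>. \<bar>g z - p z\<bar>)" using ig ip by (intro integral_mono) auto
    finally show ?thesis using d1 by linarith
  qed
  finally show "(LINT \<theta>|dtheta. (1 - cos (4 * \<theta>)) * ln (g (cis \<theta>))) \<le> 2 * (LINT z|\<mu>. g z) - C + e"
    by (simp add: algebra_simps)
qed

text \<open>Setting the test function to 1 on N hides the singular part from mu without affecting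
  the arc length integral. Truncation at k makes the duality applicable, and monotone convergence
  removes it, because the bound does not depend on k.\<close>

lemma log_deficit_finite: "(\<integral>\<^sup>+\<theta>. log_deficit w \<theta> \<partial>dtheta) < \<infinity>"
proof -
  note \<mu> = circle_probD[OF mu]
  interpret prob_space \<mu> by (rule \<mu>)
  interpret D: prob_space dtheta by (rule prob_space_dtheta)
  note w = lebesgue_decompositionD(1,2)[OF dec]
  obtain N where N: "N \<in> sets unit_circle" "emeasure (ac_measure (\<lambda>_. 1)) N = 0"
      "emeasure \<mu>s (space unit_circle - N) = 0"
    using dec unfolding lebesgue_decomposition_def by blast
  have Nb: "N \<in> sets borel"
    using N(1) unfolding unit_circle_def by (subst (asm) sets_restrict_space_iff) auto
  have cis: "cis \<in> measurable dtheta borel" by (rule measurable_dtheta[OF cis_borel_measurable])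
  have aeN: "AE \<theta> in dtheta. cis \<theta> \<notin> N"
  proof -
    have m: "(\<lambda>\<theta>. indicator N (cis \<theta>) :: ennreal) \<in> borel_measurable dtheta"
      by (rule measurable_compose[OF cis]) (use Nb in measurable)
    have "(\<integral>\<^sup>+\<theta>. indicator N (cis \<theta>) \<partial>dtheta) = 0"
      using N(2) emeasure_ac_measure[OF _ N(1), of "\<lambda>_. 1"] by simp
    then have "AE \<theta> in dtheta. indicator N (cis \<theta>) = (0 :: ennreal)"
      by (simp only: nn_integral_0_iff_AE[OF m])
    then show ?thesis by eventually_elim (auto simp: indicator_def split: if_splits)
  qed
  define W where "W = (\<lambda>z. indicator {0..2 * pi} (circle_angle z) *\<^sub>R w (circle_angle z))"
  have W0: "0 \<le> W z" for z using w(2)[of "circle_angle z"] by (auto simp: W_def indicator_def)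
  have mW: "W \<in> borel_measurable borel"
  proof -
    have "(\<lambda>\<theta>. indicator {0..2 * pi} \<theta> *\<^sub>R w \<theta>) \<in> borel_measurable borel"
      using w(1) unfolding measurable_cong_sets[OF sets_dtheta refl]
      by (subst (asm) borel_measurable_restrict_space_iff) auto
    from measurable_compose[OF circle_angle_measurable this] show ?thesis by (simp only: W_def)
  qed
  have Wcis: "W (cis \<theta>) = w \<theta>" if "\<theta> \<in> {0..2 * pi}" "\<theta> \<noteq> 2 * pi" for \<theta>
    using that circle_angle_cis[of \<theta>] by (simp add: W_def)
  \<comment> \<open>This is min(k, 1 / W) off N, written so that W = 0 gives k and not 1 / 0 =
    0.\<close>
  define h where "h = (\<lambda>(k::nat) z. if z \<in> N then 0 else if W z * real k \<le> 1 then real k else 1 / W z)"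
  have h0: "0 \<le> h k z" for k z using W0[of z] by (simp add: h_def)
  have Wpos: "0 < W z" if "\<not> W z * real k \<le> 1" for z k
    using that W0[of z] by (cases "W z = 0") auto
  have hk: "h k z \<le> real k" for k z
    using Wpos[of z k] by (auto simp: h_def pos_divide_le_eq mult.commute)
  have hW: "W z * h k z \<le> 1" for k z using Wpos[of z k] by (auto simp: h_def)
  have mh: "h k \<in> borel_measurable borel" for k
    unfolding h_def using mW Nb by measurable
  have hmono: "h k z \<le> h l z" if "k \<le> l" for k l z
  proof -
    have "W z * real k \<le> W z * real l" using that W0[of z] by (intro mult_left_mono) auto
    then show ?thesis using that Wpos[of z k] Wpos[of z l]
      by (auto simp: h_def pos_le_divide_eq mult.commute)
  qed
  have hmu: "(LINT z|\<mu>. h k z) \<le> 1" for k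
  proof (rule integral_real_bounded)
    define Nc where "Nc = space unit_circle - N"
    have Nc: "Nc \<in> sets unit_circle" using N(1) by (simp add: Nc_def sets.compl_sets del: space_unit_circle)
    \<comment> \<open>Off N the measures mu and \<open>ac_measure w\<close> coincide; as h vanishes
      on N, its integral over mu reduces to that of w h <= 1.\<close>
    have eq: "density \<mu> (indicator Nc) = density (ac_measure w) (indicator Nc)"
    proof (rule measure_eqI)
      show "sets (density \<mu> (indicator Nc)) = sets (density (ac_measure w) (indicator Nc))"
        using \<mu>(3) by (simp add: sets_ac_measure)
      fix A assume "A \<in> sets (density \<mu> (indicator Nc))"
      then have A: "A \<in> sets unit_circle" using \<mu>(3) by simp
      then have NA: "Nc \<inter> A \<in> sets unit_circle" using Nc by blast
      have "emeasure \<mu>s (Nc \<inter> A) \<le> emeasure \<mu>s Nc"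
        using Nc lebesgue_decompositionD(3)[OF dec] by (intro emeasure_mono) auto
      then have "emeasure \<mu>s (Nc \<inter> A) = 0" using N(3) by (simp add: Nc_def)
      then have e: "emeasure \<mu> (Nc \<inter> A) = emeasure (ac_measure w) (Nc \<inter> A)"
        using lebesgue_decompositionD(4)[OF dec NA] by simp
      have "emeasure (density M (indicator Nc)) A = emeasure M (Nc \<inter> A)" if "sets M = sets unit_circle" for M
        using A Nc that NA by (subst emeasure_density) (auto simp: indicator_inter_arith[symmetric])
      then show "emeasure (density \<mu> (indicator Nc)) A = emeasure (density (ac_measure w) (indicator Nc)) A"
        using e \<mu>(3) sets_ac_measure by simp
    qed
    have mhe: "(\<lambda>z. ennreal (h k z)) \<in> borel_measurable unit_circle"
      by (intro borel_imp_circle_measurable measurable_compose[OF mh measurable_ennreal])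
    have mi: "(indicator Nc :: complex \<Rightarrow> ennreal) \<in> borel_measurable unit_circle" using Nc by measurable
    have dens: "(\<integral>\<^sup>+z. ennreal (h k z) \<partial>density M (indicator Nc)) = (\<integral>\<^sup>+z. indicator Nc z * ennreal (h k z) \<partial>M)"
      if "sets M = sets unit_circle" for M
      using mhe mi unfolding measurable_cong_sets[OF that refl, symmetric] by (intro nn_integral_density)
    have "(\<integral>\<^sup>+z. ennreal (h k z) \<partial>\<mu>) = (\<integral>\<^sup>+z. indicator Nc z * ennreal (h k z) \<partial>\<mu>)"
      by (rule nn_integral_cong) (auto simp: Nc_def \<mu>(4) h_def indicator_def)
    also have "\<dots> = (\<integral>\<^sup>+z. indicator Nc z * ennreal (h k z) \<partial>ac_measure w)"
      unfolding dens[OF \<mu>(3), symmetric] dens[OF sets_ac_measure, symmetric] eq ..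
    also have "\<dots> = (\<integral>\<^sup>+\<theta>. ennreal (w \<theta>) * (indicator Nc (cis \<theta>) * ennreal (h k (cis \<theta>))) \<partial>dtheta)"
      by (intro nn_integral_ac_measure w borel_measurable_times_ennreal mi mhe)
    also have "\<dots> \<le> (\<integral>\<^sup>+\<theta>. 1 \<partial>dtheta)"
    proof (rule nn_integral_mono_AE)
      show "AE \<theta> in dtheta. ennreal (w \<theta>) * (indicator Nc (cis \<theta>) * ennreal (h k (cis \<theta>))) \<le> 1"
        using AE_dtheta_not_2pi AE_space
      proof eventually_elim
        case (elim \<theta>)
        then have "w \<theta> * h k (cis \<theta>) \<le> 1" using hW[of "cis \<theta>" k] Wcis[of \<theta>] by simp
        then have "ennreal (w \<theta>) * ennreal (h k (cis \<theta>)) \<le> 1"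
          using w(2)[of \<theta>] elim h0 by (simp flip: ennreal_mult)
        then show ?case by (simp add: indicator_def)
      qed
    qed
    also have "\<dots> = 1" using D.emeasure_space_1 by simp
    finally show "(\<integral>\<^sup>+z. ennreal (h k z) \<partial>\<mu>) \<le> ennreal 1" by simp
  qed simp
  define u where "u = (\<lambda>k \<theta>. (1 - cos (4 * \<theta>)) * ln (1 + h k (cis \<theta>)))"
  have u0: "0 \<le> u k \<theta>" for k \<theta>
    unfolding u_def using fejer4_bounds(1)[of \<theta>] h0[of k "cis \<theta>"] by (intro mult_nonneg_nonneg) auto
  have mu': "u k \<in> borel_measurable dtheta" for k
    unfolding u_def using measurable_compose[OF cis mh]
    by (intro borel_measurable_times fejer4_measurable borel_measurable_ln borel_measurable_add) auto
  \<comment> \<open>4 - C is 2 (1 + 1) - C: mu has mass 1, and the integral of h is at most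
    1.\<close>
  have uint: "(\<integral>\<^sup>+\<theta>. ennreal (u k \<theta>) \<partial>dtheta) \<le> ennreal (4 - C)" for k
  proof -
    have iu: "integrable dtheta (u k)"
    proof (rule D.integrable_const_bound[where B = "2 * ln (1 + real k)"])
      show "AE \<theta> in dtheta. norm (u k \<theta>) \<le> 2 * ln (1 + real k)"
      proof (rule AE_I2)
        fix \<theta>
        have "0 \<le> ln (1 + h k (cis \<theta>))" "ln (1 + h k (cis \<theta>)) \<le> ln (1 + real k)"
          using h0[of k "cis \<theta>"] hk[of k "cis \<theta>"] by auto
        then show "norm (u k \<theta>) \<le> 2 * ln (1 + real k)"
          unfolding u_def using fejer4_bounds[of \<theta>] by (simp add: abs_mult mult_mono)
      qed
    qed (rule mu')
    have ih: "integrable \<mu> (h k)"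
    proof (rule integrable_const_bound[where B = "real k"])
      have id: "(\<lambda>z. z) \<in> measurable \<mu> borel"
        by (rule circle_measurable[OF \<mu>(3)]) simp
      show "h k \<in> borel_measurable \<mu>" using measurable_compose[OF id mh] .
      show "AE z in \<mu>. norm (h k z) \<le> real k" using h0 hk by simp
    qed
    have "(LINT \<theta>|dtheta. u k \<theta>) \<le> 2 * (LINT z|\<mu>. 1 + h k z) - C"
      unfolding u_def
      by (rule entropy_duality[where B = "1 + real k"]) (use mh h0 hk in auto)
    also have "(LINT z|\<mu>. 1 + h k z) = 1 + (LINT z|\<mu>. h k z)"
      using ih by (simp add: prob_space)
    also have "2 * (1 + (LINT z|\<mu>. h k z)) - C \<le> 4 - C" using hmu[of k] by simp
    finally have "(LINT \<theta>|dtheta. u k \<theta>) \<le> 4 - C" .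
    then show ?thesis
      using u0 iu by (subst nn_integral_eq_integral) (auto intro: ennreal_leI)
  qed
  have "(\<integral>\<^sup>+\<theta>. log_deficit w \<theta> \<partial>dtheta) \<le> (\<integral>\<^sup>+\<theta>. (SUP k. ennreal (u k \<theta>)) \<partial>dtheta)"
  proof (rule nn_integral_mono_AE)
    show "AE \<theta> in dtheta. log_deficit w \<theta> \<le> (SUP k. ennreal (u k \<theta>))"
      using aeN AE_dtheta_not_2pi AE_space
    proof eventually_elim
      case (elim \<theta>)
      define q where "q = 1 - cos (4 * \<theta>)"
      have q: "0 \<le> q" using fejer4_bounds(1)[of \<theta>] by (simp add: q_def)
      have Ww: "W (cis \<theta>) = w \<theta>" using elim by (intro Wcis) auto
      show ?case
      proof (cases "0 < w \<theta>")
        case True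
        \<comment> \<open>Beyond 1 / w the truncation is inactive, so a single k already dominates
          the deficit.\<close>
        obtain k :: nat where k: "1 / w \<theta> < real k" using reals_Archimedean2 by blast
        then have "1 < w \<theta> * real k" using True by (simp add: pos_divide_less_eq mult.commute)
        then have "h k (cis \<theta>) = 1 / w \<theta>" using elim by (simp add: h_def Ww)
        moreover have "- ln (w \<theta>) \<le> ln (1 + 1 / w \<theta>)"
        proof -
          have "- ln (w \<theta>) = ln (1 / w \<theta>)" using True by (simp add: ln_div)
          also have "\<dots> \<le> ln (1 + 1 / w \<theta>)" using True by (subst ln_le_cancel_iff) (auto simp: add_pos_pos)
          finally show ?thesis .
        qed
        ultimately have "- (q * ln (w \<theta>)) \<le> u k \<theta>"
          unfolding u_def q_def[symmetric] using mult_left_mono[OF _ q] by fastforce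
        then have "log_deficit w \<theta> \<le> ennreal (u k \<theta>)"
          using True by (simp add: log_deficit_def q_def[symmetric] ennreal_leI)
        then show ?thesis by (rule order_trans) (rule SUP_upper, simp)
      next
        case False
        then have w0: "w \<theta> = 0" using w(2)[of \<theta>] elim by simp
        show ?thesis
        proof (cases "q = 0")
          case True then show ?thesis using False by (simp add: log_deficit_def q_def)
        next
          case qn: False
          then have q: "0 < q" using q by simp
          \<comment> \<open>Where w = 0 and Q > 0 the value h_k = k makes u_k unbounded, matching
            the infinite deficit.\<close>
          have uk: "u k \<theta> = q * ln (1 + real k)" for k
            using elim by (simp add: u_def h_def Ww w0 q_def)
          have "(SUP k. ennreal (u k \<theta>)) = top"
            unfolding SUP_eq_top_iff
          proof (intro allI impI)
            fix x :: ennreal assume "x < top"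
            then obtain r where r: "0 \<le> r" "x = ennreal r" by (cases x) auto
            obtain k :: nat where "exp ((r + 1) / q) < real k" using reals_Archimedean2 by blast
            then have "exp ((r + 1) / q) < 1 + real k" by simp
            then have "(r + 1) / q < ln (1 + real k)"
              by (metis exp_gt_zero ln_exp ln_less_cancel_iff order_less_trans)
            then have "r < u k \<theta>" unfolding uk using q by (simp add: pos_divide_less_eq mult.commute)
            then show "\<exists>i\<in>UNIV. x < ennreal (u i \<theta>)"
              using r by (intro bexI[of _ k]) (auto intro: ennreal_lessI)
          qed
          then show ?thesis by (simp only: top_greatest)
        qed
      qed
    qed
  qed
  also have "\<dots> = (SUP k. \<integral>\<^sup>+\<theta>. ennreal (u k \<theta>) \<partial>dtheta)"
  proof (rule nn_integral_monotone_convergence_SUP)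
    show "incseq (\<lambda>k \<theta>. ennreal (u k \<theta>))"
    proof (intro incseq_SucI le_funI ennreal_leI)
      fix k \<theta>
      have "ln (1 + h k (cis \<theta>)) \<le> ln (1 + h (Suc k) (cis \<theta>))"
        using hmono[of k "Suc k" "cis \<theta>"] h0[of k "cis \<theta>"] by (subst ln_le_cancel_iff) auto
      then show "u k \<theta> \<le> u (Suc k) \<theta>"
        unfolding u_def using fejer4_bounds(1)[of \<theta>] by (intro mult_left_mono)
    qed
    show "(\<lambda>\<theta>. ennreal (u k \<theta>)) \<in> borel_measurable dtheta" for k
      by (rule measurable_compose[OF mu' measurable_ennreal])
  qed
  also have "\<dots> \<le> ennreal (4 - C)" by (rule SUP_least) (rule uint)
  finally show ?thesis by (rule le_less_trans) simp
qed

end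

theorem theorem4p45:
  fixes \<mu> \<mu>s :: "complex measure" and w :: "real \<Rightarrow> real"
    and \<Phi> :: "nat \<Rightarrow> complex poly" and \<alpha> :: "nat \<Rightarrow> complex"
  assumes "circle_prob \<mu>"
    and "lebesgue_decomposition \<mu> w \<mu>s"
    and "monic_orthogonal_polys \<mu> \<Phi>"
    and "\<alpha> = verblunsky \<Phi>"
    and "in_ell 6 \<alpha>"
    and "in_ell 2 (\<lambda>n. left_shift \<alpha> n - \<alpha> n)"
  shows "ext_integral dtheta (\<lambda>\<theta>. ereal (1 - cos (4 * \<theta>)) * elog (w \<theta>)) > -\<infinity>
         \<longleftrightarrow> in_ell 4 \<alpha>"
proof -
  have "(\<integral>\<^sup>+\<theta>. log_deficit w \<theta> \<partial>dtheta) < \<infinity> \<longleftrightarrow> (\<exists>C. \<forall>N. C \<le> bs_entropy (verblunsky \<Phi>) N)"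
    using bs_entropy_ge[OF assms(1-3)] log_deficit_finite[OF assms(1-3)] by blast
  moreover have "(\<exists>C. \<forall>N. C \<le> bs_entropy \<alpha> N) \<longleftrightarrow> in_ell 4 \<alpha>"
    unfolding in_ell_def
    by (rule bs_entropy_bounded_below_iff)
      (use assms norm_verblunsky_less_1[OF assms(1,3)] in \<open>auto simp: in_ell_def left_shift_def\<close>)
  ultimately show ?thesis
    using ext_integral_iff[OF assms(1-3)] assms(4) by simp
qed

end
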